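(* Let $\{Z(t),t\ge 0\}$ be a critical Markov branching process with infinitesimal generating function $f$, let $0<\nu<1$, and suppose that $f(1-y)=y\Lambda(y)$ for all $y\in(0,1]$, where $\Lambda(y)=y^{\nu}\mathcal{L}(1/y)$ with $\mathcal{L}$ slowly varying at infinity, and that $\dfrac{y\Lambda'(y)}{\Lambda(y)}=\nu+\delta(y)$, where $\delta$ is continuous, $\delta(y)\to 0$ as $y\downarrow 0$, and moreover $\delta(y)=\Lambda(y)$ for all $y\in(0,1]$. Let $q(t)=\mathbb{P}\{Z(t)>0\mid Z(0)=1\}$, let $\{W(t),t\ge0\}$ be the associated Markov Q-process with $W(0)=1$, let $D(t;x)=\mathbb{P}\{q(t)W(t)\le x\}$, and let $D(x)$ be the distribution function on $[0,\infty)$ with Laplace transform $$\int_0^{\infty}e^{-\theta x}\,dD(x)=\frac{1}{(1+\theta^{\nu})^{1+1/\nu}} .$$ Then $$\sup_{x\in(0,\infty)}\bigl|D(t;x)-D(x)\bigr|=\mathcal{O}\left(\frac{\ln t}{t}\right)\qquad\text{as } t\to\infty .$$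
   Context: A Markov branching process (MBP) is a homogeneous continuous-time Markov process $\{Z(t),t\ge0\}$ with state space $\mathcal{S}_0=\{0\}\cup\mathcal{S}$, $\mathcal{S}\subset\mathbb{N}=\{1,2,\dots\}$, whose transition probabilities $P_{ij}(t)=\mathbb{P}\{Z(t)=j\mid Z(0)=i\}$ satisfy the branching property $P_{ij}(t)=P_{1j}^{i*}(t)$ ($i$-fold convolution) and $P_{1j}(\varepsilon)=\delta_{1j}+a_j\varepsilon+o(\varepsilon)$ as $\varepsilon\downarrow0$ ($\delta_{1j}$ is Kronecker's delta), where $a_j\ge0$ for $j\ne1$ and $0<a_0<-a_1=\sum_{j\in\mathcal{S}_0\setminus\{1\}}a_j<\infty$. Its infinitesimal generating function is $f(s)=\sum_{j\in\mathcal{S}_0}a_js^j$, $s\in[0,1)$. The generating function $F(t;s)=\sum_{j\in\mathcal{S}_0}P_{1j}(t)s^j$ is the unique solution of $\partial F/\partial t=f(F)$, $F(0;s)=s$. The process is critical if $f'(1-)=\sum_{j\in\mathcal S}ja_j=0$. A positive function $\mathcal{L}$ is slowly varying at infinity (in the sense of Karamata) if $\mathcal{L}(\lambda x)/\mathcal{L}(x)\to1$ as $x\to\infty$ for every $\lambda>0$. Markov Q-process (MQP): with $\mathcal{H}=\inf\{t:Z(t)=0\}$ the extinction time, the MQP is the continuous-time Markov chain $\{W(t),t\ge0\}$ with state space $\mathcal{E}\subset\mathbb{N}$ and transition probabilities $\mathcal{Q}_{ij}(t)=\lim_{u\to\infty}\mathbb{P}\{Z(t)=j\mid Z(0)=i,\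 t+u<\mathcal{H}<\infty\}=\frac{j}{i}P_{ij}(t)$ (critical case). Its generating function started from $1$ is $G(t;s)=\mathbb{E}[s^{W(t)}\mid W(0)=1]=s\,f(F(t;s))/f(s)$. It is known that $D(t;x)\to D(x)$ as $t\to\infty$. *)

theory Defs
  imports
    "HOL-Probability.Probability"
    "HOL-Library.Landau_Symbols"
    "HOL-Computational_Algebra.Formal_Power_Series"
begin

text \<open>
  Time is the type of reals, restricted to nonnegative values; \<open>p t i j\<close> is the probability of
  moving from \<open>i\<close> to \<open>j\<close> in time \<open>t\<close>.
\<close>

locale markov_chain = prob_space M for M :: "'a measure" +
  fixes X :: "real \<Rightarrow> 'a \<Rightarrow> nat"
    and E :: "nat set"
    and p :: "real \<Rightarrow> nat \<Rightarrow> nat \<Rightarrow> real"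
  assumes measurable_X: "0 \<le> t \<Longrightarrow> X t \<in> measurable M (count_space UNIV)"
    and X_in_E: "0 \<le> t \<Longrightarrow> \<omega> \<in> space M \<Longrightarrow> X t \<omega> \<in> E"
    and markov:
      "0 \<le> \<tau> 0 \<Longrightarrow> (\<And>k. k \<le> n \<Longrightarrow> \<tau> k \<le> \<tau> (Suc k)) \<Longrightarrow>
       0 < \<P>(\<omega> in M. \<forall>k\<le>n. X (\<tau> k) \<omega> = x k) \<Longrightarrow>
       \<P>(\<omega> in M. X (\<tau> (Suc n)) \<omega> = x (Suc n) \<bar> \<forall>k\<le>n. X (\<tau> k) \<omega> = x k)
         = p (\<tau> (Suc n) - \<tau> n) (x n) (x (Suc n))"

text \<open>
  A branching process is given by one process \<open>Z\<close> and a family of laws \<open>P\<close>, where \<open>P i\<close> is the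
  conditional law given that the process starts in \<open>i\<close>.
\<close>

definition trans_prob ::
    "(nat \<Rightarrow> 'a measure) \<Rightarrow> (real \<Rightarrow> 'a \<Rightarrow> nat) \<Rightarrow> real \<Rightarrow> nat \<Rightarrow> nat \<Rightarrow> real" where
  "trans_prob P Z t i j = \<P>(\<omega> in P i. Z t \<omega> = j)"

text \<open>
  The \<open>i\<close>-fold convolution of a sequence is the coefficient sequence of the \<open>i\<close>-th power of its
  formal power series. Since \<^typ>\<open>nat\<close> carries the discrete topology, right-continuous paths are
  right-continuous step functions; this makes the extinction time below a random variable.
\<close>

locale markov_branching_process =
  fixes P :: "nat \<Rightarrow> 'a measure"
    and Z :: "real \<Rightarrow> 'a \<Rightarrow> nat"
    and S :: "nat set"
    and a :: "nat \<Rightarrow> real"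
  assumes S_subset: "S \<subseteq> {1..}"
    and one_in_S: "1 \<in> S"
    and chain: "i \<in> insert 0 S \<Longrightarrow> markov_chain (P i) Z (insert 0 S) (trans_prob P Z)"
    and start: "i \<in> insert 0 S \<Longrightarrow> AE \<omega> in P i. Z 0 \<omega> = i"
    and right_continuous:
      "i \<in> insert 0 S \<Longrightarrow> \<omega> \<in> space (P i) \<Longrightarrow> 0 \<le> t \<Longrightarrow> continuous (at_right t) (\<lambda>u. Z u \<omega>)"
    and branching:
      "i \<in> insert 0 S \<Longrightarrow> 0 \<le> t \<Longrightarrow>
       trans_prob P Z t i j = fps_nth (Abs_fps (trans_prob P Z t 1) ^ i) j"
    and infinitesimal:
      "j \<in> insert 0 S \<Longrightarrow>
       (\<lambda>\<epsilon>. trans_prob P Z \<epsilon> 1 j - (of_bool (j = 1) + a j * \<epsilon>)) \<in> o[at_right 0](\<lambda>\<epsilon>. \<epsilon>)"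
    and a_nonneg: "j \<in> insert 0 S \<Longrightarrow> j \<noteq> 1 \<Longrightarrow> 0 \<le> a j"
    and a_0_pos: "0 < a 0"
    and a_0_less: "a 0 < - a 1"
    and a_has_sum: "(a has_sum (- a 1)) (insert 0 S - {1})"

definition infinitesimal_gf :: "nat set \<Rightarrow> (nat \<Rightarrow> real) \<Rightarrow> real \<Rightarrow> real" where
  "infinitesimal_gf S a s = (\<Sum>\<^sub>\<infinity>j\<in>insert 0 S. a j * s ^ j)"

definition critical :: "nat set \<Rightarrow> (nat \<Rightarrow> real) \<Rightarrow> bool" where
  "critical S a \<longleftrightarrow> ((\<lambda>j. real j * a j) has_sum 0) S"

definition survival_prob :: "(nat \<Rightarrow> 'a measure) \<Rightarrow> (real \<Rightarrow> 'a \<Rightarrow> nat) \<Rightarrow> real \<Rightarrow> real" where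
  "survival_prob P Z t = \<P>(\<omega> in P 1. Z t \<omega> > 0)"

text \<open>The infimum of the empty set is \<open>\<infinity>\<close> here.\<close>

definition extinction_time :: "(real \<Rightarrow> 'a \<Rightarrow> nat) \<Rightarrow> 'a \<Rightarrow> ereal" where
  "extinction_time Z \<omega> = (INF t\<in>{t. 0 \<le> t \<and> Z t \<omega> = 0}. ereal t)"

definition Q_trans_prob ::
    "(nat \<Rightarrow> 'a measure) \<Rightarrow> (real \<Rightarrow> 'a \<Rightarrow> nat) \<Rightarrow> real \<Rightarrow> nat \<Rightarrow> nat \<Rightarrow> real" where
  "Q_trans_prob P Z t i j =
     Lim at_top (\<lambda>u. \<P>(\<omega> in P i. Z t \<omega> = j
                       \<bar> ereal (t + u) < extinction_time Z \<omega> \<and> extinction_time Z \<omega> < \<infinity>))"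

locale markov_Q_process = markov_chain N W E "Q_trans_prob P Z"
  for P :: "nat \<Rightarrow> 'a measure"
    and Z :: "real \<Rightarrow> 'a \<Rightarrow> nat"
    and N :: "'b measure"
    and W :: "real \<Rightarrow> 'b \<Rightarrow> nat"
    and E :: "nat set" +
  assumes E_subset: "E \<subseteq> {1..}"

definition slowly_varying :: "(real \<Rightarrow> real) \<Rightarrow> bool" where
  "slowly_varying L \<longleftrightarrow>
     (\<forall>x>0. 0 < L x) \<and> (\<forall>c>0. ((\<lambda>x. L (c * x) / L x) \<longlongrightarrow> 1) at_top)"

end

theory Submission
  imports
    Defs
    "HOL-Complex_Analysis.Complex_Analysis"
    "HOL-Real_Asymp.Real_Asymp"
begin

text \<open>
  Because \<open>\<delta> = \<Lambda>\<close>, the regularity hypothesis is the ordinary differential equation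
  \<open>y \<Lambda>' = \<Lambda> (\<nu> + \<Lambda>)\<close>, whose positive solutions are \<open>\<Lambda> y = \<nu> C y\<^sup>\<nu> / (1 - C y\<^sup>\<nu>)\<close> with \<open>0 < C < 1\<close>.
  The backward equation \<open>\<partial>F/\<partial>t = f(F)\<close> then integrates to
  \<open>A\<^sup>-\<^sup>\<nu> + C \<nu> ln A = B\<^sup>-\<^sup>\<nu> + C \<nu> ln B + \<nu>\<^sup>2 C t\<close> for \<open>A = 1 - F(t; s)\<close> and \<open>B = 1 - s\<close>, which extends
  from real \<open>s\<close> to the unit disc by analytic continuation. With \<open>\<tau> = q(t)\<^sup>-\<^sup>\<nu> \<sim> \<nu>\<^sup>2 C t\<close> and
  \<open>s = exp (- q(t) z)\<close>, it gives \<open>A / q(t) \<approx> (1 + z\<^sup>-\<^sup>\<nu>)\<close> to the power \<open>-1/\<nu>\<close>, up to a relative error of order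
  \<open>ln \<tau> / \<tau>\<close>. Since the Q-process has generating function \<open>s \<partial>F/\<partial>s\<close>, the Laplace transforms of
  \<open>q(t) W(t)\<close> and of the limit law differ in \<open>0 < Re z\<close> by \<open>O(ln \<tau> / \<tau>)\<close> times a weight whose quotient
  by \<open>\<bar>z\<bar>\<close> is integrable on vertical lines, as long as \<open>\<bar>z\<bar>\<close> is at most a small multiple of
  \<open>\<tau> / ln \<tau>\<close>. On the imaginary axis this is a bound for characteristic functions, and Esseen's
  smoothing inequality turns it into the bound for distribution functions.
\<close>

section \<open>The differential equation for the regularly varying factor\<close>

text \<open>The logarithm in the rate comes from the term \<open>C \<nu> ln\<close> of the
  integrated equation: it makes \<open>\<tau> - C ln \<tau>\<close>, rather than \<tau>, linear in
  t, and at z it leaves an error involving ln \<tau> + |ln |z||. Half of the exponent \<nu> is given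
  up to absorb ln |z|, whence the weight |z|^(\<nu>/2) near 0. At infinity the error bound grows
  like |z|, but the limit transform decays like |z|^(-1-\<nu>). The cutoff in the smoothing
  inequality can be as large as the range of the estimate, so truncation contributes an error of the
  same order.

  On the imaginary axis, s = exp (- q z) would lie on the unit circle, outside the disc of the
  continuation. Hence the bounds are proved for 0 < Re z, depend on |z| alone, and are then passed
  to the boundary.

  Two facts have to be derived from the definitions: the backward equation, although the
  o(\<epsilon>) terms are controlled only for each state separately, and the form j p_1j(t) of the
  Q-transition probabilities, which are defined as limits.\<close>

lemma regular_variation_ode_explicit:
  fixes \<nu> :: real and \<Lambda> \<Lambda>' :: "real \<Rightarrow> real"
  assumes \<nu>: "0 < \<nu>"
    and pos: "\<And>y. y \<in> {0<..1} \<Longrightarrow> 0 < \<Lambda> y"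
    and der: "\<And>y. y \<in> {0<..1} \<Longrightarrow> (\<Lambda> has_real_derivative \<Lambda>' y) (at y within {0<..1})"
    and ode: "\<And>y. y \<in> {0<..1} \<Longrightarrow> y * \<Lambda>' y / \<Lambda> y = \<nu> + \<Lambda> y"
  obtains C where "0 < C" "C < 1"
    "\<And>y. y \<in> {0<..1} \<Longrightarrow> \<Lambda> y = \<nu> * C * y powr \<nu> / (1 - C * y powr \<nu>)"
proof -
  \<comment> \<open>Separation of variables: partial fractions in d\<Lambda> / (\<Lambda> (\<nu> +
    \<Lambda>)) = dy / y give ln (\<Lambda> / (\<nu> + \<Lambda>)) = \<nu> ln y + const, so
    \<open>K\<close> is a first integral and C is its value at 1.\<close>
  define K where "K = (\<lambda>y. \<Lambda> y / (\<nu> + \<Lambda> y) * y powr - \<nu>)"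
  have dK: "(K has_real_derivative 0) (at y within {0<..1})" if y: "y \<in> {0<..1}" for y
  proof -
    have L: "\<Lambda>' y = \<Lambda> y * (\<nu> + \<Lambda> y) / y"
      using ode[OF y] pos[OF y] y by (simp add: field_simps)
    have "((\<lambda>y. \<Lambda> y / (\<nu> + \<Lambda> y)) has_real_derivative
        (\<Lambda>' y * (\<nu> + \<Lambda> y) - \<Lambda> y * \<Lambda>' y) / ((\<nu> + \<Lambda> y) * (\<nu> + \<Lambda> y))) (at y within {0<..1})"
      using pos[OF y] \<nu> by (intro DERIV_divide der[OF y]) (auto intro!: derivative_eq_intros der[OF y])
    from DERIV_mult[OF this has_real_derivative_powr[of y "- \<nu>", THEN DERIV_subset, OF _ subset_UNIV]]
    have "(K has_real_derivative
        ((\<Lambda>' y * (\<nu> + \<Lambda> y) - \<Lambda> y * \<Lambda>' y) / ((\<nu> + \<Lambda> y) * (\<nu> + \<Lambda> y))) * y powr - \<nu>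
          + (- \<nu> * y powr (- \<nu> - 1)) * (\<Lambda> y / (\<nu> + \<Lambda> y))) (at y within {0<..1})"
      unfolding K_def using y by simp
    moreover have "y powr (- \<nu> - 1) = y powr - \<nu> / y"
      using y by (simp add: powr_diff)
    moreover have "(\<Lambda>' y * v - \<Lambda> y * \<Lambda>' y) / (v * v) * Y + (- \<nu> * (Y / y)) * (\<Lambda> y / v) = 0"
      if v: "v = \<nu> + \<Lambda> y" for v Y
    proof -
      have "v \<noteq> 0" "y \<noteq> 0" using pos[OF y] \<nu> v y by auto
      moreover have "\<Lambda>' y * v - \<Lambda> y * \<Lambda>' y = \<Lambda> y * v / y * \<nu>"
        unfolding L v by (simp add: algebra_simps flip: add_divide_distrib)
      ultimately show ?thesis by (simp add: field_simps)
    qed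
    ultimately show ?thesis by simp
  qed
  define C where "C = K 1"
  have K: "K y = C" if "y \<in> {0<..1}" for y
    unfolding C_def
    by (rule has_field_derivative_zero_constant[of "{0<..1}" K, THEN exE])
      (use dK that in auto)
  have C: "C = \<Lambda> 1 / (\<nu> + \<Lambda> 1)" by (simp add: C_def K_def)
  show thesis
  proof
    show "0 < C" "C < 1" using pos[of 1] \<nu> by (auto simp: C field_simps)
    show "\<Lambda> y = \<nu> * C * y powr \<nu> / (1 - C * y powr \<nu>)" if y: "y \<in> {0<..1}" for y
    proof -
      have "C * y powr \<nu> = \<Lambda> y / (\<nu> + \<Lambda> y) * (y powr - \<nu> * y powr \<nu>)"
        using K[OF y] by (simp add: K_def flip: mult.assoc)
      also have "y powr - \<nu> * y powr \<nu> = 1"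
        using y by (simp flip: powr_add)
      finally have "\<Lambda> y = C * y powr \<nu> * (\<nu> + \<Lambda> y)"
        using pos[OF y] \<nu> by (simp add: field_simps)
      then have *: "\<Lambda> y * (1 - C * y powr \<nu>) = \<nu> * C * y powr \<nu>" by (simp add: algebra_simps)
      have "y powr \<nu> \<le> 1" using y \<nu> by (simp add: powr_le1)
      then have "C * y powr \<nu> < 1" using \<open>0 < C\<close> \<open>C < 1\<close>
        by (smt (verit) mult_left_le)
      then show ?thesis using * by (simp add: field_simps)
    qed
  qed
qed

section \<open>Esseen's smoothing inequality\<close>

text \<open>The Fejer kernel on the line. At 0 division by zero gives the value 0 instead of the
  continuous value 1 / (2 pi); a single point does not affect the integrals.\<close>

definition fejer_density :: "real \<Rightarrow> real" where
  "fejer_density x = (1 - cos x) / (pi * x\<^sup>2)"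

text \<open>Integration by parts: Si x - (1 - cos x) / x is an antiderivative on the positive
  half-line, and the sine integral tends to pi / 2. As the integrand is nonnegative, the same limits
  also give integrability. The negative half-line follows by reflection.\<close>

lemma has_bochner_integral_one_minus_cos:
  "has_bochner_integral lborel (\<lambda>x::real. (1 - cos x) / x\<^sup>2) pi"
proof -
  let ?f = "\<lambda>x::real. (1 - cos x) / x\<^sup>2"
  let ?F = "\<lambda>x::real. Si x - (1 - cos x) / x"
  have lim0: "((\<lambda>x::real. (1 - cos x) / x) \<longlongrightarrow> 0) (at_right 0)"
    by real_asymp
  have limi: "((\<lambda>x::real. (1 - cos x) / x) \<longlongrightarrow> 0) at_top"
  proof (rule Lim_null_comparison)
    show "\<forall>\<^sub>F x in at_top. norm ((1 - cos x) / x) \<le> 2 / (x::real)"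
      using eventually_gt_at_top[of 0]
    proof eventually_elim
      case (elim x)
      have "\<bar>1 - cos x\<bar> \<le> 2" using cos_ge_minus_one[of x] cos_le_one[of x] by linarith
      then show ?case using elim by (simp add: divide_right_mono)
    qed
    show "((\<lambda>x::real. 2 / x) \<longlongrightarrow> 0) at_top" by real_asymp
  qed
  have "Si 0 = 0" by (simp add: Si_def zero_ereal_def)
  then have Si0: "(Si \<longlongrightarrow> 0) (at_right 0)"
    using isCont_Si[of 0] by (auto simp: isCont_def intro: filterlim_mono at_le)
  have der: "DERIV ?F x :> ?f x" if "0 < x" for x :: real
  proof -
    have "DERIV ?F x :> sinc x - (sin x * x - (1 - cos x)) / (x * x)"
      using that by (auto intro!: derivative_eq_intros DERIV_Si)
    also have "sinc x - (sin x * x - (1 - cos x)) / (x * x) = ?f x"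
      using that by (simp add: field_simps power2_eq_square)
    finally show ?thesis .
  qed
  have half: "set_integrable lborel (einterval 0 \<infinity>) ?f" "(LBINT x=0..\<infinity>. ?f x) = pi / 2 - 0"
  proof -
    have r0: "((?F \<circ> real_of_ereal) \<longlongrightarrow> 0) (at_right 0)"
      unfolding zero_ereal_def ereal_tendsto_simps1 using tendsto_diff[OF Si0 lim0] by simp
    have ri: "((?F \<circ> real_of_ereal) \<longlongrightarrow> pi / 2) (at_left \<infinity>)"
      unfolding ereal_tendsto_simps1 using tendsto_diff[OF Si_at_top limi] by simp
    have c: "isCont ?f x" if "0 < ereal x" for x
      using that by (auto intro!: continuous_intros)
    note I = interval_integral_FTC_nonneg[of 0 \<infinity> ?F ?f 0 "pi/2"]
    show "set_integrable lborel (einterval 0 \<infinity>) ?f"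
      by (rule I) (use r0 ri der c in \<open>auto\<close>)
    show "(LBINT x=0..\<infinity>. ?f x) = pi / 2 - 0"
      by (rule I) (use r0 ri der c in \<open>auto\<close>)
  qed
  have e: "einterval 0 \<infinity> = {0::real<..}" by (auto simp: einterval_def)
  have p: "has_bochner_integral lborel (\<lambda>x. indicator {0<..} x *\<^sub>R ?f x) (pi / 2)"
    using half unfolding has_bochner_integral_iff
    by (simp add: interval_lebesgue_integral_def set_integrable_def set_lebesgue_integral_def e)
  have n: "has_bochner_integral lborel (\<lambda>x. indicator {..<0} x *\<^sub>R ?f x) (pi / 2)"
    using lborel_has_bochner_integral_real_affine_iff[of "-1" "\<lambda>x. indicator {0<..} x *\<^sub>R ?f x" "pi/2" 0] p
    by (simp add: indicator_def)
  show ?thesis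
    using has_bochner_integral_add[OF p n]
    by (rule has_bochner_integral_cong[THEN iffD1, rotated -1]) (auto simp: indicator_def)
qed

lemma has_bochner_integral_one_minus_cos_scale:
  "has_bochner_integral lborel (\<lambda>x::real. (1 - cos (c * x)) / x\<^sup>2) (pi * \<bar>c\<bar>)"
proof (cases "c = 0")
  case False
  have "has_bochner_integral lborel (\<lambda>x::real. (1 - cos (c * x)) / (c * x)\<^sup>2) (pi / \<bar>c\<bar>)"
    using lborel_has_bochner_integral_real_affine_iff[OF False, of "\<lambda>x. (1 - cos x) / x\<^sup>2" pi 0]
      has_bochner_integral_one_minus_cos False by (simp add: divide_inverse mult.commute)
  from has_bochner_integral_mult_right[OF this, of "c\<^sup>2"]
  have "has_bochner_integral lborel (\<lambda>x::real. c\<^sup>2 * ((1 - cos (c * x)) / (c * x)\<^sup>2)) (c\<^sup>2 * (pi / \<bar>c\<bar>))" .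
  moreover have "c\<^sup>2 * (pi / \<bar>c\<bar>) = pi * \<bar>c\<bar>"
    using False by (simp add: field_simps power2_eq_square)
  moreover have "(\<lambda>x::real. c\<^sup>2 * ((1 - cos (c * x)) / (c * x)\<^sup>2)) = (\<lambda>x. (1 - cos (c * x)) / x\<^sup>2)"
    using False by (simp add: power_mult_distrib)
  ultimately show ?thesis by simp
qed (simp add: has_bochner_integral_zero)

definition fejer_distribution :: "real measure" where
  "fejer_distribution = density lborel (\<lambda>x. ennreal (fejer_density x))"

lemma fejer_density_nonneg: "0 \<le> fejer_density x"
  by (simp add: fejer_density_def)

lemma fejer_density_measurable [measurable]: "fejer_density \<in> borel_measurable borel"
  unfolding fejer_density_def by measurable

text \<open>Expanding cos x cos (t x) into cosines of (1 + t) x and (1 - t) x reduces the integrand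
  to three instances of the scaled integral; |1 + t| / 2 + |1 - t| / 2 - |t| is the triangle
  function.\<close>

lemma has_bochner_integral_fejer_cos:
  "has_bochner_integral lborel (\<lambda>x. fejer_density x * cos (t * x)) (max 0 (1 - \<bar>t\<bar>))"
proof -
  note I = has_bochner_integral_one_minus_cos_scale
  have *: "has_bochner_integral lborel
      (\<lambda>x. (1 / pi) * (1/2 * ((1 - cos ((1 + t) * x)) / x\<^sup>2) + 1/2 * ((1 - cos ((1 - t) * x)) / x\<^sup>2)
        - (1 - cos (t * x)) / x\<^sup>2))
      ((1 / pi) * (1/2 * (pi * \<bar>1 + t\<bar>) + 1/2 * (pi * \<bar>1 - t\<bar>) - pi * \<bar>t\<bar>))"
    by (intro has_bochner_integral_mult_right has_bochner_integral_diff has_bochner_integral_add I)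
  moreover have "(1 / pi) * (1/2 * (pi * \<bar>1 + t\<bar>) + 1/2 * (pi * \<bar>1 - t\<bar>) - pi * \<bar>t\<bar>) = max 0 (1 - \<bar>t\<bar>)"
    by (simp add: field_simps max_def abs_if)
  moreover have "(1 / pi) * (1/2 * ((1 - cos ((1 + t) * x)) / x\<^sup>2) + 1/2 * ((1 - cos ((1 - t) * x)) / x\<^sup>2)
        - (1 - cos (t * x)) / x\<^sup>2) = fejer_density x * cos (t * x)" for x
    by (cases "x = 0") (simp_all add: fejer_density_def cos_add cos_diff field_simps distrib_right)
  ultimately show ?thesis by simp
qed

lemma real_distribution_fejer: "real_distribution fejer_distribution"
proof -
  have 1: "has_bochner_integral lborel fejer_density 1"
    using has_bochner_integral_fejer_cos[of 0] by simp
  have "emeasure fejer_distribution (space fejer_distribution) = 1"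
    unfolding fejer_distribution_def
    using 1 by (simp add: emeasure_density nn_integral_eq_integral has_bochner_integral_iff fejer_density_nonneg)
  then interpret prob_space fejer_distribution by (rule prob_spaceI)
  show ?thesis
    by unfold_locales (simp_all add: fejer_distribution_def)
qed

lemma char_fejer: "char fejer_distribution t = of_real (max 0 (1 - \<bar>t\<bar>))"
proof -
  have 1: "integrable lborel fejer_density"
    using has_bochner_integral_fejer_cos[of 0] by (simp add: has_bochner_integral_iff)
  have int: "integrable lborel (\<lambda>x. fejer_density x *\<^sub>R iexp (t * x))"
    by (rule Bochner_Integration.integrable_bound[OF 1]) (auto simp: fejer_density_nonneg)
  have "char fejer_distribution t = (CLBINT x. fejer_density x *\<^sub>R iexp (t * x))"
    unfolding char_def fejer_distribution_def
    by (subst integral_density) (auto simp: fejer_density_nonneg)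
  also have "\<dots> = of_real (max 0 (1 - \<bar>t\<bar>))"
  proof (rule complex_eqI)
    have "Re (CLBINT x. fejer_density x *\<^sub>R iexp (t * x)) = (LBINT x. fejer_density x * cos (t * x))"
      by (subst integral_Re[OF int, symmetric]) (simp add: Re_exp)
    then show "Re (CLBINT x. fejer_density x *\<^sub>R iexp (t * x)) = Re (complex_of_real (max 0 (1 - \<bar>t\<bar>)))"
      using has_bochner_integral_fejer_cos[of t] by (simp add: has_bochner_integral_iff)
    have "Im (CLBINT x. fejer_density x *\<^sub>R iexp (t * x)) = (LBINT x. fejer_density x * sin (t * x))"
      by (subst integral_Im[OF int, symmetric]) (simp add: Im_exp)
    \<comment> \<open>The integrand is odd, so the substitution x -> -x changes the sign of the
      integral.\<close>
    moreover have "(LBINT x. fejer_density x * sin (t * x)) = - (LBINT x. fejer_density x * sin (t * x))"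
      by (subst lborel_integral_real_affine[where c = "-1" and t = 0])
         (simp_all add: fejer_density_def)
    ultimately show "Im (CLBINT x. fejer_density x *\<^sub>R iexp (t * x)) = Im (complex_of_real (max 0 (1 - \<bar>t\<bar>)))"
      by simp
  qed
  finally show ?thesis .
qed

section \<open>Convolution and comparison of laws by inversion\<close>

lemma
  assumes "real_distribution M" "real_distribution V"
  shows real_distribution_convolution: "real_distribution (M \<star> V)"
    and char_convolution: "char (M \<star> V) t = char M t * char V t"
    and measure_convolution:
      "A \<in> sets borel \<Longrightarrow> measure (M \<star> V) A = (LINT u|V. measure M {x. x + u \<in> A})"
proof -
  interpret M: real_distribution M by fact
  interpret V: real_distribution V by fact
  interpret pair_prob_space M V ..
  have [measurable_cong]: "sets (M \<Otimes>\<^sub>M V) = sets (borel \<Otimes>\<^sub>M borel)"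
    by (intro sets_pair_measure_cong) simp_all
  show "real_distribution (M \<star> V)"
    unfolding convolution_def by (intro real_distribution_distr) measurable
  have "char (M \<star> V) t = (\<integral>p. iexp (t * fst p) * iexp (t * snd p) \<partial>(M \<Otimes>\<^sub>M V))"
    unfolding char_def convolution_def
    by (subst integral_distr) (auto simp: split_beta distrib_left exp_add[symmetric] intro!: Bochner_Integration.integral_cong)
  also have "\<dots> = (CLINT x|M. CLINT y|V. iexp (t * x) * iexp (t * y))"
    by (subst integral_fst'[symmetric]) (auto intro!: integrable_const_bound[where B = 1] simp: norm_mult)
  also have "\<dots> = char M t * char V t"
    unfolding char_def by simp
  finally show "char (M \<star> V) t = char M t * char V t" .
  show "measure (M \<star> V) A = (LINT u|V. measure M {x. x + u \<in> A})" if [measurable]: "A \<in> sets borel"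
  proof -
    have "measure (M \<star> V) A = (\<integral>p. indicator A (fst p + snd p) \<partial>(M \<Otimes>\<^sub>M V))"
    proof -
      have "measure (M \<star> V) A = (\<integral>x. indicator A x \<partial>(M \<star> V))"
        by (simp add: convolution_def)
      also have "\<dots> = (\<integral>p. indicator A (fst p + snd p) \<partial>(M \<Otimes>\<^sub>M V))"
        unfolding convolution_def by (subst integral_distr) (auto simp: split_beta)
      finally show ?thesis .
    qed
    also have "\<dots> = (LINT u|V. LINT x|M. indicator A (x + u))"
    proof -
      have "(\<integral>p. indicat_real A (fst p + snd p) \<partial>(M \<Otimes>\<^sub>M V)) = (\<integral>(x, u). indicat_real A (x + u) \<partial>(M \<Otimes>\<^sub>M V))"
        by (simp add: split_beta')
      also have "\<dots> = (LINT u|V. LINT x|M. indicator A (x + u))"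
        by (rule integral_snd[symmetric]) (auto intro!: integrable_const_bound[where B = 1] simp: split_beta)
      finally show ?thesis .
    qed
    also have "\<dots> = (LINT u|V. measure M {x. x + u \<in> A})"
    proof (rule Bochner_Integration.integral_cong[OF refl])
      fix u
      have "(LINT x|M. indicator A (x + u)) = (LINT x|M. indicator {x. x + u \<in> A} x :: real)"
        by (rule Bochner_Integration.integral_cong) (auto simp: indicator_def)
      also have "\<dots> = measure M {x. x + u \<in> A}" by simp
      finally show "(LINT x|M. indicator A (x + u)) = measure M {x. x + u \<in> A}" .
    qed
    finally show ?thesis .
  qed
qed

text \<open>The kernel in Levy's inversion formula is at most 2 / |t|, uniformly in the endpoints.
  This cancels the factor |x| of the hypothesis, so the bound for {a<..b} does not depend on a and
  survives a -> -infinity. The other bound \<open>b - a\<close> of the kernel only serves to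
  integrate the two terms separately.\<close>

lemma cdf_diff_le_integral_char:
  assumes "real_distribution M1" "real_distribution M2"
    and atoms: "\<And>x. measure M1 {x} = 0" "\<And>x. measure M2 {x} = 0"
    and h: "integrable lborel h"
    and h_nonneg: "\<And>x. 0 \<le> h x"
    and bound: "\<And>x. norm (char M1 x - char M2 x) \<le> \<bar>x\<bar> * h x"
  shows "\<bar>cdf M1 b - cdf M2 b\<bar> \<le> (LBINT x. h x)"
proof -
  interpret M1: real_distribution M1 by fact
  interpret M2: real_distribution M2 by fact
  have J0: "0 \<le> (LBINT x. h x)" by (simp add: h_nonneg)
  have *: "\<bar>measure M1 {a<..b} - measure M2 {a<..b}\<bar> \<le> (LBINT x. h x)" if ab: "a \<le> b" for a
  proof -
    let ?F = "\<lambda>t. (iexp (-(t * a)) - iexp (-(t * b))) / (\<i> * t)"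
    let ?I = "\<lambda>M n. CLBINT t=-real n..real n. ?F t * char M t"
    have F1: "norm (?F t) \<le> b - a" for t
      using Levy_Inversion_aux2[of "-b" "-a" t] ab by (cases "t = 0") auto
    have F2: "norm (?F t) \<le> 2 / \<bar>t\<bar>" for t
    proof -
      have "norm (iexp (-(t * a)) - iexp (-(t * b))) \<le> 1 + 1"
        by (rule order_trans[OF norm_triangle_ineq4]) simp
      then show ?thesis by (auto simp: norm_divide norm_mult divide_right_mono)
    qed
    have int: "complex_interval_lebesgue_integrable lborel (ereal u) (ereal v) (\<lambda>t. ?F t * char M t)"
      if "real_distribution M" for M u v
    proof -
      interpret M: real_distribution M by fact
      have "norm (?F t * char M t) \<le> (b - a) * 1" for t
        unfolding norm_mult by (intro mult_mono F1 M.cmod_char_le_1) (use ab in auto)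
      then have "integrable lborel (\<lambda>t. indicator {c<..<d} t *\<^sub>R (?F t * char M t))" for c d :: real
        by (intro integrableI_bounded_set_indicator[where B="b - a"])
           (auto simp del: times_divide_eq_left simp: emeasure_bounded_finite[unfolded infinity_ennreal_def])
      then show ?thesis
        unfolding interval_lebesgue_integrable_def set_integrable_def einterval_eq by (metis (full_types))
    qed
    have bnd: "norm (?I M1 n - ?I M2 n) \<le> 2 * (LBINT x. h x)" for n :: nat
    proof -
      have "?I M1 n - ?I M2 n = (CLBINT t=-real n..real n. ?F t * char M1 t - ?F t * char M2 t)"
        by (rule interval_lebesgue_integral_diff(2)[symmetric]) (use int assms in auto)
      also have "\<dots> = (CLBINT t. indicator {-real n<..<real n} t *\<^sub>R (?F t * (char M1 t - char M2 t)))"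
        unfolding interval_lebesgue_integral_def set_lebesgue_integral_def
        by (simp add: right_diff_distrib)
      finally have eq: "?I M1 n - ?I M2 n
          = (CLBINT t. indicator {-real n<..<real n} t *\<^sub>R (?F t * (char M1 t - char M2 t)))" .
      have le: "norm (indicator {-real n<..<real n} t *\<^sub>R (?F t * (char M1 t - char M2 t))) \<le> 2 * h t"
        for t
      proof -
        have "norm (?F t * (char M1 t - char M2 t)) \<le> 2 / \<bar>t\<bar> * (\<bar>t\<bar> * h t)"
          unfolding norm_mult by (intro mult_mono F2 bound) auto
        then show ?thesis using h_nonneg[of t] by (cases "t = 0") (auto simp: indicator_def)
      qed
      have "norm (CLBINT t. indicator {-real n<..<real n} t *\<^sub>R (?F t * (char M1 t - char M2 t)))
          \<le> (LBINT t. 2 * h t)"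
        by (rule order_trans[OF integral_norm_bound integral_mono']) (use h le h_nonneg in auto)
      then show ?thesis unfolding eq using h by simp
    qed
    have "(\<lambda>n. 1 / (2 * pi) * ?I M1 n) \<longlonglongrightarrow> complex_of_real (measure M1 {a<..b})"
      "(\<lambda>n. 1 / (2 * pi) * ?I M2 n) \<longlonglongrightarrow> complex_of_real (measure M2 {a<..b})"
      using M1.Levy_Inversion[OF ab atoms(1) atoms(1)] M2.Levy_Inversion[OF ab atoms(2) atoms(2)]
      by (simp_all only: of_int_minus of_int_of_nat_eq)
    then have "(\<lambda>n. norm (1 / (2 * pi) * ?I M1 n - 1 / (2 * pi) * ?I M2 n))
        \<longlonglongrightarrow> norm (complex_of_real (measure M1 {a<..b}) - complex_of_real (measure M2 {a<..b}))"
      by (intro tendsto_norm tendsto_diff)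
    moreover have "norm (1 / (2 * pi) * ?I M1 n - 1 / (2 * pi) * ?I M2 n) \<le> (LBINT x. h x)" for n
    proof -
      have "norm (of_real c * X - of_real c * Y) = c * norm (X - Y)" if "0 \<le> c" for c and X Y :: complex
        using that by (simp add: norm_mult flip: right_diff_distrib)
      then have "norm (1 / (2 * pi) * ?I M1 n - 1 / (2 * pi) * ?I M2 n) = 1 / (2 * pi) * norm (?I M1 n - ?I M2 n)"
        by this simp
      also have "\<dots> \<le> 1 / (2 * pi) * (2 * (LBINT x. h x))"
        by (rule mult_left_mono[OF bnd]) simp
      also have "\<dots> = 1 / pi * (LBINT x. h x)" by simp
      also have "\<dots> \<le> 1 * (LBINT x. h x)"
        by (rule mult_right_mono[OF _ J0]) (use pi_gt3 in \<open>simp add: field_simps\<close>)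
      finally show ?thesis by (simp only: mult_1)
    qed
    ultimately have "norm (complex_of_real (measure M1 {a<..b}) - complex_of_real (measure M2 {a<..b})) \<le> (LBINT x. h x)"
      by (intro LIMSEQ_le_const2) auto
    then show ?thesis by (simp flip: of_real_diff)
  qed
  have "(\<lambda>a. \<bar>(cdf M1 b - cdf M1 (- real a)) - (cdf M2 b - cdf M2 (- real a))\<bar>)
      \<longlonglongrightarrow> \<bar>(cdf M1 b - 0) - (cdf M2 b - 0)\<bar>"
    by (intro tendsto_intros M1.cdf_lim_neg_infty M2.cdf_lim_neg_infty)
  moreover have "eventually (\<lambda>a. \<bar>(cdf M1 b - cdf M1 (- real a)) - (cdf M2 b - cdf M2 (- real a))\<bar> \<le> (LBINT x. h x)) sequentially"
    using eventually_gt_at_top[of "nat \<lceil>-b\<rceil>"]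
  proof eventually_elim
    case (elim a)
    then have "- real a < b" by linarith
    then show ?case using *[of "- real a"] M1.cdf_diff_eq[of "- real a" b] M2.cdf_diff_eq[of "- real a" b] by simp
  qed
  ultimately have "\<bar>(cdf M1 b - 0) - (cdf M2 b - 0)\<bar> \<le> (LBINT x. h x)"
    by (rule tendsto_upperbound) simp
  then show ?thesis by simp
qed

lemma real_distribution_small_tail:
  assumes "real_distribution M" "0 < e"
  obtains u where "0 < u" "measure M {x. u < \<bar>x\<bar>} \<le> e"
proof -
  interpret real_distribution M by fact
  have "(\<lambda>n. measure M {x. real n < \<bar>x\<bar>}) \<longlonglongrightarrow> measure M (\<Inter>n. {x. real n < \<bar>x\<bar>})"
    by (rule finite_Lim_measure_decseq) (auto simp: decseq_def)
  also have "(\<Inter>n. {x. real n < \<bar>x\<bar>}) = {}"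
    by (auto simp: not_less) (meson less_le_not_le linear reals_Archimedean2)
  finally have "eventually (\<lambda>n. measure M {x. real n < \<bar>x\<bar>} < e) sequentially"
    using assms(2) by (intro order_tendstoD) auto
  then have "eventually (\<lambda>n. measure M {x. real n < \<bar>x\<bar>} < e \<and> 0 < n) sequentially"
    using eventually_gt_at_top[of 0] by eventually_elim auto
  then obtain n where "measure M {x. real n < \<bar>x\<bar>} < e" "0 < n"
    using eventually_happens by force
  then show thesis by (intro that[of "real n"]) auto
qed

lemma measure_fejer_singleton: "measure fejer_distribution {x} = 0"
proof -
  have "emeasure fejer_distribution {x} = 0"
    unfolding fejer_distribution_def
    by (subst emeasure_density) (auto intro!: nn_integral_null_set)
  then show ?thesis by (simp add: measure_def)
qed

text \<open>
  Convolving with the rescaled Fejer distribution, whose characteristic function vanishes outside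
  \<open>[-T, T]\<close>, costs only \<open>O(m / T)\<close> in the sup distance because one of the two distribution
  functions is \<open>m\<close>-Lipschitz.
\<close>

theorem esseen_smoothing:
  fixes M1 M2 :: "real measure" and m T u0 x0 :: real and h :: "real \<Rightarrow> real"
  assumes u0: "0 < u0" "measure fejer_distribution {u. u0 < \<bar>u\<bar>} \<le> 1 / 4"
    and D: "real_distribution M1" "real_distribution M2"
    and lip: "\<And>x y. x \<le> y \<Longrightarrow> cdf M2 y - cdf M2 x \<le> m * (y - x)" and T: "0 < T"
    and h: "integrable lborel h" "\<And>x. 0 \<le> h x"
    and bound: "\<And>x. \<bar>x\<bar> < T \<Longrightarrow> norm (char M1 x - char M2 x) \<le> \<bar>x\<bar> * h x"
  shows "\<bar>cdf M1 x0 - cdf M2 x0\<bar> \<le> (2 + 4 * u0) * ((LBINT x. h x) + m / T)"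
proof -
  interpret M1: real_distribution M1 by fact
  interpret M2: real_distribution M2 by fact
  interpret U: real_distribution fejer_distribution by (rule real_distribution_fejer)
  define V where "V = distr fejer_distribution borel (\<lambda>u. u / T)"
  have V: "real_distribution V" unfolding V_def by (rule U.real_distribution_distr) simp
  interpret V: real_distribution V by fact
  have charV: "char V t = of_real (max 0 (1 - \<bar>t\<bar> / T))" for t
    using char_fejer[of "t / T"] T
    unfolding V_def char_def by (subst integral_distr) (simp_all add: field_simps)
  have atomV: "measure V {x} = 0" for x
  proof -
    have "measure V {x} = measure fejer_distribution ((\<lambda>u. u / T) -` {x})"
      unfolding V_def by (subst measure_distr) auto
    also have "(\<lambda>u. u / T) -` {x} = {x * T}" using T by (auto simp: field_simps)
    finally show ?thesis by (simp add: measure_fejer_singleton)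
  qed
  \<comment> \<open>By the choice of u0, the rescaled kernel has mass at least 3/4 within distance w
    of 0.\<close>
  define w where "w = u0 / T"
  have w: "0 < w" using u0 T by (simp add: w_def)
  have tailV: "measure V {u. w < \<bar>u\<bar>} \<le> 1 / 4"
  proof -
    have "measure V {u. w < \<bar>u\<bar>} = measure fejer_distribution ((\<lambda>u. u / T) -` {u. w < \<bar>u\<bar>})"
      unfolding V_def by (subst measure_distr) auto
    also have "(\<lambda>u. u / T) -` {u. w < \<bar>u\<bar>} = {u. u0 < \<bar>u\<bar>}"
      using T by (auto simp: w_def field_simps)
    finally show ?thesis using u0 by simp
  qed
  have m: "0 \<le> m"
    using lip[of 0 1] M2.cdf_nondecreasing[of 0 1] by simp
  \<comment> \<open>Smoothing with the atomless V removes all atoms, so inversion applies at every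
    endpoint even when M is discrete, as the law of q(t) W(t) is. The two factors are swapped in
    order to integrate point masses of V over M.\<close>
  have atoms: "measure (M \<star> V) {x} = 0" if M: "real_distribution M" for M x
  proof -
    interpret M: real_distribution M by fact
    have "measure (M \<star> V) {x} = measure (V \<star> M) {x}"
      by (subst convolution_commutative) (auto intro: M.finite_measure_axioms V.finite_measure_axioms)
    also have "\<dots> = (LINT u|M. measure V {y. y + u \<in> {x}})"
      by (rule measure_convolution[OF V M]) simp
    also have "\<dots> = (LINT u|M. 0)"
    proof (rule Bochner_Integration.integral_cong[OF refl])
      fix u
      have "{y. y + u \<in> {x}} = {x - u}" by auto
      then show "measure V {y. y + u \<in> {x}} = 0" by (simp add: atomV)
    qed
    finally show ?thesis by simp
  qed
  let ?J = "LBINT x. h x"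
  let ?\<Delta> = "\<lambda>x. cdf M1 x - cdf M2 x"
  have cdf_conv: "cdf (M \<star> V) b = (LINT u|V. cdf M (b - u))" if M: "real_distribution M" for M b
  proof -
    have "cdf (M \<star> V) b = (LINT u|V. measure M {x. x + u \<in> {..b}})"
      unfolding cdf_def by (rule measure_convolution[OF M V]) simp
    also have "\<dots> = (LINT u|V. cdf M (b - u))"
      unfolding cdf_def by (intro Bochner_Integration.integral_cong arg_cong[where f = "measure M"]) auto
    finally show ?thesis .
  qed
  have cdf_meas [measurable]: "cdf M \<in> borel_measurable borel" if "real_distribution M" for M
  proof -
    interpret M: real_distribution M by fact
    show ?thesis by (intro borel_measurable_mono monoI M.cdf_nondecreasing)
  qed
  note [measurable] = cdf_meas[OF D(1)] cdf_meas[OF D(2)]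
  have cdf_int: "integrable V (\<lambda>u. cdf M (b - u))" if M: "real_distribution M" for M b
  proof -
    interpret M: real_distribution M by fact
    note [measurable] = cdf_meas[OF M]
    show ?thesis
      by (rule V.integrable_const_bound[where B = 1]) (auto simp: M.cdf_nonneg M.cdf_bounded_prob)
  qed
  have smooth: "\<bar>LINT u|V. ?\<Delta> (b - u)\<bar> \<le> ?J" for b
  proof -
    have "\<bar>cdf (M1 \<star> V) b - cdf (M2 \<star> V) b\<bar> \<le> ?J"
    proof (rule cdf_diff_le_integral_char[OF real_distribution_convolution[OF D(1) V]
          real_distribution_convolution[OF D(2) V] atoms[OF D(1)] atoms[OF D(2)] h])
      fix x
      have "norm (char (M1 \<star> V) x - char (M2 \<star> V) x) = norm (char M1 x - char M2 x) * max 0 (1 - \<bar>x\<bar> / T)"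
        unfolding char_convolution[OF D(1) V] char_convolution[OF D(2) V]
        by (simp add: charV norm_mult flip: left_diff_distrib)
      also have "\<dots> \<le> \<bar>x\<bar> * h x"
      proof (cases "\<bar>x\<bar> < T")
        case True
        then have "norm (char M1 x - char M2 x) * max 0 (1 - \<bar>x\<bar> / T) \<le> (\<bar>x\<bar> * h x) * 1"
          using T by (intro mult_mono bound) (auto simp: h)
        then show ?thesis by simp
      next
        case False
        then have "max 0 (1 - \<bar>x\<bar> / T) = 0" using T by (simp add: field_simps max_def)
        then show ?thesis by (simp add: h)
      qed
      finally show "norm (char (M1 \<star> V) x - char (M2 \<star> V) x) \<le> \<bar>x\<bar> * h x" .
    qed
    then show ?thesis
      by (simp add: cdf_conv D Bochner_Integration.integral_diff[OF cdf_int cdf_int, OF D])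
  qed
  have D1: "\<bar>?\<Delta> x\<bar> \<le> 1" for x
    using M1.cdf_nonneg[of x] M2.cdf_nonneg[of x] M1.cdf_bounded_prob[of x] M2.cdf_bounded_prob[of x]
    by linarith
  \<comment> \<open>The sup distance is finite, being at most 1. It will be bounded by a quantity
    containing \<eta> / 2, which can then be absorbed.\<close>
  define \<eta> where "\<eta> = (SUP x. \<bar>?\<Delta> x\<bar>)"
  have bdd: "bdd_above (range (\<lambda>x. \<bar>?\<Delta> x\<bar>))" using D1 by (intro bdd_aboveI[of _ 1]) auto
  have \<eta>: "\<bar>?\<Delta> x\<bar> \<le> \<eta>" for x unfolding \<eta>_def by (rule cSUP_upper[OF UNIV_I bdd])
  \<comment> \<open>Averaging s \<Delta> (b - u) over V gives at most ?J. For |u| \<le> w the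
    integrand is at least d - 2 m w; on the rest, of mass at most 1/4, it is at least - \<eta>. The
    loss is (d + \<eta>) / 4 \<le> \<eta> / 2. The sign s treats both signs of \<Delta> at
    once.\<close>
  have *: "d \<le> ?J + 2 * m * w + \<eta> / 2"
    if near: "\<And>u. \<bar>u\<bar> \<le> w \<Longrightarrow> d - 2 * m * w \<le> s * ?\<Delta> (b - u)" and s: "\<bar>s\<bar> = 1" and d: "0 \<le> d" "d \<le> \<eta>"
    for d b s
  proof -
    have \<eta>0: "0 \<le> \<eta>" using \<eta>[of 0] by simp
    have ind: "integrable V (\<lambda>u. (d + \<eta>) * indicator {u. w < \<bar>u\<bar>} u :: real)"
      by (rule V.integrable_const_bound[where B = "d + \<eta>"])
        (use d \<eta>0 in \<open>auto simp: indicator_def\<close>)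
    have "(LINT u|V. (d - 2 * m * w) - (d + \<eta>) * indicator {u. w < \<bar>u\<bar>} u) \<le> (LINT u|V. s * ?\<Delta> (b - u))"
    proof (rule integral_mono)
      show "integrable V (\<lambda>u. (d - 2 * m * w) - (d + \<eta>) * indicator {u. w < \<bar>u\<bar>} u)"
        by (rule Bochner_Integration.integrable_diff[OF V.integrable_const ind])
      show "integrable V (\<lambda>u. s * ?\<Delta> (b - u))"
        by (intro integrable_mult_right Bochner_Integration.integrable_diff cdf_int D)
      fix u
      have "- \<eta> \<le> s * ?\<Delta> (b - u)" using \<eta>[of "b - u"] s by (auto simp: abs_if split: if_splits)
      moreover have "0 \<le> m * w" using m w by simp
      ultimately show "(d - 2 * m * w) - (d + \<eta>) * indicator {u. w < \<bar>u\<bar>} u \<le> s * ?\<Delta> (b - u)"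
        using near[of u] by (cases "w < \<bar>u\<bar>") (auto simp: indicator_def)
    qed
    also have "(LINT u|V. s * ?\<Delta> (b - u)) \<le> ?J"
      using smooth[of b] s by (auto simp: abs_if split: if_splits)
    finally have "(d - 2 * m * w) - (d + \<eta>) * measure V {u. w < \<bar>u\<bar>} \<le> ?J"
      using ind V.prob_space by simp
    moreover have "(d + \<eta>) * measure V {u. w < \<bar>u\<bar>} \<le> (\<eta> + \<eta>) * (1 / 4)"
      by (intro mult_mono tailV) (use d \<eta>0 in auto)
    ultimately show ?thesis by (simp add: algebra_simps)
  qed
  have "\<bar>?\<Delta> x\<bar> \<le> ?J + 2 * m * w + \<eta> / 2" for x
  proof (cases "0 \<le> ?\<Delta> x")
    case True
    \<comment> \<open>Centring at x + w keeps all points x + w - u to the right of x, where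
      \<open>cdf M1\<close> has not dropped and \<open>cdf M2\<close> has risen by at most 2 m w.
      For negative \<Delta> the centre moves to the left instead.\<close>
    have "?\<Delta> x - 2 * m * w \<le> 1 * ?\<Delta> (x + w - u)" if u: "\<bar>u\<bar> \<le> w" for u
    proof -
      have "cdf M1 x \<le> cdf M1 (x + w - u)" using u by (intro M1.cdf_nondecreasing) auto
      moreover have "cdf M2 (x + w - u) - cdf M2 x \<le> m * ((x + w - u) - x)" using u by (intro lip) auto
      moreover have "m * ((x + w - u) - x) \<le> m * (2 * w)" using u m by (intro mult_left_mono) auto
      ultimately show ?thesis by simp
    qed
    from *[OF this] True \<eta>[of x] show ?thesis by simp
  next
    case False
    have "- ?\<Delta> x - 2 * m * w \<le> (- 1) * ?\<Delta> (x - w - u)" if u: "\<bar>u\<bar> \<le> w" for u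
    proof -
      have "cdf M1 (x - w - u) \<le> cdf M1 x" using u by (intro M1.cdf_nondecreasing) auto
      moreover have "cdf M2 x - cdf M2 (x - w - u) \<le> m * (x - (x - w - u))" using u by (intro lip) auto
      moreover have "m * (x - (x - w - u)) \<le> m * (2 * w)" using u m by (intro mult_left_mono) auto
      ultimately show ?thesis by simp
    qed
    from *[OF this] False \<eta>[of x] show ?thesis by simp
  qed
  then have "\<eta> \<le> ?J + 2 * m * w + \<eta> / 2" unfolding \<eta>_def by (intro cSUP_least) auto
  then have "\<eta> \<le> 2 * ?J + 4 * m * w" by simp
  also have "\<dots> \<le> (2 + 4 * u0) * (?J + m / T)"
  proof -
    have "0 \<le> ?J" using h by simp
    then have "0 \<le> 4 * u0 * ?J" "0 \<le> m / T" using u0 m T by auto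
    moreover have "(2 + 4 * u0) * (?J + m / T) = 2 * ?J + 4 * m * w + (4 * u0 * ?J + 2 * (m / T))"
      by (simp add: w_def algebra_simps)
    ultimately show ?thesis by linarith
  qed
  finally show ?thesis using \<eta>[of x0] by simp
qed

section \<open>Laplace transforms of laws on the half-line\<close>

definition laplace_transform :: "real measure \<Rightarrow> complex \<Rightarrow> complex" where
  "laplace_transform M z = (CLINT x|M. exp (- z * of_real x))"

context real_distribution
begin

context
  assumes nonneg: "measure M {..<0} = 0"
begin

lemma AE_nonneg: "AE x in M. 0 \<le> x"
proof -
  have "AE x in M. x \<notin> {..<0}" using nonneg by (subst (asm) prob_eq_0) auto
  then show ?thesis by eventually_elim auto
qed

lemma norm_exp_le_one: "0 \<le> Re z \<Longrightarrow> 0 \<le> x \<Longrightarrow> norm (exp (- z * of_real x)) \<le> 1"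
  by (simp add: norm_exp_eq_Re)

text \<open>The characteristic function at t is the boundary value at z = - i t, whence the sign in
  the second coordinate. Mass on the half-line makes 1 a dominating function for 0 \<le> Re
  z.\<close>

lemma laplace_transform_tendsto_char: "((\<lambda>n. laplace_transform M (Complex (1 / real (Suc n)) (- t))) \<longlonglongrightarrow> char M t)"
  unfolding laplace_transform_def char_def
proof (rule integral_dominated_convergence[where w = "\<lambda>_. 1"])
  show "AE x in M. (\<lambda>n. exp (- Complex (1 / real (Suc n)) (- t) * of_real x)) \<longlonglongrightarrow> iexp (t * x)"
  proof (rule AE_I2)
    fix x
    have "(\<lambda>n. Complex (1 / real (Suc n)) (- t)) \<longlonglongrightarrow> Complex 0 (- t)"
      by (intro tendsto_Complex tendsto_const) (rule LIMSEQ_Suc[OF lim_1_over_n])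
    then have "(\<lambda>n. exp (- Complex (1 / real (Suc n)) (- t) * of_real x)) \<longlonglongrightarrow> exp (- Complex 0 (- t) * of_real x)"
      by (intro tendsto_exp tendsto_mult tendsto_minus tendsto_const)
    also have "- Complex 0 (- t) * of_real x = \<i> * of_real (t * x)" by (simp add: complex_eq_iff)
    finally show "(\<lambda>n. exp (- Complex (1 / real (Suc n)) (- t) * of_real x)) \<longlonglongrightarrow> iexp (t * x)" .
  qed
  show "AE x in M. norm (exp (- Complex (1 / real (Suc n)) (- t) * of_real x)) \<le> 1" for n
    using AE_nonneg by eventually_elim (rule norm_exp_le_one, auto)
qed simp_all

text \<open>Differentiation under the integral. On the ball of radius d = Re z / 2 the real part
  stays above d, and x exp (- d x) \<le> 1 / d bounds the difference quotients by a constant that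
  does not depend on x.\<close>

lemma laplace_transform_holomorphic: "laplace_transform M holomorphic_on {z. 0 < Re z}"
proof (rule holomorphic_onI)
  fix z :: complex assume "z \<in> {z. 0 < Re z}"
  then have z: "0 < Re z" by simp
  let ?d = "Re z / 2"
  have d: "0 < ?d" using z by simp
  have bound: "norm ((exp (- w * of_real x) - exp (- z * of_real x)) / (w - z)) \<le> 1 / ?d"
    if w: "w \<in> ball z ?d" "w \<noteq> z" and x: "0 \<le> x" for w x
  proof -
    have "norm (exp (- w * of_real x) - exp (- z * of_real x)) \<le> (1 / ?d) * norm (w - z)"
    proof (rule field_differentiable_bound[of "ball z ?d" "\<lambda>w. exp (- w * of_real x)" "\<lambda>w. - of_real x * exp (- w * of_real x)"])
      fix v assume v: "v \<in> ball z ?d"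
      show "((\<lambda>w. exp (- w * of_real x)) has_field_derivative - of_real x * exp (- v * of_real x)) (at v within ball z ?d)"
        by (auto intro!: derivative_eq_intros)
      have "\<bar>Re (z - v)\<bar> \<le> norm (z - v)" by (rule abs_Re_le_cmod)
      also have "\<dots> < ?d" using v by (simp add: dist_norm)
      finally have "?d < Re v" unfolding minus_complex.sel by linarith
      have "norm (- of_real x * exp (- v * of_real x)) = x * exp (- Re v * x)"
        using x by (simp add: norm_mult norm_exp_eq_Re)
      also have "\<dots> \<le> x * exp (- ?d * x)"
      proof -
        have "?d * x \<le> Re v * x" by (rule mult_right_mono) (use x \<open>?d < Re v\<close> in auto)
        then have "- Re v * x \<le> - ?d * x" by simp
        then show ?thesis using x by (intro mult_left_mono) simp_all
      qed
      also have "\<dots> \<le> 1 / ?d"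
      proof -
        have "?d * x \<le> exp (?d * x)" using exp_ge_add_one_self[of "?d * x"] by linarith
        then have "?d * (x * exp (- ?d * x)) \<le> 1" by (simp add: exp_minus field_simps)
        then show ?thesis using d by (simp add: field_simps)
      qed
      finally show "norm (- of_real x * exp (- v * of_real x)) \<le> 1 / ?d" .
    qed (use w d in auto)
    then show ?thesis using w by (simp add: norm_divide field_simps)
  qed
  have int: "integrable M (\<lambda>x. exp (- w * of_real x))" if "0 \<le> Re w" for w
  proof (rule integrable_const_bound[where B = 1])
    show "AE x in M. norm (exp (- w * of_real x)) \<le> 1"
      using AE_nonneg by eventually_elim (rule norm_exp_le_one[OF that])
  qed simp
  have "(laplace_transform M has_field_derivative (CLINT x|M. - of_real x * exp (- z * of_real x))) (at z)"
    unfolding has_field_derivative_iff tendsto_at_iff_sequentially comp_def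
  proof (intro allI impI)
    fix X :: "nat \<Rightarrow> complex"
    assume X: "\<forall>i. X i \<in> UNIV - {z}" "X \<longlonglongrightarrow> z"
    have "eventually (\<lambda>n. X n \<in> ball z ?d) sequentially"
      using X(2) d by (intro topological_tendstoD) auto
    then obtain n0 where n0: "\<And>n. n \<ge> n0 \<Longrightarrow> X n \<in> ball z ?d" by (auto simp: eventually_at_top_linorder)
    define Y where "Y n = X (n + n0)" for n
    have Y: "Y n \<in> ball z ?d" "Y n \<noteq> z" for n using n0 X(1) by (auto simp: Y_def)
    have Y_lim: "Y \<longlonglongrightarrow> z" unfolding Y_def using X(2) by (rule LIMSEQ_ignore_initial_segment)
    have Re_Y: "0 \<le> Re (Y n)" for n
    proof -
      have "\<bar>Re (z - Y n)\<bar> \<le> norm (z - Y n)" by (rule abs_Re_le_cmod)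
      also have "\<dots> < ?d" using Y(1)[of n] by (simp add: dist_norm)
      finally show ?thesis using z unfolding minus_complex.sel by linarith
    qed
    have "(\<lambda>n. CLINT x|M. (exp (- Y n * of_real x) - exp (- z * of_real x)) / (Y n - z))
        \<longlonglongrightarrow> (CLINT x|M. - of_real x * exp (- z * of_real x))"
    proof (rule integral_dominated_convergence[where w = "\<lambda>_. 1 / ?d"])
      show "AE x in M. (\<lambda>n. (exp (- Y n * of_real x) - exp (- z * of_real x)) / (Y n - z))
          \<longlonglongrightarrow> - of_real x * exp (- z * of_real x)"
      proof (rule AE_I2)
        fix x
        have "((\<lambda>w. exp (- w * of_real x)) has_field_derivative - of_real x * exp (- z * of_real x)) (at z)"
          by (auto intro!: derivative_eq_intros)
        then show "(\<lambda>n. (exp (- Y n * of_real x) - exp (- z * of_real x)) / (Y n - z))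
            \<longlonglongrightarrow> - of_real x * exp (- z * of_real x)"
          unfolding has_field_derivative_iff tendsto_at_iff_sequentially comp_def using Y Y_lim by auto
      qed
      show "AE x in M. norm ((exp (- Y n * of_real x) - exp (- z * of_real x)) / (Y n - z)) \<le> 1 / ?d" for n
        using AE_nonneg by eventually_elim (rule bound[OF Y])
    qed simp_all
    also have "(\<lambda>n. CLINT x|M. (exp (- Y n * of_real x) - exp (- z * of_real x)) / (Y n - z))
        = (\<lambda>n. (laplace_transform M (Y n) - laplace_transform M z) / (Y n - z))"
    proof
      fix n
      have "(CLINT x|M. exp (- Y n * of_real x) - exp (- z * of_real x)) = laplace_transform M (Y n) - laplace_transform M z"
        unfolding laplace_transform_def
        by (rule Bochner_Integration.integral_diff[OF int int]) (use Re_Y z in auto)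
      then show "(CLINT x|M. (exp (- Y n * of_real x) - exp (- z * of_real x)) / (Y n - z))
          = (laplace_transform M (Y n) - laplace_transform M z) / (Y n - z)"
        by (simp only: integral_divide_zero)
    qed
    finally show "(\<lambda>n. (laplace_transform M (X n) - laplace_transform M z) / (X n - z))
        \<longlonglongrightarrow> (CLINT x|M. - of_real x * exp (- z * of_real x))"
      unfolding Y_def by (rule LIMSEQ_offset)
  qed
  then show "laplace_transform M field_differentiable at z within {z. 0 < Re z}"
    using field_differentiable_at_within field_differentiable_def by blast
qed

text \<open>The identity theorem: the positive axis accumulates at 1, inside the half-plane. It
  carries information given for real arguments only to complex ones.\<close>

lemma laplace_transform_eqI:
  assumes hol: "\<phi> holomorphic_on {z. 0 < Re z}"
    and eq: "\<And>\<theta>. 0 < \<theta> \<Longrightarrow> of_real (LINT x|M. exp (- \<theta> * x)) = \<phi> (of_real \<theta>)"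
    and z: "0 < Re z"
  shows "laplace_transform M z = \<phi> z"
proof -
  have "laplace_transform M z - \<phi> z = 0"
  proof (rule analytic_continuation[of "\<lambda>z. laplace_transform M z - \<phi> z" "{z. 0 < Re z}" "complex_of_real ` {0<..}" 1])
    show "(\<lambda>z. laplace_transform M z - \<phi> z) holomorphic_on {z. 0 < Re z}"
      by (intro holomorphic_intros laplace_transform_holomorphic hol)
    show "open {z. 0 < Re z}" by (rule open_halfspace_Re_gt)
    show "connected {z. 0 < Re z}" by (intro convex_connected convex_halfspace_Re_gt)
    have "(\<lambda>n. complex_of_real (1 + 1 / real (Suc n))) \<longlonglongrightarrow> of_real (1 + 0)"
      by (intro tendsto_of_real tendsto_add tendsto_const LIMSEQ_Suc[OF lim_1_over_n])
    then show "(1 :: complex) islimpt complex_of_real ` {0<..}"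
      unfolding islimpt_sequential
      by (intro exI[of _ "\<lambda>n. of_real (1 + 1 / real (Suc n))"])
         (auto simp: add_pos_pos complex_eq_iff simp del: of_real_add of_real_divide)
    fix w assume "w \<in> complex_of_real ` {0<..}"
    then obtain \<theta> where \<theta>: "0 < \<theta>" "w = of_real \<theta>" by auto
    have "laplace_transform M w = (CLINT x|M. complex_of_real (exp (- \<theta> * x)))"
      unfolding laplace_transform_def \<theta>(2) by (simp flip: of_real_minus of_real_mult exp_of_real)
    also have "\<dots> = of_real (LINT x|M. exp (- \<theta> * x))" by (rule integral_complex_of_real)
    finally show "laplace_transform M w - \<phi> w = 0" using eq[OF \<theta>(1)] \<theta> by simp
  qed (use z in auto)
  then show ?thesis by simp
qed

end

end

text \<open>An integrable characteristic function means a bounded density. Inversion requires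
  endpoints without mass, so the bound is first proved for such endpoints; they are dense because
  atoms are countable, and an atom squeezed between two close ones would contradict the
  bound.\<close>

lemma (in real_distribution) cdf_lipschitz_of_char:
  assumes h: "integrable lborel h" and le: "\<And>x. norm (char M x) \<le> h x" and xy: "x \<le> y"
  shows "cdf M y - cdf M x \<le> (LBINT t. h t) * (y - x)"
proof -
  have h0: "0 \<le> h x" for x by (rule order_trans[OF norm_ge_zero le])
  have J0: "0 \<le> (LBINT t. h t)" using h0 by simp
  have *: "measure M {a<..b} \<le> (LBINT t. h t) * (b - a)"
    if ab: "a \<le> b" and atoms: "measure M {a} = 0" "measure M {b} = 0" for a b
  proof -
    let ?F = "\<lambda>t. (iexp (-(t * a)) - iexp (-(t * b))) / (\<i> * t)"
    let ?I = "\<lambda>n. CLBINT t=-real n..real n. ?F t * char M t"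
    have F1: "norm (?F t) \<le> b - a" for t
      using Levy_Inversion_aux2[of "-b" "-a" t] ab by (cases "t = 0") auto
    have bnd: "norm (?I n) \<le> (b - a) * (LBINT t. h t)" for n :: nat
    proof -
      have "?I n = (CLBINT t. indicator {-real n<..<real n} t *\<^sub>R (?F t * char M t))"
        by (simp add: interval_lebesgue_integral_def set_lebesgue_integral_def)
      also have "norm \<dots> \<le> (LBINT t. (b - a) * h t)"
      proof (rule order_trans[OF integral_norm_bound integral_mono'])
        fix t
        have "norm (?F t * char M t) \<le> (b - a) * h t"
          unfolding norm_mult by (intro mult_mono F1 le) (use ab in auto)
        then show "norm (indicator {-real n<..<real n} t *\<^sub>R (?F t * char M t)) \<le> (b - a) * h t"
          using h0[of t] ab by (auto simp: indicator_def)
      qed (use h h0 ab in auto)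
      finally show ?thesis by simp
    qed
    have "(\<lambda>n. 1 / (2 * pi) * ?I n) \<longlonglongrightarrow> complex_of_real (measure M {a<..b})"
      using Levy_Inversion[OF ab atoms] by (simp only: of_int_minus of_int_of_nat_eq)
    then have "(\<lambda>n. norm (1 / (2 * pi) * ?I n)) \<longlonglongrightarrow> norm (complex_of_real (measure M {a<..b}))"
      by (rule tendsto_norm)
    moreover have "norm (1 / (2 * pi) * ?I n) \<le> (LBINT t. h t) * (b - a)" for n
    proof -
      have "norm (1 / (2 * pi) * ?I n) = 1 / (2 * pi) * norm (?I n)"
        by (simp add: norm_mult norm_divide)
      also have "\<dots> \<le> 1 * norm (?I n)"
        by (intro mult_right_mono) (use pi_gt3 in \<open>auto simp: field_simps\<close>)
      finally show ?thesis using bnd[of n] by (simp add: mult.commute)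
    qed
    ultimately have "norm (complex_of_real (measure M {a<..b})) \<le> (LBINT t. h t) * (b - a)"
      by (intro LIMSEQ_le_const2) auto
    then show ?thesis by simp
  qed
  have dense: "\<exists>v. u < v \<and> v < w \<and> measure M {v} = 0" if "u < w" for u w :: real
  proof -
    have "uncountable ({u<..<w} - {x. measure M {x} > 0})"
      using uncountable_minus_countable[OF _ countable_atoms] uncountable_open_interval[of u w] that by auto
    then have "{u<..<w} - {x. measure M {x} > 0} \<noteq> {}" by (metis countable_empty)
    then obtain v where "v \<in> {u<..<w}" "\<not> measure M {v} > 0" by blast
    then show ?thesis by (intro exI[of _ v]) (auto simp: less_le)
  qed
  have atom: "measure M {v} = 0" for v
  proof (rule ccontr)
    assume "measure M {v} \<noteq> 0"
    then have pos: "0 < measure M {v}" by (simp add: zero_less_measure_iff)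
    \<comment> \<open>Chosen so that an interval of length at most e has mass at most half of the
      alleged atom; the summand 1 avoids division by zero.\<close>
    define e where "e = measure M {v} / (2 * ((LBINT t. h t) + 1))"
    have e: "0 < e" using pos J0 by (simp add: e_def)
    obtain a b where ab: "v - e / 2 < a" "a < v" "v < b" "b < v + e / 2" "measure M {a} = 0" "measure M {b} = 0"
      using dense[of "v - e / 2" v] dense[of v "v + e / 2"] e by auto
    have "measure M {v} \<le> measure M {a<..b}"
      by (rule finite_measure_mono) (use ab in auto)
    also have "\<dots> \<le> (LBINT t. h t) * (b - a)" by (rule *) (use ab in auto)
    also have "\<dots> \<le> ((LBINT t. h t) + 1) * e" using ab J0 e by (intro mult_mono) auto
    also have "\<dots> = measure M {v} / 2"
    proof -
      have "k * (m / (2 * k)) = m / 2" if "0 < k" for k m :: real using that by simp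
      then show ?thesis unfolding e_def by this (use J0 in simp)
    qed
    finally show False using pos by simp
  qed
  show ?thesis
  proof (cases "x = y")
    case False
    then show ?thesis using *[OF xy atom atom] cdf_diff_eq[of x y] xy by simp
  qed simp
qed

section \<open>Generating functions of the branching process\<close>

text \<open>The argument type is left open: the semigroup property and the differential equation are
  proved for real arguments, the continuation concerns complex ones.\<close>

definition transition_pgf ::
    "(nat \<Rightarrow> 'a measure) \<Rightarrow> (real \<Rightarrow> 'a \<Rightarrow> nat) \<Rightarrow> real \<Rightarrow> 'c \<Rightarrow> 'c::{banach, real_normed_field}" where
  "transition_pgf P Z t x = (\<Sum>j. of_real (trans_prob P Z t 1 j) * x ^ j)"

lemma (in prob_space) sums_prob_nat_cases:
  fixes X :: "'a \<Rightarrow> nat"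
  assumes [measurable]: "X \<in> measurable M (count_space UNIV)" "Measurable.pred M Q"
  shows "(\<lambda>k. \<P>(\<omega> in M. X \<omega> = k \<and> Q \<omega>)) sums \<P>(\<omega> in M. Q \<omega>)"
proof -
  have "(\<lambda>k. prob {\<omega> \<in> space M. X \<omega> = k \<and> Q \<omega>}) sums prob (\<Union>k. {\<omega> \<in> space M. X \<omega> = k \<and> Q \<omega>})"
    by (rule finite_measure_UNION) (auto simp: disjoint_family_on_def)
  also have "(\<Union>k. {\<omega> \<in> space M. X \<omega> = k \<and> Q \<omega>}) = {\<omega> \<in> space M. Q \<omega>}" by auto
  finally show ?thesis .
qed

context markov_branching_process
begin

lemma prob_space_P: "i \<in> insert 0 S \<Longrightarrow> prob_space (P i)"
  using chain by (simp add: markov_chain_def)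

lemma measurable_Z: "i \<in> insert 0 S \<Longrightarrow> 0 \<le> t \<Longrightarrow> Z t \<in> measurable (P i) (count_space UNIV)"
  using chain markov_chain.measurable_X by fastforce

lemma trans_prob_nonneg: "0 \<le> trans_prob P Z t i j"
  by (simp add: trans_prob_def)

lemma trans_prob_sums:
  assumes "i \<in> insert 0 S" "0 \<le> t"
  shows "trans_prob P Z t i sums 1"
proof -
  interpret prob_space "P i" using assms by (simp add: prob_space_P)
  have "(\<lambda>k. \<P>(\<omega> in P i. Z t \<omega> = k \<and> True)) sums \<P>(\<omega> in P i. True)"
    by (rule sums_prob_nat_cases) (use assms measurable_Z in auto)
  then show ?thesis by (simp add: trans_prob_def[abs_def] prob_space)
qed

lemma trans_prob_outside:
  assumes "i \<in> insert 0 S" "0 \<le> t" "j \<notin> insert 0 S"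
  shows "trans_prob P Z t i j = 0"
proof -
  have "{\<omega> \<in> space (P i). Z t \<omega> = j} = {}"
    using markov_chain.X_in_E[OF chain[OF assms(1)] assms(2)] assms(3) by blast
  then show ?thesis unfolding trans_prob_def by (simp only: measure_empty)
qed

text \<open>The Markov property speaks only about histories of positive probability; if k is not
  reached at time s, both sides vanish. The almost sure event Z 0 = i is inserted into the history
  and removed again.\<close>

lemma trans_prob_joint:
  assumes i: "i \<in> insert 0 S" and s: "0 \<le> s" and t: "0 \<le> t"
  shows "\<P>(\<omega> in P i. Z s \<omega> = k \<and> Z (s + t) \<omega> = j) = trans_prob P Z s i k * trans_prob P Z t k j"
proof -
  interpret markov_chain "P i" Z "insert 0 S" "trans_prob P Z" by (rule chain[OF i])
  note [measurable] = measurable_X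
  have st: "0 \<le> s + t" using s t by simp
  have 0: "AE \<omega> in P i. Z 0 \<omega> = i" by (rule start[OF i])
  have A: "\<P>(\<omega> in P i. Z 0 \<omega> = i \<and> Z s \<omega> = k) = trans_prob P Z s i k"
    unfolding trans_prob_def
    by (rule prob_eq_AE) (use 0 s in auto)
  have B: "\<P>(\<omega> in P i. Z (s + t) \<omega> = j \<and> Z 0 \<omega> = i \<and> Z s \<omega> = k) = \<P>(\<omega> in P i. Z s \<omega> = k \<and> Z (s + t) \<omega> = j)"
    by (rule prob_eq_AE) (use 0 s st in auto)
  show ?thesis
  proof (cases "trans_prob P Z s i k = 0")
    case True
    have "\<P>(\<omega> in P i. Z s \<omega> = k \<and> Z (s + t) \<omega> = j) \<le> trans_prob P Z s i k"
      unfolding trans_prob_def by (rule finite_measure_mono) (use s in auto)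
    then show ?thesis using True by (simp add: measure_le_0_iff)
  next
    case False
    define \<tau> :: "nat \<Rightarrow> real" where "\<tau> = (\<lambda>n. if n = 0 then 0 else if n = 1 then s else s + t)"
    define x :: "nat \<Rightarrow> nat" where "x = (\<lambda>n. if n = 0 then i else if n = 1 then k else j)"
    have all: "(\<forall>k\<le>1. Q k) \<longleftrightarrow> Q 0 \<and> Q 1" for Q :: "nat \<Rightarrow> bool" by (auto simp: le_Suc_eq)
    have "\<P>(\<omega> in P i. Z (\<tau> (Suc 1)) \<omega> = x (Suc 1) \<bar> \<forall>k\<le>1. Z (\<tau> k) \<omega> = x k)
        = trans_prob P Z (\<tau> (Suc 1) - \<tau> 1) (x 1) (x (Suc 1))"
    proof (rule markov)
      show "0 < \<P>(\<omega> in P i. \<forall>k\<le>1. Z (\<tau> k) \<omega> = x k)"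
        unfolding all using A False trans_prob_nonneg[of s i k] by (simp add: \<tau>_def x_def)
    qed (use s t in \<open>auto simp: \<tau>_def\<close>)
    then have "\<P>(\<omega> in P i. Z (s + t) \<omega> = j \<and> Z 0 \<omega> = i \<and> Z s \<omega> = k) / trans_prob P Z s i k = trans_prob P Z t k j"
      unfolding all cond_prob_def using A by (simp add: \<tau>_def x_def)
    then show ?thesis using False B by (simp add: field_simps)
  qed
qed

lemma chapman_kolmogorov:
  assumes i: "i \<in> insert 0 S" and s: "0 \<le> s" and t: "0 \<le> t"
  shows "(\<lambda>k. trans_prob P Z s i k * trans_prob P Z t k j) sums trans_prob P Z (s + t) i j"
proof -
  interpret prob_space "P i" using i by (simp add: prob_space_P)
  have "(\<lambda>k. \<P>(\<omega> in P i. Z s \<omega> = k \<and> Z (s + t) \<omega> = j)) sums \<P>(\<omega> in P i. Z (s + t) \<omega> = j)"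
    by (rule sums_prob_nat_cases) (use measurable_Z[OF i] s t in auto)
  then show ?thesis unfolding trans_prob_joint[OF assms] by (simp add: trans_prob_def)
qed

lemma pgf_sums:
  assumes t: "0 \<le> t" and x: "norm x \<le> 1"
  shows "(\<lambda>j. of_real (trans_prob P Z t 1 j) * x ^ j) sums transition_pgf P Z t x"
  unfolding transition_pgf_def
proof (rule summable_sums, rule summable_comparison_test)
  show "\<exists>N. \<forall>n\<ge>N. norm (of_real (trans_prob P Z t 1 n) * x ^ n) \<le> trans_prob P Z t 1 n"
    using x by (auto simp: norm_mult norm_power trans_prob_nonneg intro!: mult_left_le power_le_one)
  show "summable (trans_prob P Z t 1)"
    using trans_prob_sums[of 1 t] t one_in_S by (auto simp: sums_iff)
qed

lemma pgf_sums_real: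
  assumes t: "0 \<le> t" and x: "norm (x :: real) \<le> 1"
  shows "(\<lambda>j. trans_prob P Z t 1 j * x ^ j) sums transition_pgf P Z t x"
  using pgf_sums[OF assms] by simp

lemma trans_prob_pgf_power:
  assumes i: "i \<in> insert 0 S" and t: "0 \<le> t" and x: "\<bar>x\<bar> < (1::real)"
  shows "(\<lambda>j. trans_prob P Z t i j * x ^ j) sums (transition_pgf P Z t x ^ i)"
proof -
  let ?F = "Abs_fps (trans_prob P Z t 1)"
  have "conv_radius (trans_prob P Z t 1) \<ge> 1"
    by (rule conv_radius_geI_ex') (use pgf_sums_real[OF t] in \<open>auto simp: sums_iff\<close>)
  then have r: "norm x < fps_conv_radius ?F"
    using x by (simp add: fps_conv_radius_def) (metis ereal_less(3) less_le_trans)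
  have "norm x < fps_conv_radius (?F ^ i)"
    using less_le_trans[OF r fps_conv_radius_power] .
  from sums_eval_fps[OF this] have "(\<lambda>j. fps_nth (?F ^ i) j * x ^ j) sums (eval_fps ?F x ^ i)"
    unfolding eval_fps_power[OF r] by simp
  moreover have "eval_fps ?F x = transition_pgf P Z t x"
    using sums_eval_fps[OF r] pgf_sums_real[OF t, of x] x by (auto simp: sums_iff)
  ultimately show ?thesis using branching[OF i t] by simp
qed

text \<open>Termwise comparison with the series of total mass 1. The second bound keeps the
  generating function below 1 once p_11(t) is positive; the third, uniform in x, is the source of
  continuity in time.\<close>

lemma pgf_bounds:
  assumes t: "0 \<le> t" and x: "0 \<le> x" "x \<le> (1::real)"
  shows "0 \<le> transition_pgf P Z t x"
    and "transition_pgf P Z t x \<le> 1 - trans_prob P Z t 1 1 * (1 - x)"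
    and "\<bar>transition_pgf P Z t x - x\<bar> \<le> 1 - trans_prob P Z t 1 1"
proof -
  let ?p = "trans_prob P Z t 1"
  have 1: "1 \<in> insert 0 S" using one_in_S by simp
  have s1: "(\<lambda>j. ?p j * x ^ j) sums transition_pgf P Z t x"
    by (rule pgf_sums_real) (use t x in auto)
  have one: "(\<lambda>j. if j = 1 then c else 0) sums c" for c :: real
    using sums_single[of 1 "\<lambda>_. c"] by simp
  have le1: "x ^ j \<le> 1" for j using x by (simp add: power_le_one)
  have nn: "0 \<le> ?p j * x ^ j" for j using x by (simp add: trans_prob_nonneg)
  show "0 \<le> transition_pgf P Z t x" by (rule sums_le[OF _ sums_zero s1]) (rule nn)
  show A: "transition_pgf P Z t x \<le> 1 - ?p 1 * (1 - x)"
  proof (rule sums_le[OF _ s1 sums_diff[OF trans_prob_sums[OF 1 t] one]])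
    fix j show "?p j * x ^ j \<le> ?p j - (if j = 1 then ?p 1 * (1 - x) else 0)"
      using mult_left_le[OF le1 trans_prob_nonneg] by (auto simp: algebra_simps)
  qed
  have B: "?p 1 * x \<le> transition_pgf P Z t x"
    by (rule sums_le[OF _ one s1]) (use nn in auto)
  have "?p 1 \<le> 1"
    by (rule sums_le[OF _ one trans_prob_sums[OF 1 t]]) (auto simp: trans_prob_nonneg)
  then have "(1 - ?p 1) * x \<le> 1 - ?p 1" using x by (simp add: mult_left_le)
  then have "x - ?p 1 * x \<le> 1 - ?p 1" by (simp add: algebra_simps)
  moreover have "1 - ?p 1 * (1 - x) - x = (1 - ?p 1) * (1 - x)" by (simp add: algebra_simps)
  moreover have "(1 - ?p 1) * (1 - x) \<le> 1 - ?p 1" using x \<open>?p 1 \<le> 1\<close> by (simp add: mult_left_le)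
  ultimately show "\<bar>transition_pgf P Z t x - x\<bar> \<le> 1 - ?p 1"
    using A B by (intro abs_leI) linarith+
qed

lemma pgf_semigroup:
  assumes s: "0 \<le> s" and t: "0 \<le> t" and x: "0 \<le> x" "x < (1::real)"
  shows "transition_pgf P Z (s + t) x = transition_pgf P Z s (transition_pgf P Z t x)"
proof -
  let ?p = "trans_prob P Z"
  let ?y = "transition_pgf P Z t x"
  have 1: "1 \<in> insert 0 S" using one_in_S by simp
  have y: "0 \<le> ?y" "?y \<le> 1"
  proof -
    show "0 \<le> ?y" using pgf_bounds(1)[OF t] x by simp
    have "0 \<le> ?p t 1 1 * (1 - x)" using x by (simp add: trans_prob_nonneg)
    then show "?y \<le> 1" using pgf_bounds(2)[OF t, of x] x by simp
  qed
  let ?f = "\<lambda>(k, j). ?p s 1 k * (?p t k j * x ^ j)"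
  have nn: "0 \<le> ?f q" for q using x by (auto simp: trans_prob_nonneg split: prod.split)
  have inner: "((\<lambda>j. ?f (k, j)) has_sum (?p s 1 k * ?y ^ k)) UNIV" for k
  proof (cases "k \<in> insert 0 S")
    case True
    have "(\<lambda>j. ?f (k, j)) sums (?p s 1 k * ?y ^ k)"
      using sums_mult[OF trans_prob_pgf_power[OF True t, of x]] x by simp
    moreover from this have "summable (\<lambda>j. norm (?f (k, j)))"
      using nn by (auto simp: sums_iff abs_of_nonneg split: prod.splits)
    ultimately show ?thesis by (rule norm_summable_imp_has_sum[rotated])
  next
    case False
    then show ?thesis using trans_prob_outside[OF 1 s] by (simp add: has_sum_0)
  qed
  have outer: "((\<lambda>k. ?p s 1 k * ?y ^ k) has_sum transition_pgf P Z s ?y) UNIV"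
  proof (rule norm_summable_imp_has_sum)
    show *: "(\<lambda>k. ?p s 1 k * ?y ^ k) sums transition_pgf P Z s ?y"
      by (rule pgf_sums_real) (use s y in auto)
    then show "summable (\<lambda>k. norm (?p s 1 k * ?y ^ k))"
      using y by (simp add: sums_iff trans_prob_nonneg abs_mult)
  qed
  have "(?f has_sum transition_pgf P Z s ?y) (UNIV \<times> UNIV)"
  proof (rule has_sum_SigmaI[OF inner outer])
    show "?f summable_on UNIV \<times> UNIV"
      by (rule summable_on_SigmaI[OF inner]) (use outer nn in \<open>auto simp: summable_on_def\<close>)
  qed
  then have sw: "((\<lambda>(j, k). ?f (k, j)) has_sum transition_pgf P Z s ?y) (UNIV \<times> UNIV)"
    by (subst (asm) has_sum_swap) simp
  have inner': "((\<lambda>k. (\<lambda>(j, k). ?f (k, j)) (j, k)) has_sum (?p (s + t) 1 j * x ^ j)) UNIV" for j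
  proof -
    have "(\<lambda>k. ?f (k, j)) sums (?p (s + t) 1 j * x ^ j)"
      using sums_mult2[OF chapman_kolmogorov[OF 1 s t, of j], of "x ^ j"] by (simp add: mult.assoc)
    moreover from this have "summable (\<lambda>k. norm (?f (k, j)))"
      using nn by (auto simp: sums_iff abs_of_nonneg split: prod.splits)
    ultimately show ?thesis using norm_summable_imp_has_sum by fastforce
  qed
  have "((\<lambda>j. ?p (s + t) 1 j * x ^ j) has_sum transition_pgf P Z s ?y) UNIV"
    by (rule has_sum_SigmaD[OF sw inner'])
  then have "(\<lambda>j. ?p (s + t) 1 j * x ^ j) sums transition_pgf P Z s ?y"
    by (rule has_sum_imp_sums)
  moreover have "(\<lambda>j. ?p (s + t) 1 j * x ^ j) sums transition_pgf P Z (s + t) x"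
    by (rule pgf_sums_real) (use s t x in auto)
  ultimately show ?thesis by (rule sums_unique2[symmetric])
qed

section \<open>Small times and the backward equation\<close>

lemma trans_prob_one_near_zero:
  assumes j: "j \<in> insert 0 S" and e: "0 < e"
  shows "\<forall>\<^sub>F \<epsilon> in at_right 0. \<bar>trans_prob P Z \<epsilon> 1 j - (of_bool (j = 1) + a j * \<epsilon>)\<bar> \<le> e * \<epsilon>"
  using landau_o.smallD[OF infinitesimal[OF j] e] eventually_at_right_less[of 0]
  by eventually_elim auto

lemma infinitesimal_gf_sums:
  assumes x: "\<bar>x\<bar> \<le> 1"
  shows "(\<lambda>j. of_bool (j \<in> insert 0 S) * a j * x ^ j) sums infinitesimal_gf S a x"
proof -
  have "a summable_on (insert 0 S - {1})" using a_has_sum by (auto simp: summable_on_def)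
  then have "a summable_on insert 1 (insert 0 S - {1})" by (rule summable_on_insert_iff[THEN iffD2])
  moreover have "insert 1 (insert 0 S - {1}) = insert 0 S" using one_in_S by auto
  ultimately have "a summable_on insert 0 S" by simp
  then have "(\<lambda>j. norm (a j)) summable_on insert 0 S" by (rule summable_on_iff_abs_summable_on_real[THEN iffD1])
  then have "(\<lambda>j. norm (a j * x ^ j)) summable_on insert 0 S"
  proof (rule Infinite_Sum.abs_summable_on_comparison_test)
    fix j
    show "norm (a j * x ^ j) \<le> norm (a j)"
      using x by (simp add: abs_mult power_abs power_le_one mult_left_le)
  qed
  then have "(\<lambda>j. a j * x ^ j) summable_on insert 0 S" by (rule Infinite_Sum.abs_summable_summable)
  then have "((\<lambda>j. a j * x ^ j) has_sum infinitesimal_gf S a x) (insert 0 S)"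
    unfolding infinitesimal_gf_def by (rule has_sum_infsum)
  then have "((\<lambda>j. of_bool (j \<in> insert 0 S) * a j * x ^ j) has_sum infinitesimal_gf S a x) UNIV"
    by (rule has_sum_cong_neutral[THEN iffD1, rotated -1]) auto
  then show ?thesis by (rule has_sum_imp_sums)
qed

text \<open>The o(\<epsilon>) terms are not uniform in j. Finitely many states are treated
  individually; the tail carries the factor r^(J+1), while its total mass is O(\<epsilon>) because 1
  - p_11(\<epsilon>) is. Uniformity in x is what later permits a moving base point.\<close>

lemma pgf_expansion:
  assumes r: "0 \<le> r" "r < 1" and e: "0 < e"
  shows "\<forall>\<^sub>F \<epsilon> in at_right 0. \<forall>x\<in>{0..r}.
    \<bar>transition_pgf P Z \<epsilon> x - x - \<epsilon> * infinitesimal_gf S a x\<bar> \<le> e * \<epsilon>"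
proof -
  let ?p = "\<lambda>\<epsilon>. trans_prob P Z \<epsilon> 1"
  define b where "b j = of_bool (j \<in> insert 0 S) * a j" for j
  have 1: "1 \<in> insert 0 S" using one_in_S by simp
  have b_nonneg: "0 \<le> b j" if "j \<noteq> 1" for j
    using a_nonneg[of j] that by (auto simp: b_def)
  have b1: "b 1 = a 1" using 1 by (simp add: b_def)
  have a1: "a 1 < 0" using a_0_pos a_0_less by simp
  have sum_b: "(\<lambda>j. of_bool (j \<noteq> 1) * b j) sums (- a 1)"
  proof -
    have "((\<lambda>j. of_bool (j \<noteq> 1) * b j) has_sum (- a 1)) UNIV"
      using a_has_sum by (rule has_sum_cong_neutral[THEN iffD1, rotated -1]) (auto simp: b_def)
    then show ?thesis by (rule has_sum_imp_sums)
  qed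
  \<comment> \<open>The factor 1 - 2 a 1 is the constant in the bound D for the total mass of the
    majorant d, divided by \<epsilon>.\<close>
  obtain J where J: "r ^ Suc J * (1 - 2 * a 1) < e / 2"
  proof -
    have "(\<lambda>J. r ^ J) \<longlonglongrightarrow> 0" by (rule LIMSEQ_realpow_zero[OF r])
    then have "(\<lambda>J. r ^ J * (1 - 2 * a 1)) \<longlonglongrightarrow> 0 * (1 - 2 * a 1)" by (intro tendsto_mult tendsto_const)
    then have "eventually (\<lambda>J. r ^ J * (1 - 2 * a 1) < e / 2) sequentially"
      using e by (intro order_tendstoD) auto
    then obtain n where "\<forall>J\<ge>n. r ^ J * (1 - 2 * a 1) < e / 2" by (auto simp: eventually_at_top_linorder)
    then have "r ^ Suc n * (1 - 2 * a 1) < e / 2" by (meson le_SucI order_refl)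
    then show thesis by (rule that)
  qed
  \<comment> \<open>The part 1 yields 1 - p_11(\<epsilon>) \<le> (1 - a 1) \<epsilon>; the other
    part lets the J + 2 individually treated states contribute at most e \<epsilon> / 2.\<close>
  define e' where "e' = min 1 (e / (2 * real (Suc (Suc J))))"
  have e': "0 < e'" using e by (simp add: e'_def)
  have "\<forall>\<^sub>F \<epsilon> in at_right 0. \<forall>j\<in>{..Suc J}. \<bar>?p \<epsilon> j - (of_bool (j = 1) + b j * \<epsilon>)\<bar> \<le> e' * \<epsilon>"
  proof (rule eventually_ball_finite)
    show "\<forall>j\<in>{..Suc J}. \<forall>\<^sub>F \<epsilon> in at_right 0. \<bar>?p \<epsilon> j - (of_bool (j = 1) + b j * \<epsilon>)\<bar> \<le> e' * \<epsilon>"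
    proof
      fix j
      show "\<forall>\<^sub>F \<epsilon> in at_right 0. \<bar>?p \<epsilon> j - (of_bool (j = 1) + b j * \<epsilon>)\<bar> \<le> e' * \<epsilon>"
      proof (cases "j \<in> insert 0 S")
        case True
        then show ?thesis using trans_prob_one_near_zero[OF True e'] by (simp add: b_def)
      next
        case False
        then have j1: "j \<noteq> 1" "b j = 0" using 1 by (auto simp: b_def)
        show ?thesis using eventually_at_right_less[of 0]
        proof eventually_elim
          case (elim \<epsilon>)
          have "?p \<epsilon> j = 0" using elim by (intro trans_prob_outside 1 False) simp
          then show ?case using elim j1 e' by simp
        qed
      qed
    qed
  qed simp
  then show ?thesis using eventually_at_right_less[of 0]
  proof eventually_elim
    case (elim \<epsilon>)
    then have \<epsilon>: "0 < \<epsilon>" by simp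
    define c where "c j = ?p \<epsilon> j - (of_bool (j = 1) + b j * \<epsilon>)" for j
    have c: "\<bar>c j\<bar> \<le> e' * \<epsilon>" if "j \<le> Suc J" for j using elim that by (simp add: c_def)
    define d where "d j = of_bool (j \<noteq> 1) * (?p \<epsilon> j + b j * \<epsilon>)" for j
    have one: "(\<lambda>j. if j = 1 then u else 0) sums u" for u :: real
      using sums_single[of 1 "\<lambda>_. u"] by simp
    have "(\<lambda>j. (?p \<epsilon> j - (if j = 1 then ?p \<epsilon> 1 else 0)) + (of_bool (j \<noteq> 1) * b j) * \<epsilon>)
        sums ((1 - ?p \<epsilon> 1) + (- a 1) * \<epsilon>)"
      using \<epsilon> by (intro sums_add sums_diff sums_mult2 trans_prob_sums one sum_b 1) simp
    also have "(\<lambda>j. (?p \<epsilon> j - (if j = 1 then ?p \<epsilon> 1 else 0)) + (of_bool (j \<noteq> 1) * b j) * \<epsilon>) = d"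
      by (auto simp: d_def)
    finally have sum_d: "d sums ((1 - ?p \<epsilon> 1) + (- a 1) * \<epsilon>)" .
    have d_nonneg: "0 \<le> d j" for j
      using b_nonneg[of j] \<epsilon> by (auto simp: d_def trans_prob_nonneg)
    have "1 - ?p \<epsilon> 1 \<le> (1 - a 1) * \<epsilon>"
    proof -
      have "\<bar>c 1\<bar> \<le> 1 * \<epsilon>"
        by (rule order_trans[OF c]) (use \<epsilon> in \<open>auto simp: e'_def\<close>)
      then show ?thesis using b1 by (simp add: c_def algebra_simps)
    qed
    then have D: "(1 - ?p \<epsilon> 1) + (- a 1) * \<epsilon> \<le> (1 - 2 * a 1) * \<epsilon>" by (simp add: algebra_simps)
    show ?case
    proof
      fix x assume "x \<in> {0..r}"
      then have x: "0 \<le> x" "x \<le> r" by auto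
      have "(\<lambda>j. ?p \<epsilon> j * x ^ j - (if j = 1 then x else 0) - \<epsilon> * (of_bool (j \<in> insert 0 S) * a j * x ^ j))
          sums (transition_pgf P Z \<epsilon> x - x - \<epsilon> * infinitesimal_gf S a x)"
        using \<epsilon> x r by (intro sums_diff sums_mult pgf_sums_real one infinitesimal_gf_sums) auto
      also have "(\<lambda>j. ?p \<epsilon> j * x ^ j - (if j = 1 then x else 0) - \<epsilon> * (of_bool (j \<in> insert 0 S) * a j * x ^ j))
          = (\<lambda>j. c j * x ^ j)"
        by (auto simp: c_def b_def algebra_simps)
      finally have s1: "(\<lambda>j. c j * x ^ j) sums (transition_pgf P Z \<epsilon> x - x - \<epsilon> * infinitesimal_gf S a x)" .
      have s2: "(\<lambda>j. (if j \<in> {..Suc J} then \<bar>c j\<bar> else 0) + r ^ Suc J * d j)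
          sums ((\<Sum>j\<le>Suc J. \<bar>c j\<bar>) + r ^ Suc J * ((1 - ?p \<epsilon> 1) + (- a 1) * \<epsilon>))"
        by (intro sums_add sums_mult sum_d sums_If_finite_set) simp
      have le: "\<bar>c j * x ^ j\<bar> \<le> (if j \<in> {..Suc J} then \<bar>c j\<bar> else 0) + r ^ Suc J * d j" for j
      proof (cases "j \<le> Suc J")
        case True
        have "\<bar>c j * x ^ j\<bar> \<le> \<bar>c j\<bar> * 1"
          unfolding abs_mult using x r by (intro mult_left_mono) (auto simp: power_le_one power_abs)
        then show ?thesis using True d_nonneg[of j] r by (auto intro: add_increasing2)
      next
        case False
        then have "\<bar>c j\<bar> \<le> d j"
          using b_nonneg[of j] \<epsilon> trans_prob_nonneg[of \<epsilon> 1 j] by (auto simp: c_def d_def abs_le_iff)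
        moreover have "x ^ j \<le> r ^ Suc J"
          using False x r by (intro order_trans[OF power_mono[OF x(2,1)] power_decreasing]) auto
        ultimately have "\<bar>c j\<bar> * x ^ j \<le> d j * r ^ Suc J"
          using x by (intro mult_mono) (auto simp: d_nonneg)
        then show ?thesis using False x by (simp add: abs_mult power_abs mult.commute)
      qed
      have le1: "- ((if j \<in> {..Suc J} then \<bar>c j\<bar> else 0) + r ^ Suc J * d j) \<le> c j * x ^ j"
        and le2: "c j * x ^ j \<le> (if j \<in> {..Suc J} then \<bar>c j\<bar> else 0) + r ^ Suc J * d j" for j
        using le[of j] by linarith+
      have "\<bar>transition_pgf P Z \<epsilon> x - x - \<epsilon> * infinitesimal_gf S a x\<bar>
          \<le> (\<Sum>j\<le>Suc J. \<bar>c j\<bar>) + r ^ Suc J * ((1 - ?p \<epsilon> 1) + (- a 1) * \<epsilon>)"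
        using sums_le[OF le1 sums_minus[OF s2] s1] sums_le[OF le2 s1 s2] by (simp add: abs_le_iff)
      also have "(\<Sum>j\<le>Suc J. \<bar>c j\<bar>) \<le> (\<Sum>j\<le>Suc J. e' * \<epsilon>)"
        by (rule sum_mono) (use c in auto)
      also have "\<dots> = real (Suc (Suc J)) * e' * \<epsilon>" by simp
      also have "real (Suc (Suc J)) * e' \<le> real (Suc (Suc J)) * (e / (2 * real (Suc (Suc J))))"
        by (rule mult_left_mono) (auto simp: e'_def)
      also have "\<dots> = e / 2" by (simp del: of_nat_Suc)
      also have "r ^ Suc J * ((1 - ?p \<epsilon> 1) + (- a 1) * \<epsilon>) \<le> r ^ Suc J * ((1 - 2 * a 1) * \<epsilon>)"
        using r by (intro mult_left_mono D) auto
      also have "\<dots> = (r ^ Suc J * (1 - 2 * a 1)) * \<epsilon>" by simp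
      also have "\<dots> \<le> (e / 2) * \<epsilon>" using J \<epsilon> by (intro mult_right_mono) auto
      finally show "\<bar>transition_pgf P Z \<epsilon> x - x - \<epsilon> * infinitesimal_gf S a x\<bar> \<le> e * \<epsilon>"
        using \<epsilon> by (simp add: mult.commute)
    qed
  qed
qed

lemma trans_prob_one_one_tendsto: "((\<lambda>t. trans_prob P Z t 1 1) \<longlongrightarrow> 1) (at_right 0)"
proof -
  have 1: "1 \<in> insert 0 S" using one_in_S by simp
  have "\<forall>\<^sub>F \<epsilon> in at_right 0. norm (trans_prob P Z \<epsilon> 1 1 - 1) \<le> (1 + \<bar>a 1\<bar>) * \<epsilon>"
    using trans_prob_one_near_zero[OF 1 zero_less_one] eventually_at_right_less[of 0]
  proof eventually_elim
    case (elim \<epsilon>)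
    have "(1 + \<bar>a 1\<bar>) * \<epsilon> = \<epsilon> + \<bar>a 1 * \<epsilon>\<bar>"
      using elim by (simp add: abs_mult algebra_simps)
    moreover have "\<bar>trans_prob P Z \<epsilon> 1 1 - (1 + a 1 * \<epsilon>)\<bar> \<le> \<epsilon>" using elim by simp
    ultimately show ?case unfolding real_norm_def by linarith
  qed
  moreover have "((\<lambda>\<epsilon>. (1 + \<bar>a 1\<bar>) * \<epsilon>) \<longlongrightarrow> 0) (at_right 0)"
    by (rule tendsto_mult_right_zero) (rule tendsto_ident_at)
  ultimately have "((\<lambda>t. trans_prob P Z t 1 1 - 1) \<longlongrightarrow> 0) (at_right 0)"
    by (rule Lim_null_comparison)
  then show ?thesis by (rule Lim_null[THEN iffD2])
qed

lemma trans_prob_time_zero: "trans_prob P Z 0 1 1 = 1"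
proof -
  have 1: "1 \<in> insert 0 S" using one_in_S by simp
  interpret prob_space "P 1" using 1 by (rule prob_space_P)
  have "\<P>(\<omega> in P 1. Z 0 \<omega> = 1) = 1"
    using prob_eq_1[of "{\<omega> \<in> space (P 1). Z 0 \<omega> = 1}"] start[OF 1] measurable_Z[OF 1, of 0] by auto
  then show ?thesis by (simp add: trans_prob_def)
qed

text \<open>p_11 is supermultiplicative in time and positive for small times, so splitting t into
  many short steps suffices.\<close>

lemma trans_prob_one_one_pos:
  assumes t: "0 \<le> t"
  shows "0 < trans_prob P Z t 1 1"
proof -
  have 1: "1 \<in> insert 0 S" using one_in_S by simp
  interpret prob_space "P 1" using 1 by (rule prob_space_P)
  have mult: "trans_prob P Z s 1 1 * trans_prob P Z u 1 1 \<le> trans_prob P Z (s + u) 1 1"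
    if "0 \<le> s" "0 \<le> u" for s u
  proof -
    have "\<P>(\<omega> in P 1. Z s \<omega> = 1 \<and> Z (s + u) \<omega> = 1) \<le> trans_prob P Z (s + u) 1 1"
      unfolding trans_prob_def
      by (rule finite_measure_mono) (use measurable_Z[OF 1, of "s + u"] that in auto)
    then show ?thesis using trans_prob_joint[OF 1 that, of 1 1] by simp
  qed
  note zero = trans_prob_time_zero
  obtain d where d: "0 < d" "\<And>h. 0 < h \<Longrightarrow> h < d \<Longrightarrow> 0 < trans_prob P Z h 1 1"
    using order_tendstoD(1)[OF trans_prob_one_one_tendsto, of 0] by (auto simp: eventually_at_right_field)
  obtain n where n: "t / real (Suc n) < d"
  proof -
    obtain n where "t / d < real n" using reals_Archimedean2 by blast
    then have "t < real (Suc n) * d" using d by (simp add: field_simps)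
    then show thesis using that[of n] by (simp add: field_simps)
  qed
  define h where "h = t / real (Suc n)"
  have h: "0 \<le> h" using t by (simp add: h_def)
  have hp: "0 < trans_prob P Z h 1 1"
  proof (cases "h = 0")
    case True
    then show ?thesis using zero by simp
  next
    case False
    then have "0 < h" using h by simp
    then show ?thesis by (rule d(2)) (use n in \<open>simp only: h_def\<close>)
  qed
  have "0 < trans_prob P Z (real k * h) 1 1" for k
  proof (induction k)
    case (Suc k)
    have "0 < trans_prob P Z h 1 1 * trans_prob P Z (real k * h) 1 1" using Suc hp by (intro mult_pos_pos) simp_all
    also have "\<dots> \<le> trans_prob P Z (h + real k * h) 1 1" using h by (intro mult) auto
    finally show ?case by (simp add: algebra_simps)
  qed (use zero in simp)
  from this[of "Suc n"] show ?thesis by (simp add: h_def)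
qed

lemma pgf_less_one:
  assumes "0 \<le> t" "0 \<le> x" "x < (1::real)"
  shows "transition_pgf P Z t x < 1"
  using pgf_bounds(2)[of t x] trans_prob_one_one_pos[OF assms(1)] assms
  by (smt (verit) mult_pos_pos)

text \<open>By the semigroup property, an increment over h is F(h; y) - y with y the earlier value,
  to which the uniform expansion applies. For the left derivative this base point moves with s, so
  continuity of s -> f(F(s; x)) is needed as well.\<close>

lemma pgf_has_derivative:
  assumes t: "0 \<le> t" and x: "0 \<le> x" "x < 1"
    and cont: "continuous_on {0..<1} (infinitesimal_gf S a)"
  shows "((\<lambda>t. transition_pgf P Z t x) has_real_derivative infinitesimal_gf S a (transition_pgf P Z t x))
    (at t within {0..})"
proof -
  let ?f = "infinitesimal_gf S a"
  define g where "g t = transition_pgf P Z t x" for t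
  have g: "0 \<le> g s" "g s < 1" if "0 \<le> s" for s
    using pgf_bounds(1)[OF that, of x] pgf_less_one[OF that x] x by (auto simp: g_def)
  have shift: "g (s + h) = transition_pgf P Z h (g s)" if "0 \<le> s" "0 \<le> h" for s h
    using pgf_semigroup[OF that(2,1) x] by (simp add: g_def add.commute)
  have step: "\<bar>g (s + h) - g s\<bar> \<le> 1 - trans_prob P Z h 1 1" if "0 \<le> s" "0 \<le> h" for s h
    unfolding shift[OF that] by (rule pgf_bounds(3)) (use that g[of s] in auto)
  have g_cont: "(g \<longlongrightarrow> g t) (at t within {0..})"
  proof (rule tendstoI)
    fix e :: real assume "0 < e"
    then obtain d where d: "0 < d" "\<And>h. 0 < h \<Longrightarrow> h < d \<Longrightarrow> 1 - trans_prob P Z h 1 1 < e"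
      using order_tendstoD(1)[OF trans_prob_one_one_tendsto, of "1 - e"]
      by (auto simp: eventually_at_right_field algebra_simps)
    show "\<forall>\<^sub>F s in at t within {0..}. dist (g s) (g t) < e"
      unfolding eventually_at
    proof (intro exI conjI ballI impI)
      show "0 < d" by fact
      fix s assume s: "s \<in> {0..}" "s \<noteq> t \<and> dist s t < d"
      show "dist (g s) (g t) < e"
      proof (cases "s < t")
        case True
        then show ?thesis
          using step[of s "t - s"] d(2)[of "t - s"] s by (simp add: dist_real_def)
      next
        case False
        then show ?thesis
          using step[of t "s - t"] d(2)[of "s - t"] s t by (simp add: dist_real_def)
      qed
    qed
  qed
  have f_cont: "((\<lambda>s. ?f (g s)) \<longlongrightarrow> ?f (g t)) (at t within {0..})"
    by (rule continuous_on_tendsto_compose[OF cont g_cont])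
      (use g t in \<open>auto simp: eventually_at intro!: exI[of _ 1]\<close>)
  \<comment> \<open>Any value strictly between g t and 1: for s near t all base points stay in
    {0..r}, where the expansion is uniform.\<close>
  define r where "r = (1 + g t) / 2"
  have r: "0 \<le> r" "r < 1" "g t < r" using g[OF t] by (auto simp: r_def)
  have "((\<lambda>s. (g s - g t) / (s - t)) \<longlongrightarrow> ?f (g t)) (at t within {0..})"
  proof (rule tendstoI)
    fix e :: real assume e: "0 < e"
    obtain d where d: "0 < d"
      "\<And>h y. 0 < h \<Longrightarrow> h < d \<Longrightarrow> y \<in> {0..r} \<Longrightarrow> \<bar>transition_pgf P Z h y - y - h * ?f y\<bar> \<le> (e / 3) * h"
      using pgf_expansion[OF r(1,2), of "e / 3"] e by (auto simp: eventually_at_right_field)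
    have quot: "\<bar>(g (s + h) - g s) / h - ?f (g s)\<bar> \<le> e / 3" if "0 \<le> s" "0 < h" "h < d" "g s \<le> r" for s h
    proof -
      have "\<bar>g (s + h) - g s - h * ?f (g s)\<bar> \<le> (e / 3) * h"
        using d(2)[of h "g s"] that g[of s] shift[of s h] by simp
      moreover have "(g (s + h) - g s) / h - ?f (g s) = (g (s + h) - g s - h * ?f (g s)) / h"
        using that by (simp add: field_simps)
      ultimately show ?thesis using that by (simp add: field_simps)
    qed
    have "\<forall>\<^sub>F s in at t within {0..}. s \<in> {0..} \<and> s \<noteq> t" by (auto simp: eventually_at intro!: exI[of _ 1])
    moreover have "\<forall>\<^sub>F s in at t within {0..}. dist s t < d" using d by (auto simp: eventually_at)
    moreover have "\<forall>\<^sub>F s in at t within {0..}. g s < r" using g_cont r by (intro order_tendstoD)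
    moreover have "\<forall>\<^sub>F s in at t within {0..}. dist (?f (g s)) (?f (g t)) < e / 3"
      by (rule tendstoD[OF f_cont]) (use e in simp)
    ultimately show "\<forall>\<^sub>F s in at t within {0..}. dist ((g s - g t) / (s - t)) (?f (g t)) < e"
    proof eventually_elim
      case (elim s)
      show ?case
      proof (cases "s < t")
        case True
        have "(g s - g t) / (s - t) = (g (s + (t - s)) - g s) / (t - s)"
          using minus_divide_divide[of "g t - g s" "t - s"] by simp
        moreover have "\<bar>(g (s + (t - s)) - g s) / (t - s) - ?f (g s)\<bar> \<le> e / 3"
          by (rule quot) (use True elim in \<open>auto simp: dist_real_def\<close>)
        moreover have "\<bar>?f (g s) - ?f (g t)\<bar> < e / 3" using elim by (simp add: dist_real_def)
        ultimately show ?thesis using e unfolding dist_real_def by linarith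
      next
        case False
        have "\<bar>(g (t + (s - t)) - g t) / (s - t) - ?f (g t)\<bar> \<le> e / 3"
          by (rule quot) (use False elim t r in \<open>auto simp: dist_real_def\<close>)
        then show ?thesis using e by (simp add: dist_real_def)
      qed
    qed
  qed
  then show ?thesis by (simp add: has_field_derivative_iff g_def)
qed

end

section \<open>The law of the Q-process\<close>

context markov_branching_process
begin

context
  notes One_nat_def [simp del]
begin

lemma trans_prob_zero:
  assumes "0 \<le> t" shows "trans_prob P Z t 0 j = of_bool (j = 0)"
  using branching[of 0 t j] assms by simp

lemma trans_prob_to_zero:
  assumes "i \<in> insert 0 S" "0 \<le> t" shows "trans_prob P Z t i 0 = trans_prob P Z t 1 0 ^ i"
  using branching[OF assms, of 0] by (simp add: fps_power_zeroth)

lemma survival_prob_eq: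
  assumes "0 \<le> t"
  shows "survival_prob P Z t = 1 - trans_prob P Z t 1 0"
    and "survival_prob P Z t = 1 - transition_pgf P Z t 0"
proof -
  have 1: "1 \<in> insert 0 S" using one_in_S by simp
  interpret prob_space "P 1" using 1 by (rule prob_space_P)
  have "survival_prob P Z t = \<P>(\<omega> in P 1. \<not> Z t \<omega> = 0)"
    by (simp add: survival_prob_def)
  also have "\<dots> = 1 - trans_prob P Z t 1 0"
    unfolding trans_prob_def by (rule prob_neg) (use measurable_Z[OF 1 assms] in measurable)
  finally show *: "survival_prob P Z t = 1 - trans_prob P Z t 1 0" .
  have "(\<lambda>j. trans_prob P Z t 1 j * 0 ^ j) sums (trans_prob P Z t 1 0)"
    using powser_sums_zero[of "trans_prob P Z t 1"] by simp
  then show "survival_prob P Z t = 1 - transition_pgf P Z t 0"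
    using pgf_sums_real[OF assms, of 0] * by (auto simp: sums_iff)
qed

section \<open>The extinction time as a random variable\<close>

lemma path_locally_constant:
  assumes "\<omega> \<in> space (P 1)" "0 \<le> t"
  obtains d where "0 < d" "\<And>u. t \<le> u \<Longrightarrow> u < t + d \<Longrightarrow> Z u \<omega> = Z t \<omega>"
proof -
  have "((\<lambda>u. Z u \<omega>) \<longlongrightarrow> Z t \<omega>) (at_right t)"
    using right_continuous[of 1 \<omega> t] assms one_in_S by (simp add: continuous_within)
  then have "eventually (\<lambda>u. Z u \<omega> \<in> {Z t \<omega>}) (at_right t)"
    by (rule topological_tendstoD) (rule discrete_topology_class.open_discrete, simp)
  then obtain b where b: "t < b" "\<And>u. t < u \<Longrightarrow> u < b \<Longrightarrow> Z u \<omega> = Z t \<omega>"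
    by (auto simp: eventually_at_right_field)
  show thesis
  proof
    show "0 < b - t" using b by simp
    fix u assume "t \<le> u" "u < t + (b - t)"
    then show "Z u \<omega> = Z t \<omega>" using b(2)[of u] by (cases "u = t") auto
  qed
qed

lemma extinction_time_greater_iff:
  assumes \<omega>: "\<omega> \<in> space (P 1)" and w: "0 \<le> w"
  shows "ereal w < extinction_time Z \<omega> \<longleftrightarrow> Z w \<omega> \<noteq> 0 \<and> (\<forall>r\<in>\<rat> \<inter> {0..<w}. Z r \<omega> \<noteq> 0)"
proof
  assume gr: "ereal w < extinction_time Z \<omega>"
  have "Z v \<omega> \<noteq> 0" if "0 \<le> v" "v \<le> w" for v
  proof
    assume "Z v \<omega> = 0"
    then have "extinction_time Z \<omega> \<le> ereal v"
      unfolding extinction_time_def using that by (intro INF_lower) auto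
    then show False using gr that by (simp add: order_trans leD)
  qed
  then show "Z w \<omega> \<noteq> 0 \<and> (\<forall>r\<in>\<rat> \<inter> {0..<w}. Z r \<omega> \<noteq> 0)" using w by auto
next
  assume *: "Z w \<omega> \<noteq> 0 \<and> (\<forall>r\<in>\<rat> \<inter> {0..<w}. Z r \<omega> \<noteq> 0)"
  have nz: "Z v \<omega> \<noteq> 0" if v: "0 \<le> v" "v < w" for v
  proof
    assume "Z v \<omega> = 0"
    obtain d where d: "0 < d" "\<And>u. v \<le> u \<Longrightarrow> u < v + d \<Longrightarrow> Z u \<omega> = Z v \<omega>"
      using path_locally_constant[OF \<omega> v(1)] by blast
    obtain r where "r \<in> \<rat>" "v < r" "r < min w (v + d)"
      using Rats_dense_in_real[of v "min w (v + d)"] d v by auto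
    then have "Z r \<omega> = 0" "r \<in> \<rat> \<inter> {0..<w}" using d(2)[of r] v \<open>Z v \<omega> = 0\<close> by auto
    then show False using * by blast
  qed
  obtain d where d: "0 < d" "\<And>u. w \<le> u \<Longrightarrow> u < w + d \<Longrightarrow> Z u \<omega> = Z w \<omega>"
    using path_locally_constant[OF \<omega> w] by blast
  have "ereal (w + d) \<le> extinction_time Z \<omega>"
    unfolding extinction_time_def
  proof (rule INF_greatest)
    fix v assume "v \<in> {t. 0 \<le> t \<and> Z t \<omega> = 0}"
    then have v: "0 \<le> v" "Z v \<omega> = 0" by auto
    then have "\<not> v < w + d" using nz[of v] d(2)[of v] * by (cases "v < w") auto
    then show "ereal (w + d) \<le> ereal v" by simp
  qed
  moreover have "ereal w < ereal (w + d)" using d by simp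
  ultimately show "ereal w < extinction_time Z \<omega>" by (rule less_le_trans[rotated])
qed

lemma extinction_time_finite_iff:
  assumes \<omega>: "\<omega> \<in> space (P 1)"
  shows "extinction_time Z \<omega> < \<infinity> \<longleftrightarrow> (\<exists>r\<in>\<rat> \<inter> {0..}. Z r \<omega> = 0)"
proof -
  have "extinction_time Z \<omega> < \<infinity> \<longleftrightarrow> (\<exists>v\<ge>0. Z v \<omega> = 0)"
    unfolding extinction_time_def INF_less_iff by simp
  also have "\<dots> \<longleftrightarrow> (\<exists>r\<in>\<rat> \<inter> {0..}. Z r \<omega> = 0)"
  proof
    assume "\<exists>v\<ge>0. Z v \<omega> = 0"
    then obtain v where v: "0 \<le> v" "Z v \<omega> = 0" by auto
    obtain d where d: "0 < d" "\<And>u. v \<le> u \<Longrightarrow> u < v + d \<Longrightarrow> Z u \<omega> = Z v \<omega>"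
      using path_locally_constant[OF \<omega> v(1)] by blast
    obtain r where "r \<in> \<rat>" "v < r" "r < v + d"
      using Rats_dense_in_real[of v "v + d"] d by auto
    then show "\<exists>r\<in>\<rat> \<inter> {0..}. Z r \<omega> = 0" using d(2)[of r] v by (intro bexI[of _ r]) auto
  qed auto
  finally show ?thesis .
qed

lemma pred_extinction:
  assumes w: "0 \<le> w"
  shows "Measurable.pred (P 1) (\<lambda>\<omega>. ereal w < extinction_time Z \<omega> \<and> extinction_time Z \<omega> < \<infinity>)"
proof -
  have 1: "1 \<in> insert 0 S" using one_in_S by simp
  \<comment> \<open>Clipping at 0 makes every index admissible, so that quantification over all
    rationals is measurable; on the times that occur it changes nothing.\<close>
  have [measurable]: "Z (max 0 r) \<in> measurable (P 1) (count_space UNIV)" for r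
    by (rule measurable_Z[OF 1]) simp
  have all: "(\<forall>r\<in>\<rat> \<inter> A. Q r) \<longleftrightarrow> (\<forall>r. real_of_rat r \<in> A \<longrightarrow> Q (real_of_rat r))"
    and ex: "(\<exists>r\<in>\<rat> \<inter> A. Q r) \<longleftrightarrow> (\<exists>r. real_of_rat r \<in> A \<and> Q (real_of_rat r))" for Q A
    by (auto simp: Rats_def)
  have "Measurable.pred (P 1) (\<lambda>\<omega>. (Z (max 0 w) \<omega> \<noteq> 0 \<and> (\<forall>r\<in>\<rat> \<inter> {0..<w}. Z (max 0 r) \<omega> \<noteq> 0))
      \<and> (\<exists>r\<in>\<rat> \<inter> {0..}. Z (max 0 r) \<omega> = 0))"
    unfolding all ex by measurable
  also have "?this \<longleftrightarrow> ?thesis"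
  proof (rule measurable_cong)
    fix \<omega> assume \<omega>: "\<omega> \<in> space (P 1)"
    show "((Z (max 0 w) \<omega> \<noteq> 0 \<and> (\<forall>r\<in>\<rat> \<inter> {0..<w}. Z (max 0 r) \<omega> \<noteq> 0))
        \<and> (\<exists>r\<in>\<rat> \<inter> {0..}. Z (max 0 r) \<omega> = 0))
      = (ereal w < extinction_time Z \<omega> \<and> extinction_time Z \<omega> < \<infinity>)"
      unfolding extinction_time_greater_iff[OF \<omega> w] extinction_time_finite_iff[OF \<omega>]
      using w by (intro arg_cong2[where f = "(\<and>)"] ball_cong bex_cong) (auto simp: max_absorb2)
  qed
  finally show ?thesis .
qed

lemma AE_zero_absorbing:
  assumes r: "0 \<le> r" "r \<le> w"
  shows "AE \<omega> in P 1. Z r \<omega> = 0 \<longrightarrow> Z w \<omega> = 0"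
proof -
  have 1: "1 \<in> insert 0 S" using one_in_S by simp
  interpret prob_space "P 1" using 1 by (rule prob_space_P)
  have w: "0 \<le> w" using r by simp
  note [measurable] = measurable_Z[OF 1 r(1)] measurable_Z[OF 1 w]
  have "AE \<omega> in P 1. \<not> (Z r \<omega> = 0 \<and> Z w \<omega> = Suc j)" for j
  proof -
    have "\<P>(\<omega> in P 1. Z r \<omega> = 0 \<and> Z w \<omega> = Suc j) = 0"
      using trans_prob_joint[OF 1 r(1), of "w - r" 0 "Suc j"] r by (simp add: trans_prob_zero)
    then show ?thesis by (subst (asm) prob_eq_0) auto
  qed
  then have "AE \<omega> in P 1. \<forall>j. \<not> (Z r \<omega> = 0 \<and> Z w \<omega> = Suc j)"
    by (intro AE_all_countable[THEN iffD2] allI)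
  then show ?thesis
    by eventually_elim (metis not0_implies_Suc)
qed

lemma AE_extinct:
  assumes q: "(survival_prob P Z \<longlongrightarrow> 0) at_top"
  shows "AE \<omega> in P 1. extinction_time Z \<omega> < \<infinity>"
proof -
  have 1: "1 \<in> insert 0 S" using one_in_S by simp
  interpret prob_space "P 1" using 1 by (rule prob_space_P)
  have [measurable]: "Z (real n) \<in> measurable (P 1) (count_space UNIV)" for n
    by (rule measurable_Z[OF 1]) simp
  have le: "\<P>(\<omega> in P 1. \<forall>n. Z (real n) \<omega> \<noteq> 0) \<le> survival_prob P Z (real m)" for m
    unfolding survival_prob_def by (rule finite_measure_mono) auto
  have "(\<lambda>m. survival_prob P Z (real m)) \<longlonglongrightarrow> 0"
    by (rule filterlim_compose[OF q filterlim_real_sequentially])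
  then have "\<P>(\<omega> in P 1. \<forall>n. Z (real n) \<omega> \<noteq> 0) \<le> 0"
    by (rule LIMSEQ_le_const) (use le in auto)
  then have "\<P>(\<omega> in P 1. \<forall>n. Z (real n) \<omega> \<noteq> 0) = 0" by (simp add: measure_le_0_iff)
  then have "AE \<omega> in P 1. \<not> (\<forall>n. Z (real n) \<omega> \<noteq> 0)" by (subst (asm) prob_eq_0) auto
  then show ?thesis
    using AE_space
  proof eventually_elim
    case (elim \<omega>)
    then obtain n where "Z (real n) \<omega> = 0" by auto
    then show ?case
      using extinction_time_finite_iff[of \<omega>] elim(2) by (auto intro!: bexI[of _ "real n"])
  qed
qed

text \<open>Absorption at 0 is not a property of every path; it holds almost surely between any two
  fixed times, and the rational times before w are countably many. This replaces the conditioning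
  event by one about a single time.\<close>

lemma AE_survival_iff:
  assumes q: "(survival_prob P Z \<longlongrightarrow> 0) at_top" and w: "0 \<le> w"
  shows "AE \<omega> in P 1. (ereal w < extinction_time Z \<omega> \<and> extinction_time Z \<omega> < \<infinity>) \<longleftrightarrow> Z w \<omega> \<noteq> 0"
proof -
  have "AE \<omega> in P 1. \<forall>r\<in>\<rat> \<inter> {0..<w}. Z r \<omega> = 0 \<longrightarrow> Z w \<omega> = 0"
    using AE_zero_absorbing by (subst AE_ball_countable) (auto intro: countable_Int1 countable_rat)
  then show ?thesis
    using AE_extinct[OF q] AE_space
  proof eventually_elim
    case (elim \<omega>)
    then show ?case using extinction_time_greater_iff[OF elim(3) w] by auto
  qed
qed

text \<open>Given Z t = j, the j independent lines all die within u with probability p_10(u)^j, and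
  1 - p_10(u)^j = q(u) (1 + p_10(u) + ... + p_10(u)^(j-1)). After division by q(t + u) the geometric
  sum tends to j and q(t + u) / q(u) tends to 1.\<close>

lemma Q_trans_prob_one:
  assumes t: "0 \<le> t"
    and q: "(survival_prob P Z \<longlongrightarrow> 0) at_top"
    and pos: "\<And>u. 0 \<le> u \<Longrightarrow> 0 < survival_prob P Z u"
    and ratio: "((\<lambda>u. survival_prob P Z (t + u) / survival_prob P Z u) \<longlongrightarrow> 1) at_top"
  shows "Q_trans_prob P Z t 1 j = real j * trans_prob P Z t 1 j"
proof -
  have 1: "1 \<in> insert 0 S" using one_in_S by simp
  interpret prob_space "P 1" using 1 by (rule prob_space_P)
  let ?q = "survival_prob P Z" and ?p = "trans_prob P Z"
  have cond: "\<P>(\<omega> in P 1. Z t \<omega> = j \<bar> ereal (t + u) < extinction_time Z \<omega> \<and> extinction_time Z \<omega> < \<infinity>)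
      = ?p t 1 j * (\<Sum>i<j. ?p u 1 0 ^ i) / (?q (t + u) / ?q u)" if u: "0 \<le> u" for u
  proof -
    have w: "0 \<le> t + u" using t u by simp
    note [measurable] = measurable_Z[OF 1 t] measurable_Z[OF 1 w] pred_extinction[OF w]
    note AE = AE_survival_iff[OF q w]
    have A: "\<P>(\<omega> in P 1. ereal (t + u) < extinction_time Z \<omega> \<and> extinction_time Z \<omega> < \<infinity>) = ?q (t + u)"
    proof -
      have "\<P>(\<omega> in P 1. ereal (t + u) < extinction_time Z \<omega> \<and> extinction_time Z \<omega> < \<infinity>)
          = \<P>(\<omega> in P 1. Z (t + u) \<omega> > 0)"
      proof (rule prob_eq_AE)
        show "AE \<omega> in P 1. (ereal (t + u) < extinction_time Z \<omega> \<and> extinction_time Z \<omega> < \<infinity>) = (Z (t + u) \<omega> > 0)"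
          using AE by eventually_elim (simp only: neq0_conv)
      qed measurable
      then show ?thesis by (simp add: survival_prob_def)
    qed
    have B: "\<P>(\<omega> in P 1. Z t \<omega> = j \<and> ereal (t + u) < extinction_time Z \<omega> \<and> extinction_time Z \<omega> < \<infinity>)
        = \<P>(\<omega> in P 1. Z t \<omega> = j \<and> Z (t + u) \<omega> \<noteq> 0)"
    proof (rule prob_eq_AE)
      show "AE \<omega> in P 1. (Z t \<omega> = j \<and> ereal (t + u) < extinction_time Z \<omega> \<and> extinction_time Z \<omega> < \<infinity>)
          = (Z t \<omega> = j \<and> Z (t + u) \<omega> \<noteq> 0)"
        using AE by eventually_elim (simp only:)
    qed measurable
    have C: "?p t 1 j = \<P>(\<omega> in P 1. Z t \<omega> = j \<and> Z (t + u) \<omega> \<noteq> 0) + \<P>(\<omega> in P 1. Z t \<omega> = j \<and> Z (t + u) \<omega> = 0)"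
      unfolding trans_prob_def
      by (subst finite_measure_Union[symmetric]) (auto intro!: arg_cong[where f = prob])
    have D: "\<P>(\<omega> in P 1. Z t \<omega> = j \<and> Z (t + u) \<omega> \<noteq> 0) = ?p t 1 j * (1 - ?p u 1 0 ^ j)"
    proof (cases "j \<in> insert 0 S")
      case True
      then show ?thesis
        using C trans_prob_joint[OF 1 t u, of j 0] trans_prob_to_zero[OF True u] by (simp add: algebra_simps)
    next
      case False
      then show ?thesis
        using C trans_prob_joint[OF 1 t u, of j 0] trans_prob_outside[OF 1 t False] by simp
    qed
    have "1 - ?p u 1 0 ^ j = ?q u * (\<Sum>i<j. ?p u 1 0 ^ i)"
      unfolding survival_prob_eq(1)[OF u] by (rule one_diff_power_eq)
    then show ?thesis
      unfolding cond_prob_def A B D by (simp only: divide_divide_eq_right ac_simps)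
  qed
  have p0: "((\<lambda>u. ?p u 1 0) \<longlongrightarrow> 1) at_top"
  proof -
    have "((\<lambda>u. 1 - ?q u) \<longlongrightarrow> 1 - 0) at_top" by (intro tendsto_intros q)
    moreover have "\<forall>\<^sub>F u in at_top. 1 - ?q u = ?p u 1 0"
      using eventually_ge_at_top[of 0] by eventually_elim (simp add: survival_prob_eq(1))
    ultimately show ?thesis by (simp add: filterlim_cong)
  qed
  have "((\<lambda>u. ?p t 1 j * (\<Sum>i<j. ?p u 1 0 ^ i) / (?q (t + u) / ?q u)) \<longlongrightarrow> ?p t 1 j * (\<Sum>i<j. 1 ^ i) / 1) at_top"
    by (intro tendsto_intros p0 ratio) auto
  moreover have "\<forall>\<^sub>F u in at_top. ?p t 1 j * (\<Sum>i<j. ?p u 1 0 ^ i) / (?q (t + u) / ?q u)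
      = \<P>(\<omega> in P 1. Z t \<omega> = j \<bar> ereal (t + u) < extinction_time Z \<omega> \<and> extinction_time Z \<omega> < \<infinity>)"
    using eventually_ge_at_top[of 0] by eventually_elim (simp only: cond)
  ultimately have "((\<lambda>u. \<P>(\<omega> in P 1. Z t \<omega> = j \<bar> ereal (t + u) < extinction_time Z \<omega> \<and> extinction_time Z \<omega> < \<infinity>))
      \<longlongrightarrow> ?p t 1 j * (\<Sum>i<j. 1 ^ i) / 1) at_top"
    by (rule Lim_transform_eventually)
  then show ?thesis
    unfolding Q_trans_prob_def by (subst tendsto_Lim) (auto simp: mult.commute)
qed

end

end

lemma (in markov_Q_process) prob_W_eq:
  assumes t: "0 \<le> t" and W0: "AE \<omega> in N. W 0 \<omega> = 1"
  shows "\<P>(\<omega> in N. W t \<omega> = j) = Q_trans_prob P Z t 1 j"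
proof -
  note [measurable] = measurable_X
  define \<tau> where "\<tau> k = (if k = 0 then 0 else t)" for k :: nat
  define x where "x k = (if k = 0 then 1 else j)" for k :: nat
  have one: "\<P>(\<omega> in N. W 0 \<omega> = 1) = 1"
    using prob_eq_1[of "{\<omega> \<in> space N. W 0 \<omega> = 1}"] W0 by auto
  have "\<P>(\<omega> in N. W (\<tau> (Suc 0)) \<omega> = x (Suc 0) \<bar> \<forall>k\<le>0. W (\<tau> k) \<omega> = x k)
      = Q_trans_prob P Z (\<tau> (Suc 0) - \<tau> 0) (x 0) (x (Suc 0))"
    by (rule markov) (use one t in \<open>auto simp: \<tau>_def x_def\<close>)
  then have "\<P>(\<omega> in N. W t \<omega> = j \<and> W 0 \<omega> = 1) = Q_trans_prob P Z t 1 j"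
    using one by (simp add: cond_prob_def \<tau>_def x_def)
  moreover have "\<P>(\<omega> in N. W t \<omega> = j \<and> W 0 \<omega> = 1) = \<P>(\<omega> in N. W t \<omega> = j)"
    by (rule prob_eq_AE) (use W0 t in auto)
  ultimately show ?thesis by simp
qed

section \<open>The implicit equation for the generating function\<close>

lemma (in prob_space) sums_expectation_nat:
  fixes X :: "'a \<Rightarrow> nat" and g :: "nat \<Rightarrow> complex"
  assumes [measurable]: "X \<in> measurable M (count_space UNIV)" and g: "\<And>n. norm (g n) \<le> B"
  shows "(\<lambda>j. of_real \<P>(\<omega> in M. X \<omega> = j) * g j) sums (CLINT \<omega>|M. g (X \<omega>))"
proof -
  let ?s = "\<lambda>n \<omega>. \<Sum>j<n. indicator {\<omega> \<in> space M. X \<omega> = j} \<omega> *\<^sub>R g j"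
  have s: "?s n \<omega> = (if X \<omega> < n then g (X \<omega>) else 0)" if "\<omega> \<in> space M" for n \<omega>
  proof -
    have "?s n \<omega> = (\<Sum>j<n. if j = X \<omega> then g j else 0)"
      using that by (intro sum.cong) (auto simp: indicator_def)
    then show ?thesis by simp
  qed
  have B: "0 \<le> B" using order_trans[OF norm_ge_zero g] by blast
  have "(\<lambda>n. CLINT \<omega>|M. ?s n \<omega>) \<longlonglongrightarrow> (CLINT \<omega>|M. g (X \<omega>))"
  proof (rule integral_dominated_convergence[where w = "\<lambda>_. B"])
    show "AE \<omega> in M. (\<lambda>n. ?s n \<omega>) \<longlonglongrightarrow> g (X \<omega>)"
    proof (rule AE_I2)
      fix \<omega> assume \<omega>: "\<omega> \<in> space M"
      have "\<forall>\<^sub>F n in sequentially. g (X \<omega>) = ?s n \<omega>"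
        using eventually_gt_at_top[of "X \<omega>"] by eventually_elim (simp only: s[OF \<omega>] if_True)
      then show "(\<lambda>n. ?s n \<omega>) \<longlonglongrightarrow> g (X \<omega>)"
        by (rule Lim_transform_eventually[OF tendsto_const])
    qed
    show "AE \<omega> in M. norm (?s n \<omega>) \<le> B" for n
    proof (rule AE_I2)
      fix \<omega> assume \<omega>: "\<omega> \<in> space M"
      show "norm (?s n \<omega>) \<le> B" unfolding s[OF \<omega>] using g[of "X \<omega>"] B by simp
    qed
  qed auto
  moreover have "(CLINT \<omega>|M. ?s n \<omega>) = (\<Sum>j<n. of_real \<P>(\<omega> in M. X \<omega> = j) * g j)" for n
  proof -
    have int: "integrable M (indicat_real {\<omega> \<in> space M. X \<omega> = j})" for j
      by (intro integrable_real_indicator) (auto simp: less_top[symmetric])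
    have "(CLINT \<omega>|M. ?s n \<omega>) = (\<Sum>j<n. CLINT \<omega>|M. indicator {\<omega> \<in> space M. X \<omega> = j} \<omega> *\<^sub>R g j)"
      by (rule Bochner_Integration.integral_sum) (intro integrable_scaleR_left int)
    also have "\<dots> = (\<Sum>j<n. (LINT \<omega>|M. indicator {\<omega> \<in> space M. X \<omega> = j} \<omega>) *\<^sub>R g j)"
      by (intro sum.cong refl integral_scaleR_left int)
    finally show ?thesis by (simp add: scaleR_conv_of_real)
  qed
  ultimately show ?thesis by (simp add: sums_def)
qed

context markov_branching_process
begin

section \<open>The generating function in the complex unit disc\<close>

lemma norm_pgf_less_one:
  fixes z :: complex
  assumes t: "0 \<le> t" and z: "norm z < 1"
  shows "norm (transition_pgf P Z t z) < 1"
proof -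
  have s: "(\<lambda>j. trans_prob P Z t 1 j * norm z ^ j) sums transition_pgf P Z t (norm z)"
    by (rule pgf_sums_real) (use t z in auto)
  have "norm (transition_pgf P Z t z) \<le> (\<Sum>j. trans_prob P Z t 1 j * norm z ^ j)"
    unfolding transition_pgf_def
  proof (rule norm_suminf_le)
    show "norm (of_real (trans_prob P Z t 1 n) * z ^ n) \<le> trans_prob P Z t 1 n * norm z ^ n" for n
      by (simp add: norm_mult norm_power trans_prob_nonneg)
    show "summable (\<lambda>j. trans_prob P Z t 1 j * norm z ^ j)" using s by (rule sums_summable)
  qed
  also have "\<dots> = transition_pgf P Z t (norm z)" using s by (simp add: sums_iff)
  also have "\<dots> < 1" using pgf_less_one[OF t, of "norm z"] z by simp
  finally show ?thesis .
qed

lemma pgf_of_real: "transition_pgf P Z t (of_real x :: complex) = of_real (transition_pgf P Z t x)"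
  if "0 \<le> t" "\<bar>x\<bar> \<le> 1"
proof -
  have "(\<lambda>j. of_real (trans_prob P Z t 1 j * x ^ j)) sums complex_of_real (transition_pgf P Z t x)"
    by (intro sums_of_real pgf_sums_real) (use that in auto)
  moreover have "(\<lambda>j. of_real (trans_prob P Z t 1 j) * of_real x ^ j) sums transition_pgf P Z t (of_real x :: complex)"
    by (rule pgf_sums) (use that in auto)
  ultimately show ?thesis by (simp add: sums_iff)
qed

text \<open>The weights j p_1j(t) of the Q-process turn the generating function F into z F'(z); the
  series for z F' is recorded for that purpose.\<close>

lemma pgf_has_field_derivative:
  fixes z :: complex
  assumes t: "0 \<le> t" and z: "norm z < 1"
  obtains D where "(transition_pgf P Z t has_field_derivative D) (at z)"
    "(\<lambda>j. of_real (real j * trans_prob P Z t 1 j) * z ^ j) sums (z * D)"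
proof
  let ?F = "Abs_fps (\<lambda>j. complex_of_real (trans_prob P Z t 1 j))"
  have "conv_radius (\<lambda>j. complex_of_real (trans_prob P Z t 1 j)) \<ge> 1"
  proof (rule conv_radius_geI_ex')
    fix r :: real assume "0 < r" "ereal r < 1"
    then show "summable (\<lambda>j. complex_of_real (trans_prob P Z t 1 j) * of_real r ^ j)"
      using pgf_sums[OF t, of "of_real r :: complex"] by (auto simp: sums_iff)
  qed
  then have r: "norm z < fps_conv_radius ?F"
    using z by (simp add: fps_conv_radius_def) (metis ereal_less(3) less_le_trans)
  have "transition_pgf P Z t = eval_fps ?F" by (auto simp: transition_pgf_def eval_fps_def)
  then show "(transition_pgf P Z t has_field_derivative eval_fps (fps_deriv ?F) z) (at z)"
    using has_field_derivative_eval_fps[OF r] by simp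
  have "(\<lambda>n. fps_nth (fps_deriv ?F) n * z ^ n) sums eval_fps (fps_deriv ?F) z"
    by (rule sums_eval_fps) (use r fps_conv_radius_deriv[of ?F] in auto)
  from sums_mult[OF this, of z]
  have "(\<lambda>n. of_real (real (Suc n) * trans_prob P Z t 1 (Suc n)) * z ^ Suc n) sums (z * eval_fps (fps_deriv ?F) z)"
    by (simp add: mult_ac)
  then show "(\<lambda>j. of_real (real j * trans_prob P Z t 1 j) * z ^ j) sums (z * eval_fps (fps_deriv ?F) z)"
    by (subst (asm) sums_Suc_iff) simp
qed

lemma pgf_holomorphic: "0 \<le> t \<Longrightarrow> transition_pgf P Z t holomorphic_on ball (0::complex) 1"
  using pgf_has_field_derivative
  by (metis (no_types, lifting) dist_0_norm field_differentiable_at_within field_differentiable_def holomorphic_onI mem_ball)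

end

text \<open>For real v in (0,1], with f in the explicit form, the derivative equals - \<nu>^2 C /
  f(1 - v), so the function is up to a constant factor the antiderivative used to integrate the
  backward equation. Powers are spelled out with the principal logarithm.\<close>

lemma has_field_derivative_power_log:
  assumes "0 < Re v"
  shows "((\<lambda>v. exp (- of_real \<nu> * Ln v) + of_real (C * \<nu>) * Ln v) has_field_derivative
    - of_real \<nu> * (exp (- of_real (1 + \<nu>) * Ln v) * (1 - of_real C * exp (of_real \<nu> * Ln v)))) (at v)"
proof -
  have v0: "v \<noteq> 0" "v \<notin> \<real>\<^sub>\<le>\<^sub>0" using assms by (auto simp: complex_nonpos_Reals_iff)
  have "((\<lambda>v. exp (- of_real \<nu> * Ln v) + of_real (C * \<nu>) * Ln v) has_field_derivative
      exp (- of_real \<nu> * Ln v) * (- of_real \<nu> * inverse v) + of_real (C * \<nu>) * inverse v) (at v)"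
    by (rule derivative_eq_intros refl v0 | simp add: v0)+
  also have "inverse v = exp (- Ln v)" using v0 by (simp add: exp_minus)
  also have "exp (- of_real \<nu> * Ln v) * (- of_real \<nu> * exp (- Ln v)) + of_real (C * \<nu>) * exp (- Ln v)
      = - of_real \<nu> * (exp (- of_real (1 + \<nu>) * Ln v) * (1 - of_real C * exp (of_real \<nu> * Ln v)))"
  proof -
    have e: "- of_real (1 + \<nu>) * Ln v = - of_real \<nu> * Ln v + - Ln v" by (simp add: algebra_simps)
    show ?thesis unfolding e exp_add by (simp add: exp_minus field_simps)
  qed
  finally show ?thesis .
qed

text \<open>What remains of the hypotheses on f once the differential equation for \<Lambda> is
  solved: the two parameters \<nu> and C.\<close>

locale explicit_branching_process = markov_branching_process P Z S a
  for P :: "nat \<Rightarrow> 'a measure" and Z S a +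
  fixes \<nu> C :: real
  assumes \<nu>: "0 < \<nu>" "\<nu> < 1" and C: "0 < C" "C < 1"
    and gf: "\<And>x. 0 \<le> x \<Longrightarrow> x < 1 \<Longrightarrow>
      infinitesimal_gf S a x = \<nu> * C * (1 - x) powr (1 + \<nu>) / (1 - C * (1 - x) powr \<nu>)"
begin

lemma denominator_pos: "0 \<le> x \<Longrightarrow> x < 1 \<Longrightarrow> 0 < 1 - C * (1 - x) powr \<nu>"
proof -
  assume "0 \<le> x" "x < 1"
  then have "(1 - x) powr \<nu> \<le> 1" using \<nu> by (intro powr_le1) auto
  then have "C * (1 - x) powr \<nu> \<le> C * 1" using C by (intro mult_left_mono) auto
  then show ?thesis using C by linarith
qed

lemma gf_continuous: "continuous_on {0..<1} (infinitesimal_gf S a)"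
proof -
  have "continuous_on {0..<1} (\<lambda>x. \<nu> * C * (1 - x) powr (1 + \<nu>) / (1 - C * (1 - x) powr \<nu>))"
    by (intro continuous_intros) (use denominator_pos in \<open>force+\<close>)
  also have "?this \<longleftrightarrow> ?thesis"
    by (rule continuous_on_cong) (auto simp: gf)
  finally show ?thesis .
qed

text \<open>H is an antiderivative of \<nu>^2 C / f on [0,1), so H(F(t; x)) grows linearly in t with
  slope \<nu>^2 C.\<close>

lemma pgf_implicit_equation:
  assumes t: "0 \<le> t" and x: "0 \<le> x" "x < 1"
  shows "(1 - transition_pgf P Z t x) powr - \<nu> + C * \<nu> * ln (1 - transition_pgf P Z t x)
    = (1 - x) powr - \<nu> + C * \<nu> * ln (1 - x) + \<nu>\<^sup>2 * C * t"
proof -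
  define H where "H v = (1 - v) powr - \<nu> + C * \<nu> * ln (1 - v)" for v :: real
  define G where "G t = H (transition_pgf P Z t x) - \<nu>\<^sup>2 * C * t" for t
  have G: "(G has_real_derivative 0) (at t within {0..})" if t: "t \<in> {0..}" for t
  proof -
    let ?v = "transition_pgf P Z t x"
    have t: "0 \<le> t" using t by simp
    have v: "0 \<le> ?v" "?v < 1"
      using pgf_bounds(1)[OF t, of x] pgf_less_one[OF t x] x by auto
    have H: "(H has_real_derivative \<nu> * (1 - ?v) powr (- \<nu> - 1) - C * \<nu> / (1 - ?v)) (at ?v)"
      unfolding H_def using v by (auto intro!: derivative_eq_intros simp: field_simps)
    have "((\<lambda>t. H (transition_pgf P Z t x)) has_real_derivative
        (\<nu> * (1 - ?v) powr (- \<nu> - 1) - C * \<nu> / (1 - ?v)) * infinitesimal_gf S a ?v) (at t within {0..})"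
      by (rule DERIV_chain'[OF pgf_has_derivative[OF t x gf_continuous] H])
    also have "(\<nu> * (1 - ?v) powr (- \<nu> - 1) - C * \<nu> / (1 - ?v)) * infinitesimal_gf S a ?v = \<nu>\<^sup>2 * C"
    proof -
      define r where "r = 1 - ?v"
      define p where "p = r powr \<nu>"
      have r: "0 < r" using v by (simp add: r_def)
      have p: "0 < p" using r by (simp add: p_def)
      have d: "0 < 1 - C * p" using denominator_pos[OF v] by (simp add: p_def r_def)
      have 1: "r powr (- \<nu> - 1) = 1 / (p * r)"
        using r by (simp add: p_def powr_diff powr_minus_divide)
      have 2: "r powr (1 + \<nu>) = r * p" using r by (simp add: p_def powr_add)
      have "(\<nu> * (1 / (p * r)) - C * \<nu> / r) * (\<nu> * C * (r * p) / (1 - C * p)) = \<nu>\<^sup>2 * C"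
      proof -
        have "\<nu> * (1 / (p * r)) - C * \<nu> / r = \<nu> * (1 - C * p) / (p * r)"
          using p r by (simp add: field_simps)
        then show ?thesis using p r d by (simp add: power2_eq_square)
      qed
      then show ?thesis
        unfolding gf[OF v] unfolding r_def[symmetric] p_def[symmetric] 1 2 .
    qed
    finally show ?thesis
      unfolding G_def by (auto intro!: derivative_eq_intros)
  qed
  have "\<exists>c. \<forall>t\<in>{0..}. G t = c"
    by (rule has_field_derivative_zero_constant[OF _ G]) auto
  then have "G t = G 0" using t by auto
  moreover have "transition_pgf P Z 0 x = x"
    using pgf_bounds(3)[of 0 x] x trans_prob_time_zero by simp
  ultimately show ?thesis by (simp add: G_def H_def)
qed

text \<open>Both 1 - z and 1 - F(t; z) have positive real part, so the principal branches are
  holomorphic on the whole disc; the real interval (0,1), where the equation is known, accumulates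
  at 1/2.\<close>

lemma pgf_implicit_equation_complex:
  fixes z :: complex
  assumes t: "0 \<le> t" and z: "norm z < 1"
  shows "exp (- of_real \<nu> * Ln (1 - transition_pgf P Z t z)) + of_real (C * \<nu>) * Ln (1 - transition_pgf P Z t z)
    = exp (- of_real \<nu> * Ln (1 - z)) + of_real (C * \<nu>) * Ln (1 - z) + of_real (\<nu>\<^sup>2 * C * t)"
proof -
  let ?\<Phi> = "\<lambda>v. exp (- of_real \<nu> * Ln v) + of_real (C * \<nu>) * Ln v"
  let ?F = "transition_pgf P Z t"
  have re: "0 < Re (1 - v)" if "norm v < 1" for v :: complex
    using complex_Re_le_cmod[of v] that by simp
  have nonpos: "1 - v \<notin> \<real>\<^sub>\<le>\<^sub>0" if "norm v < 1" for v :: complex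
    using re[OF that] by (auto simp: complex_nonpos_Reals_iff)
  let ?h = "\<lambda>z. ?\<Phi> (1 - ?F z) - ?\<Phi> (1 - z) - of_real (\<nu>\<^sup>2 * C * t)"
  have "?h z = 0"
  proof (rule analytic_continuation[of ?h "ball 0 1" "complex_of_real ` {0<..<1}" "of_real (1 / 2)"])
    show "?h holomorphic_on ball 0 1"
      by (intro holomorphic_intros pgf_holomorphic[OF t]) (use nonpos norm_pgf_less_one[OF t] in auto)
    have "(1 / 2 :: real) islimpt {0<..<1}" by (rule interior_limit_point) simp
    then show "complex_of_real (1 / 2) islimpt complex_of_real ` {0<..<1}"
    proof (rule islimpt_isCont_image)
      show "\<forall>\<^sub>F x in at (1 / 2). complex_of_real x \<noteq> complex_of_real (1 / 2)"
        unfolding of_real_eq_iff by (rule eventually_neq_at_within)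
    qed simp
    fix w assume "w \<in> complex_of_real ` {0<..<1}"
    then obtain x where x: "0 < x" "x < 1" "w = of_real x" by auto
    have F: "?F w = of_real (transition_pgf P Z t x)" using pgf_of_real[OF t, of x] x by simp
    have lt: "transition_pgf P Z t x < 1" using pgf_less_one[OF t, of x] x by simp
    have \<Phi>: "?\<Phi> (of_real v) = of_real (v powr - \<nu> + C * \<nu> * ln v)" if "0 < v" for v :: real
      using that by (simp add: Ln_of_real powr_def exp_of_real[symmetric])
    have "1 - ?F w = of_real (1 - transition_pgf P Z t x)" "1 - w = of_real (1 - x)"
      using F x by simp_all
    then have "?h w = of_real ((1 - transition_pgf P Z t x) powr - \<nu> + C * \<nu> * ln (1 - transition_pgf P Z t x)
        - ((1 - x) powr - \<nu> + C * \<nu> * ln (1 - x)) - \<nu>\<^sup>2 * C * t)"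
      using \<Phi>[of "1 - transition_pgf P Z t x"] \<Phi>[of "1 - x"] lt x by (simp only: of_real_diff)
    also have "\<dots> = 0" using pgf_implicit_equation[OF t, of x] x by simp
    finally show "?h w = 0" .
  qed (use z in auto)
  then show ?thesis by (simp add: algebra_simps)
qed

text \<open>Differentiating the implicit equation in z; for real arguments it says F' = f(F) / f. It
  is stated without division, because 1 - C A^\<nu> is shown to be nonzero only later, in the range
  of the perturbation estimate.\<close>

lemma pgf_derivative_equation:
  fixes z :: complex
  assumes t: "0 \<le> t" and z: "norm z < 1" and D: "(transition_pgf P Z t has_field_derivative D) (at z)"
  defines "A \<equiv> 1 - transition_pgf P Z t z" and "B \<equiv> 1 - z"
  shows "D * (exp (- of_real (1 + \<nu>) * Ln A) * (1 - of_real C * exp (of_real \<nu> * Ln A)))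
    = exp (- of_real (1 + \<nu>) * Ln B) * (1 - of_real C * exp (of_real \<nu> * Ln B))"
proof -
  let ?\<Phi> = "\<lambda>v. exp (- of_real \<nu> * Ln v) + of_real (C * \<nu>) * Ln v"
  let ?d = "\<lambda>v. exp (- of_real (1 + \<nu>) * Ln v) * (1 - of_real C * exp (of_real \<nu> * Ln v))"
  let ?F = "transition_pgf P Z t"
  have re: "0 < Re (1 - v)" if "norm v < 1" for v :: complex
    using complex_Re_le_cmod[of v] that by simp
  have d1: "((\<lambda>z. ?\<Phi> (1 - ?F z)) has_field_derivative (- of_real \<nu> * ?d A) * (- D)) (at z)"
    unfolding A_def
    by (rule DERIV_chain'[OF _ has_field_derivative_power_log])
      (use D re[OF norm_pgf_less_one[OF t z]] in \<open>auto intro!: derivative_eq_intros\<close>)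
  have d2: "((\<lambda>z. ?\<Phi> (1 - z) + of_real (\<nu>\<^sup>2 * C * t)) has_field_derivative (- of_real \<nu> * ?d B) * (- 1) + 0) (at z)"
    unfolding B_def
    by (rule DERIV_add[OF DERIV_chain'[OF _ has_field_derivative_power_log] DERIV_const])
      (use re[OF z] in \<open>auto intro!: derivative_eq_intros\<close>)
  have "((\<lambda>z. ?\<Phi> (1 - z) + of_real (\<nu>\<^sup>2 * C * t)) has_field_derivative (- of_real \<nu> * ?d A) * (- D)) (at z)"
  proof (rule has_field_derivative_transform_within_open[OF d1, of "ball 0 1"])
    fix w :: complex assume "w \<in> ball 0 1"
    then show "?\<Phi> (1 - ?F w) = ?\<Phi> (1 - w) + of_real (\<nu>\<^sup>2 * C * t)"
      using pgf_implicit_equation_complex[OF t, of w] by simp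
  qed (use z in auto)
  from DERIV_unique[OF this d2] have "of_real \<nu> * (?d A * D) = of_real \<nu> * ?d B"
    by (simp add: mult_ac)
  then show ?thesis using \<nu> by (simp add: mult.commute)
qed

end

section \<open>Perturbation of the limiting Laplace transform\<close>

lemma Re_exp_pos: "\<bar>Im z\<bar> < pi / 2 \<Longrightarrow> 0 < Re (exp z)"
  by (auto simp: Re_exp intro!: mult_pos_pos cos_gt_zero_pi)

text \<open>Both arguments lie strictly between - pi / 2 and pi / 2, so their difference cannot
  leave the principal strip.\<close>

lemma Ln_quotient_Re_pos:
  assumes "0 < Re z" "0 < Re w"
  shows "Ln (z / w) = Ln z - Ln w"
proof (rule Ln_unique)
  have [simp]: "z \<noteq> 0" "w \<noteq> 0" using assms by auto
  show "exp (Ln z - Ln w) = z / w" by (simp add: exp_diff)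
  show "- pi < Im (Ln z - Ln w)" "Im (Ln z - Ln w) \<le> pi"
    using Re_Ln_pos_lt_imp[OF assms(1)] Re_Ln_pos_lt_imp[OF assms(2)] by (auto simp: abs_less_iff)
qed

lemma norm_exp_minus_one_le:
  fixes z :: complex
  assumes "norm z \<le> 1 / 2"
  shows "norm (exp z - 1) \<le> 2 * norm z" and "norm (exp z - 1 - z) \<le> 2 * (norm z)\<^sup>2"
proof -
  have "exp \<bar>Re z\<bar> \<le> exp (1 / 2)" using abs_Re_le_cmod[of z] assms by simp
  also have "\<dots> \<le> (2 :: real)" by (rule exp_half_le2)
  finally have e: "exp \<bar>Re z\<bar> \<le> 2" .
  show "norm (exp z - 1) \<le> 2 * norm z"
    using Taylor_exp[of z 0] mult_right_mono[OF e, of "norm z"] by simp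
  show "norm (exp z - 1 - z) \<le> 2 * (norm z)\<^sup>2"
    using Taylor_exp[of z 1] mult_right_mono[OF e, of "(norm z)\<^sup>2"]
    by (simp add: diff_diff_eq power2_eq_square)
qed

lemma norm_one_plus_Re_pos:
  assumes "0 < Re z"
  shows "1 \<le> norm (1 + z)" and "norm z \<le> norm (1 + z)"
proof -
  show "1 \<le> norm (1 + z)" using complex_Re_le_cmod[of "1 + z"] assms by simp
  have "(norm z)\<^sup>2 \<le> (norm (1 + z))\<^sup>2"
    using assms by (simp add: cmod_power2 power2_sum)
  then show "norm z \<le> norm (1 + z)" by (rule power2_le_imp_le) simp
qed

text \<open>With w = exp lw this is (w / (1 + w))^(1 + 1/\<nu>); for lw = - \<nu> Ln z it is the
  limit transform (1 + z^\<nu>)^(-1 - 1/\<nu>). The argument is a logarithm in order to fix the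
  branch of the power of w.\<close>

definition laplace_limit :: "real \<Rightarrow> complex \<Rightarrow> complex" where
  "laplace_limit \<nu> lw = exp (- of_real (1 + 1 / \<nu>) * (Ln (1 + exp lw) - lw))"

text \<open>Since Re w > 0, |1 + w| is at least |w| and at least 1; the two lower bounds give the
  two estimates.\<close>

lemma norm_laplace_limit_le:
  assumes "0 < \<nu>" "\<bar>Im lw\<bar> < pi / 2"
  shows "norm (laplace_limit \<nu> lw) \<le> 1" and "norm (laplace_limit \<nu> lw) \<le> exp ((1 + 1 / \<nu>) * Re lw)"
proof -
  define p where "p = 1 + 1 / \<nu>"
  have p: "0 \<le> p" using assms by (simp add: p_def)
  have w: "0 < Re (exp lw)" by (rule Re_exp_pos) fact
  then have nz: "1 + exp lw \<noteq> 0" by (metis add.commute norm_one_plus_Re_pos(1) norm_zero not_one_le_zero)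
  have n: "norm (laplace_limit \<nu> lw) = exp (- (p * (ln (norm (1 + exp lw)) - Re lw)))"
    unfolding laplace_limit_def norm_exp_eq_Re p_def[symmetric] using nz by simp
  have "Re lw \<le> ln (norm (1 + exp lw))"
    using norm_one_plus_Re_pos(2)[OF w] by (subst ln_ge_iff) (use nz in auto)
  then have "p * (ln (norm (1 + exp lw)) - Re lw) \<ge> 0" using p by (intro mult_nonneg_nonneg) simp_all
  then show "norm (laplace_limit \<nu> lw) \<le> 1" unfolding n by simp
  have "0 \<le> ln (norm (1 + exp lw))" using norm_one_plus_Re_pos(1)[OF w] by simp
  then have "p * ln (norm (1 + exp lw)) \<ge> 0" using p by (intro mult_nonneg_nonneg)
  then show "norm (laplace_limit \<nu> lw) \<le> exp ((1 + 1 / \<nu>) * Re lw)"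
    unfolding n p_def[symmetric] by (simp add: algebra_simps)
qed

lemma abs_ln_le_powr:
  assumes "0 < c" "0 < (x::real)"
  shows "\<bar>ln x\<bar> \<le> (1 / c) * max (x powr c) (x powr - c)"
proof -
  have *: "ln y \<le> (1 / c) * y powr c" if "0 < y" for y
  proof -
    have "c * ln y = ln (y powr c)" using that by (simp add: ln_powr)
    also have "\<dots> \<le> y powr c" using ln_le_minus_one[of "y powr c"] that by simp
    finally show ?thesis using assms(1) by (simp add: field_simps)
  qed
  have "ln x \<le> (1 / c) * x powr c" by (rule *) fact
  also have "\<dots> \<le> (1 / c) * max (x powr c) (x powr - c)" using assms by (intro mult_left_mono) auto
  finally have 1: "ln x \<le> (1 / c) * max (x powr c) (x powr - c)" .
  have "- ln x \<le> (1 / c) * x powr - c"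
  proof -
    have "ln (1 / x) = - ln x" "(1 / x) powr c = x powr - c"
      using assms by (simp_all add: ln_div powr_divide powr_minus_divide)
    then show ?thesis using *[of "1 / x"] assms by simp
  qed
  also have "\<dots> \<le> (1 / c) * max (x powr c) (x powr - c)" using assms by (intro mult_left_mono) auto
  finally show ?thesis using 1 by linarith
qed

text \<open>The factor min 1 (2 x^\<nu>) will bound 1 / |1 + b|. Half of its exponent pays for the
  logarithm when x is small; when x is large the factor is 1, and |ln x| is itself at most a
  multiple of x^(\<nu>/2).\<close>

lemma weight_bounds:
  fixes \<nu> x :: real
  assumes \<nu>: "0 < \<nu>" "\<nu> < 1" and x: "0 < x"
  shows "min 1 (2 * x powr \<nu>) * (1 + \<bar>ln x\<bar>) \<le> (2 + 4 / \<nu>) * x powr (\<nu> / 2)"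
    and "min 1 (2 * x powr \<nu>) \<le> 2 * x powr (\<nu> / 2)"
    and "x powr \<nu> \<le> x powr (\<nu> / 2) + x"
proof -
  have half: "x powr \<nu> = x powr (\<nu> / 2) * x powr (\<nu> / 2)" by (simp flip: powr_add)
  have ln: "\<bar>ln x\<bar> \<le> (2 / \<nu>) * max (x powr (\<nu> / 2)) (x powr - (\<nu> / 2))"
    using abs_ln_le_powr[of "\<nu> / 2" x] \<nu> x by simp
  define y where "y = x powr (\<nu> / 2)"
  have y: "0 < y" using x by (simp add: y_def)
  have inv: "x powr - (\<nu> / 2) = 1 / y" by (simp add: y_def powr_minus_divide)
  have ln': "\<bar>ln x\<bar> \<le> (2 / \<nu>) * max y (1 / y)" using ln by (simp add: y_def[symmetric] inv)
  have xv: "x powr \<nu> = y * y" using half by (simp add: y_def)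
  have "min 1 (2 * x powr \<nu>) * (1 + \<bar>ln x\<bar>) \<le> (2 + 4 / \<nu>) * y \<and> min 1 (2 * x powr \<nu>) \<le> 2 * y
      \<and> x powr \<nu> \<le> y + x"
  proof (cases "1 \<le> x")
    case True
    have y1: "1 \<le> y" using True \<nu> by (simp add: y_def ge_one_powr_ge_zero)
    then have "1 / y \<le> y" using mult_mono[of 1 y 1 y] by (simp add: field_simps)
    then have l: "\<bar>ln x\<bar> \<le> (2 / \<nu>) * y" using ln' by (simp add: max_absorb1)
    have "min 1 (2 * x powr \<nu>) * (1 + \<bar>ln x\<bar>) \<le> 1 * (y + (2 / \<nu>) * y)"
      by (intro mult_mono add_mono y1 l) auto
    also have "\<dots> \<le> (2 + 4 / \<nu>) * y" using y \<nu> by (simp add: field_simps)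
    finally have A: "min 1 (2 * x powr \<nu>) * (1 + \<bar>ln x\<bar>) \<le> (2 + 4 / \<nu>) * y" .
    have "x powr \<nu> \<le> x powr 1" using True \<nu> by (intro powr_mono) auto
    then have "x powr \<nu> \<le> y + x" using x y by simp
    moreover have "min 1 (2 * x powr \<nu>) \<le> 2 * y" using y1 by linarith
    ultimately show ?thesis using A by blast
  next
    case False
    have y1: "y \<le> 1" using False \<nu> x by (simp add: y_def powr_le1)
    then have "y \<le> 1 / y" using mult_mono[of y 1 y 1] y by (simp add: field_simps)
    then have l: "\<bar>ln x\<bar> \<le> (2 / \<nu>) * (1 / y)" using ln' by (simp add: max_absorb2)
    have yy: "y * y \<le> y" using y1 y by simp
    have "min 1 (2 * x powr \<nu>) * (1 + \<bar>ln x\<bar>) \<le> (2 * (y * y)) * (1 + (2 / \<nu>) * (1 / y))"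
      by (intro mult_mono add_mono l) (auto simp: xv)
    also have "\<dots> = 2 * (y * y) + (4 / \<nu>) * y" using y by (simp add: field_simps)
    also have "\<dots> \<le> 2 * y + (4 / \<nu>) * y" using yy by simp
    finally have A: "min 1 (2 * x powr \<nu>) * (1 + \<bar>ln x\<bar>) \<le> (2 + 4 / \<nu>) * y" by (simp add: algebra_simps)
    have "x powr \<nu> \<le> y + x" "min 1 (2 * x powr \<nu>) \<le> 2 * y" using yy x unfolding xv by linarith+
    then show ?thesis using A by blast
  qed
  then show "min 1 (2 * x powr \<nu>) * (1 + \<bar>ln x\<bar>) \<le> (2 + 4 / \<nu>) * x powr (\<nu> / 2)"
    "min 1 (2 * x powr \<nu>) \<le> 2 * x powr (\<nu> / 2)" "x powr \<nu> \<le> x powr (\<nu> / 2) + x"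
    by (auto simp: y_def)
qed

text \<open>
  Here \<open>la\<close>, \<open>lb\<close>, \<open>lw\<close> are the logarithms of \<open>\<tau>\<^sup>-\<^sup>1 A\<^sup>-\<^sup>\<nu>\<close>, \<open>\<tau>\<^sup>-\<^sup>1 B\<^sup>-\<^sup>\<nu>\<close> and \<open>z\<^sup>-\<^sup>\<nu>\<close>.
\<close>

lemma laplace_limit_perturbation:
  fixes \<nu> C \<tau> x :: real and la lb lw y :: complex
  defines "g \<equiv> ln \<tau> / \<tau> * (x powr (\<nu> / 2) + x)"
    and "K \<equiv> 13 + (1 + 1 / \<nu>) * (24 * (2 + 4 / \<nu>) + 20)"
  assumes \<nu>: "0 < \<nu>" "\<nu> < 1" and C: "0 < C" "C < 1" and \<tau>: "8 \<le> \<tau>" and x: "0 < x"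
    and g: "g \<le> 1 / (2 * K)"
    and Im: "\<bar>Im la\<bar> < pi / 2" "\<bar>Im lb\<bar> < pi / 2" "\<bar>Im lw\<bar> < pi / 2"
    and lw: "Re lw = - \<nu> * ln x" and la: "- ln \<tau> - 1 \<le> Re la" and lbw: "norm (lb - lw) \<le> 4 * g"
    and y: "norm y \<le> g"
    and eq: "exp la - exp lb - 1 = (of_real C * (la - lb - of_real (ln \<tau>)) - 1) / of_real \<tau>"
  shows "1 - of_real C / (of_real \<tau> * exp la) \<noteq> 0"
    and "norm (exp y * exp (- of_real (1 + 1 / \<nu>) * (la - lb))
        * ((1 - of_real C / (of_real \<tau> * exp lb)) / (1 - of_real C / (of_real \<tau> * exp la)))
        - laplace_limit \<nu> lw) \<le> 2 * K * g * norm (laplace_limit \<nu> lw)"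
proof -
  define a b w where "a = exp la" and "b = exp lb" and "w = exp lw"
  define p where "p = 1 + 1 / \<nu>"
  define K1 where "K1 = 2 + 4 / \<nu>"
  define L where "L = ln \<tau>"
  define N where "N = \<bar>ln x\<bar> + 3"
  \<comment> \<open>The 13 collects 1 from y and 4 + 8 from the logarithms of 1 - kb and 1 - ka. The
    multiple of p collects 24 K1 from comparing la with Ln (1 + b), 16 from comparing 1 + b with 1 +
    w, and 4 from lb - lw.\<close>
  have K: "K = 13 + p * (24 * K1 + 20)" by (simp add: K_def p_def K1_def)
  have p: "1 \<le> p" using \<nu> by (simp add: p_def)
  have K1: "6 \<le> K1" using \<nu> by (simp add: K1_def field_simps)
  have pK: "24 * K1 + 20 \<le> p * (24 * K1 + 20)" using p K1 by (simp add: mult_right_mono)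
  have K_ge: "24 * K1 + 33 \<le> K" using pK by (simp add: K)
  have L1: "1 \<le> L"
    unfolding L_def using \<tau> exp_le by (subst ln_ge_iff) auto
  have L\<tau>: "3 + L \<le> \<tau>"
  proof -
    have "L - ln 4 = ln (\<tau> / 4)" using \<tau> by (simp add: L_def ln_div)
    also have "\<dots> \<le> \<tau> / 4 - 1" using \<tau> by (intro ln_le_minus_one) simp
    finally have "L \<le> \<tau> / 4 - 1 + ln 4" by simp
    moreover have "ln 4 \<le> (4 - 1 :: real)" by (rule ln_le_minus_one) simp
    ultimately show ?thesis using \<tau> by linarith
  qed
  have g0: "0 \<le> g" unfolding g_def using \<tau> x by (intro mult_nonneg_nonneg add_nonneg_nonneg) (auto simp: field_simps)
  have Kg: "K * g \<le> 1 / 2" using g K_ge K1 by (simp add: field_simps)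
  have Kg': "(24 * K1 + 33) * g \<le> 1 / 2" using mult_right_mono[OF K_ge g0] Kg by linarith
  have "144 * g \<le> 24 * K1 * g" using K1 g0 by (intro mult_right_mono) auto
  then have g_small: "177 * g \<le> 1 / 2" and K1g: "24 * K1 * g + 33 * g \<le> 1 / 2"
    using Kg' by (simp_all add: algebra_simps)
  have re: "0 < Re a" "0 < Re b" "0 < Re w"
    unfolding a_def b_def w_def using Im by (auto intro: Re_exp_pos)
  have pi2: "pi / 2 < 2" using pi_less_4 by simp
  have lb: "norm lb \<le> N"
  proof -
    have "norm lw \<le> \<bar>Re lw\<bar> + \<bar>Im lw\<bar>" by (rule cmod_le)
    also have "\<bar>Re lw\<bar> = \<nu> * \<bar>ln x\<bar>" using \<nu> by (simp add: lw abs_mult)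
    also have "\<dots> \<le> 1 * \<bar>ln x\<bar>" using \<nu> by (intro mult_right_mono) auto
    finally have "norm lw \<le> \<bar>ln x\<bar> + 2" using Im(3) pi2 by linarith
    moreover have "norm lb \<le> norm lw + norm (lb - lw)" by (metis add.commute diff_add_cancel norm_triangle_ineq)
    ultimately show ?thesis using lbw g_small g0 unfolding N_def by linarith
  qed
  \<comment> \<open>\<tau> times the deviation of a from 1 + b, by the hypothesis
    \<open>eq\<close>.\<close>
  define E where "E = of_real C * (la - lb - of_real L) - 1"
  have E: "norm E \<le> norm la + N + L + 1"
  proof -
    have "norm E \<le> norm (of_real C * (la - lb - of_real L)) + norm (1::complex)"
      unfolding E_def by (rule norm_triangle_ineq4)
    also have "norm (of_real C * (la - lb - of_real L)) = C * norm (la - lb - of_real L)"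
      using C by (simp add: norm_mult)
    also have "\<dots> \<le> 1 * norm (la - lb - of_real L)" using C by (intro mult_right_mono) auto
    also have "norm (la - lb - of_real L) \<le> norm la + norm lb + norm (of_real L :: complex)"
      by (meson norm_triangle_ineq4 order_trans add_right_mono)
    also have "norm (of_real L :: complex) = L" using L1 by simp
    finally show ?thesis using lb by simp
  qed
  have eq': "a - (1 + b) = E / of_real \<tau>"
    using eq unfolding a_def b_def E_def L_def by (simp add: algebra_simps)
  have la2: "norm la \<le> \<bar>Re la\<bar> + 2" using cmod_le[of la] Im(1) pi2 by linarith
  have N3: "3 \<le> N" by (simp add: N_def)
  \<comment> \<open>E contains la itself, so an a priori bound is needed. Upwards, exp X is at most
    a multiple of exp N plus a term linear in X, and the exponential wins; L\<tau> then replaces 3 +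
    L by \<tau> = exp L. Downwards it is the hypothesis on Re la.\<close>
  have Re_la: "\<bar>Re la\<bar> \<le> N + L + 1"
  proof (cases "0 \<le> Re la")
    case True
    define X where "X = Re la"
    have X0: "0 \<le> X" using True by (simp add: X_def)
    have eX: "1 + X \<le> exp X" by (rule exp_ge_add_one_self)
    have eN: "1 + N \<le> exp N" by (rule exp_ge_add_one_self)
    have "exp X = norm a" by (simp add: a_def X_def norm_exp_eq_Re)
    also have "\<dots> \<le> norm (1 + b) + norm (a - (1 + b))" by (metis add.commute diff_add_cancel norm_triangle_ineq)
    also have "norm (1 + b) \<le> 1 + norm b" using norm_triangle_ineq[of 1 b] by simp
    also have "norm b \<le> exp N"
      using complex_Re_le_cmod[of lb] lb by (simp add: b_def norm_exp_eq_Re)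
    also have "norm (a - (1 + b)) = norm E / \<tau>" unfolding eq' using \<tau> by (simp add: norm_divide)
    also have "\<dots> \<le> norm E / 4" using \<tau> by (intro divide_left_mono) auto
    also have "norm E \<le> X + N + L + 3" using E la2 X0 by (simp add: X_def)
    finally have "exp X \<le> 1 + exp N + (X + N + L + 3) / 4" by simp
    moreover have "3 * u \<le> 9 * v + L"
      if "u \<le> 1 + v + (X + N + L + 3) / 4" "1 + X \<le> u" "1 + N \<le> v" for u v
      using that N3 by (simp add: field_simps)
    ultimately have "3 * exp X \<le> 9 * exp N + L" using eX eN by blast
    also have "L \<le> 3 * L * exp N"
    proof -
      have "1 * 1 \<le> 3 * exp N" using N3 by (intro mult_mono) simp_all
      then have "L * (1 * 1) \<le> L * (3 * exp N)" by (rule mult_left_mono) (use L1 in simp)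
      then show ?thesis by (simp add: mult_ac)
    qed
    also have "9 * exp N + 3 * L * exp N = 3 * (exp N * (3 + L))" by (simp add: algebra_simps)
    finally have "exp X \<le> exp N * (3 + L)" by simp
    also have "\<dots> \<le> exp N * \<tau>" by (rule mult_left_mono[OF L\<tau>]) simp
    also have "\<dots> = exp (N + L)" using \<tau> by (simp add: exp_add L_def)
    finally show ?thesis using X0 by (simp add: X_def)
  next
    case False
    then show ?thesis using la N3 unfolding L_def by linarith
  qed
  have "norm E \<le> 2 * \<bar>ln x\<bar> + 2 * L + 10"
    using E la2 Re_la unfolding N_def by linarith
  also have "\<dots> \<le> 12 * (L * (1 + \<bar>ln x\<bar>))"
  proof -
    have "1 * \<bar>ln x\<bar> \<le> L * \<bar>ln x\<bar>" using L1 by (intro mult_right_mono) auto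
    then show ?thesis using L1 by (simp add: algebra_simps)
  qed
  finally have E': "norm E \<le> 12 * (L * (1 + \<bar>ln x\<bar>))" .
  \<comment> \<open>A bound for 1 / |1 + b|: the modulus of b is at least half of x^(-\<nu>), and |1
    + b| is at least 1 and at least |b|.\<close>
  define m where "m = min 1 (2 * x powr \<nu>)"
  have m0: "0 \<le> m" by (simp add: m_def)
  have b_lower: "1 / norm b \<le> 2 * x powr \<nu>"
  proof -
    have "1 / norm b = exp (- Re lb)" by (simp add: b_def norm_exp_eq_Re exp_minus divide_inverse)
    also have "- Re lb = - Re lw - Re (lb - lw)" by simp
    also have "\<dots> \<le> \<nu> * ln x + 1 / 2"
      using abs_Re_le_cmod[of "lb - lw"] lbw g_small g0 unfolding lw by linarith
    also have "exp (\<nu> * ln x + 1 / 2) = x powr \<nu> * exp (1 / 2)" using x by (simp add: exp_add powr_def)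
    also have "\<dots> \<le> x powr \<nu> * 2" using exp_half_le2 by (intro mult_left_mono) auto
    finally show ?thesis by (simp add: mult.commute)
  qed
  have nb: "0 < norm b" by (simp add: b_def)
  have b1: "1 / norm (1 + b) \<le> m"
  proof -
    have "1 / norm (1 + b) \<le> 1 / norm b"
      by (rule frac_le) (use norm_one_plus_Re_pos(2)[OF re(2)] nb in auto)
    moreover have "1 / norm (1 + b) \<le> 1"
      using norm_one_plus_Re_pos(1)[OF re(2)] by (simp add: divide_le_eq_1)
    ultimately show ?thesis using b_lower by (simp add: m_def)
  qed
  have nb1: "0 < norm (1 + b)" using norm_one_plus_Re_pos(1)[OF re(2)] by linarith
  define h where "h = x powr (\<nu> / 2)"
  have h0: "0 \<le> h" by (simp add: h_def)
  have g_eq: "g = L / \<tau> * (h + x)" by (simp add: g_def L_def h_def)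
  have L\<tau>0: "0 \<le> L / \<tau>" using L1 \<tau> by simp
  have le_g: "h / \<tau> \<le> g" "x / \<tau> \<le> g" "x powr \<nu> / \<tau> \<le> g"
  proof -
    have "1 / \<tau> \<le> L / \<tau>" using L1 \<tau> by (intro divide_right_mono) auto
    then have *: "v / \<tau> \<le> g" if "0 \<le> v" "v \<le> h + x" for v
      using mult_mono[of "1 / \<tau>" "L / \<tau>" v "h + x"] that L\<tau>0 \<tau> by (simp add: g_eq)
    show "h / \<tau> \<le> g" "x / \<tau> \<le> g" using h0 x by (auto intro!: *)
    show "x powr \<nu> / \<tau> \<le> g" using weight_bounds(3)[OF \<nu> x] by (intro *) (auto simp: h_def)
  qed
  have W: "m * (1 + \<bar>ln x\<bar>) \<le> K1 * h" "m \<le> 2 * h"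
    using weight_bounds(1,2)[OF \<nu> x] by (simp_all add: m_def K1_def h_def)
  \<comment> \<open>The relative error in a \<approx> 1 + b. It carries the logarithm into the
    rate.\<close>
  define \<eta> where "\<eta> = a / (1 + b) - 1"
  have nz1b: "1 + b \<noteq> 0" using nb1 by auto
  have \<eta>: "norm \<eta> \<le> 12 * K1 * g"
  proof -
    have "\<eta> = (E / of_real \<tau>) / (1 + b)"
      unfolding \<eta>_def eq'[symmetric] using nz1b by (simp add: diff_divide_distrib)
    then have "norm \<eta> = norm E * (1 / norm (1 + b)) / \<tau>" using \<tau> by (simp add: norm_divide norm_mult)
    also have "\<dots> \<le> (12 * (L * (1 + \<bar>ln x\<bar>))) * m / \<tau>"
      using E' b1 m0 L1 \<tau> by (intro divide_right_mono mult_mono) auto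
    also have "\<dots> = 12 * (L / \<tau>) * (m * (1 + \<bar>ln x\<bar>))" by simp
    also have "\<dots> \<le> 12 * (L / \<tau>) * (K1 * h)" using W L\<tau>0 by (intro mult_left_mono) auto
    also have "\<dots> = 12 * K1 * (L / \<tau> * h)" by simp
    also have "\<dots> \<le> 12 * K1 * g" unfolding g_eq using K1 L\<tau>0 x by (intro mult_left_mono) auto
    finally show ?thesis .
  qed
  have \<eta>_half: "norm \<eta> < 1 / 2" using \<eta> K1g g0 by linarith
  have re1: "0 < Re (1 + b)" "0 < Re (1 + w)" using re by auto
  have T1: "norm (la - Ln (1 + b)) \<le> 24 * K1 * g"
  proof -
    have "Ln a = la" unfolding a_def using Im(1) by (intro Ln_exp) (auto simp: abs_less_iff)
    then have "la - Ln (1 + b) = Ln (1 + \<eta>)"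
      using Ln_quotient_Re_pos[OF re(1) re1(1)] by (simp add: \<eta>_def)
    then show ?thesis using norm_Ln_le[OF \<eta>_half] \<eta> by simp
  qed
  have T2: "norm (Ln (1 + b) - Ln (1 + w)) \<le> 16 * g"
  proof -
    define u where "u = (1 + b) / (1 + w) - 1"
    have nw1: "0 < norm (1 + w)" using norm_one_plus_Re_pos(1)[OF re(3)] by linarith
    then have nz1w: "1 + w \<noteq> 0" by auto
    have "b = w * exp (lb - lw)" by (simp add: b_def w_def exp_diff)
    then have "u = w * (exp (lb - lw) - 1) / (1 + w)"
      unfolding u_def using nz1w by (simp add: field_simps)
    then have "norm u = norm (exp (lb - lw) - 1) * (norm w / norm (1 + w))" by (simp add: norm_mult norm_divide)
    also have "\<dots> \<le> (2 * norm (lb - lw)) * 1"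
    proof (intro mult_mono norm_exp_minus_one_le)
      show "norm w / norm (1 + w) \<le> 1"
        using norm_one_plus_Re_pos(2)[OF re(3)] nw1 by (simp add: divide_le_eq_1)
    qed (use lbw g_small g0 in auto)
    finally have u: "norm u \<le> 8 * g" using lbw by simp
    have "Ln (1 + b) - Ln (1 + w) = Ln (1 + u)"
      using Ln_quotient_Re_pos[OF re1] by (simp add: u_def)
    then show ?thesis using norm_Ln_le[of u] u g_small g0 by simp
  qed
  \<comment> \<open>In the application these are C B^\<nu> and C A^\<nu>, the correction factors in
    the derivative equation.\<close>
  define kb ka where "kb = of_real C / (of_real \<tau> * b)" and "ka = of_real C / (of_real \<tau> * a)"
  have kb: "norm kb \<le> 2 * g"
  proof -
    have "norm kb = C * (1 / norm b) / \<tau>" using C \<tau> by (simp add: kb_def norm_divide norm_mult)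
    also have "\<dots> \<le> 1 * (2 * x powr \<nu>) / \<tau>" using C \<tau> b_lower by (intro divide_right_mono mult_mono) auto
    finally show ?thesis using le_g(3) by simp
  qed
  have ka: "norm ka \<le> 4 * g"
  proof -
    have "norm (1 + \<eta>) \<ge> 1 / 2" using norm_triangle_ineq4[of "1 + \<eta>" \<eta>] \<eta>_half by simp
    moreover have "a = (1 + b) * (1 + \<eta>)" using nz1b by (simp add: \<eta>_def)
    ultimately have "norm (1 + b) * (1 / 2) \<le> norm a"
      using mult_left_mono[of "1 / 2" "norm (1 + \<eta>)" "norm (1 + b)"] by (simp only: norm_mult norm_ge_zero)
    then have "1 / norm a \<le> 1 / (norm (1 + b) * (1 / 2))"
      by (rule frac_le[rotated 3]) (use nb1 in auto)
    also have "\<dots> = 2 * (1 / norm (1 + b))" by simp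
    also have "\<dots> \<le> 2 * (2 * h)" using b1 W(2) by linarith
    finally have 1: "1 / norm a \<le> 4 * h" by simp
    have "norm ka = C * (1 / norm a) / \<tau>" using C \<tau> by (simp add: ka_def norm_divide norm_mult)
    also have "\<dots> \<le> 1 * (4 * h) / \<tau>" using C \<tau> 1 by (intro divide_right_mono mult_mono) auto
    finally show ?thesis using le_g(1) by simp
  qed
  have ka_half: "norm (- ka) < 1 / 2" and kb_half: "norm (- kb) < 1 / 2"
    using ka kb g_small g0 by simp_all
  have nz: "1 - ka \<noteq> 0" "1 - kb \<noteq> 0" using ka_half kb_half by auto
  then show "1 - of_real C / (of_real \<tau> * exp la) \<noteq> 0" by (simp add: ka_def a_def)
  have lka: "norm (Ln (1 - ka)) \<le> 8 * g" "norm (Ln (1 - kb)) \<le> 4 * g"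
    using norm_Ln_le[OF ka_half] norm_Ln_le[OF kb_half] ka kb by simp_all
  define D where "D = (la - Ln (1 + b)) + (Ln (1 + b) - Ln (1 + w)) - (lb - lw)"
  have D: "norm D \<le> (24 * K1 + 20) * g"
  proof -
    have "norm D \<le> norm (la - Ln (1 + b)) + norm (Ln (1 + b) - Ln (1 + w)) + norm (lb - lw)"
      unfolding D_def by (meson norm_triangle_ineq norm_triangle_ineq4 order_trans add_right_mono)
    then show ?thesis using T1 T2 lbw by (simp add: algebra_simps)
  qed
  \<comment> \<open>A logarithm of the quotient of the exact expression by the limit; D gathers the
    comparisons a with 1 + b, 1 + b with 1 + w, and b with w.\<close>
  define \<rho> where "\<rho> = y + (Ln (1 - kb) - Ln (1 - ka)) - of_real p * D"
  have \<rho>: "norm \<rho> \<le> K * g"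
  proof -
    have "norm \<rho> \<le> norm y + norm (Ln (1 - kb) - Ln (1 - ka)) + norm (of_real p * D)"
      unfolding \<rho>_def by (meson norm_triangle_ineq norm_triangle_ineq4 order_trans add_right_mono)
    also have "norm (Ln (1 - kb) - Ln (1 - ka)) \<le> 4 * g + 8 * g"
      by (rule order_trans[OF norm_triangle_ineq4]) (use lka in simp)
    also have "norm (of_real p * D) = p * norm D" using p by (simp add: norm_mult)
    also have "\<dots> \<le> p * ((24 * K1 + 20) * g)" using D p by (intro mult_left_mono) auto
    finally show ?thesis using y by (simp add: K algebra_simps)
  qed
  have "laplace_limit \<nu> lw * exp \<rho>
      = exp (- of_real p * (Ln (1 + w) - lw) + \<rho>)"
    by (simp add: laplace_limit_def w_def p_def exp_add)
  also have "- of_real p * (Ln (1 + w) - lw) + \<rho> = y + (- of_real p * (la - lb)) + (Ln (1 - kb) - Ln (1 - ka))"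
    by (simp add: \<rho>_def D_def algebra_simps)
  also have "exp \<dots> = exp y * exp (- of_real p * (la - lb)) * ((1 - kb) / (1 - ka))"
  proof -
    have "exp (Ln (1 - kb) - Ln (1 - ka)) = (1 - kb) / (1 - ka)" using nz by (simp add: exp_diff)
    then show ?thesis by (simp only: exp_add)
  qed
  finally have "exp y * exp (- of_real p * (la - lb)) * ((1 - kb) / (1 - ka)) - laplace_limit \<nu> lw
      = laplace_limit \<nu> lw * (exp \<rho> - 1)"
    by (simp add: algebra_simps)
  then have "norm (exp y * exp (- of_real p * (la - lb)) * ((1 - kb) / (1 - ka)) - laplace_limit \<nu> lw)
      = norm (laplace_limit \<nu> lw) * norm (exp \<rho> - 1)" by (simp only: norm_mult)
  also have "\<dots> \<le> norm (laplace_limit \<nu> lw) * (2 * (K * g))"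
    using norm_exp_minus_one_le(1)[of \<rho>] \<rho> Kg by (intro mult_left_mono) auto
  finally show "norm (exp y * exp (- of_real (1 + 1 / \<nu>) * (la - lb))
        * ((1 - of_real C / (of_real \<tau> * exp lb)) / (1 - of_real C / (of_real \<tau> * exp la)))
        - laplace_limit \<nu> lw) \<le> 2 * K * g * norm (laplace_limit \<nu> lw)"
    unfolding p_def ka_def kb_def a_def b_def by (simp add: mult_ac)
qed

text \<open>Returns from the logarithmic variables to A, B and z. The time has been eliminated: the
  implicit equation at s = 0 gives \<nu>^2 C t = \<tau> + C \<nu> ln q - 1, so only q and \<tau>
  enter.\<close>

lemma laplace_estimate:
  fixes \<nu> C q :: real and z A D :: complex
  defines "\<tau> \<equiv> q powr - \<nu>"
  defines "g \<equiv> ln \<tau> / \<tau> * (norm z powr (\<nu> / 2) + norm z)"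
    and "K \<equiv> 13 + (1 + 1 / \<nu>) * (24 * (2 + 4 / \<nu>) + 20)"
    and "B \<equiv> 1 - exp (- of_real q * z)"
  assumes \<nu>: "0 < \<nu>" "\<nu> < 1" and C: "0 < C" "C < 1" and q: "0 < q" and \<tau>: "8 \<le> \<tau>"
    and z: "0 < Re z" and g: "g \<le> 1 / (2 * K)"
    and A: "0 < Re A" "norm A \<le> 2"
    and eq: "exp (- of_real \<nu> * Ln A) + of_real (C * \<nu>) * Ln A
      = exp (- of_real \<nu> * Ln B) + of_real (C * \<nu>) * Ln B + of_real (\<tau> + C * \<nu> * ln q - 1)"
    and D: "D * (exp (- of_real (1 + \<nu>) * Ln A) * (1 - of_real C * exp (of_real \<nu> * Ln A)))
      = exp (- of_real (1 + \<nu>) * Ln B) * (1 - of_real C * exp (of_real \<nu> * Ln B))"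
  shows "norm (exp (- of_real q * z) * D - laplace_limit \<nu> (- of_real \<nu> * Ln z))
    \<le> 2 * K * g * norm (laplace_limit \<nu> (- of_real \<nu> * Ln z))"
proof -
  define y where "y = - of_real q * z"
  define la lb lw where "la = - of_real \<nu> * Ln A - of_real (ln \<tau>)"
    and "lb = - of_real \<nu> * Ln B - of_real (ln \<tau>)" and "lw = - of_real \<nu> * Ln z"
  have z0: "z \<noteq> 0" using z by auto
  have \<tau>0: "0 < \<tau>" using \<tau> by simp
  have ln\<tau>: "ln \<tau> = - \<nu> * ln q" using q by (simp add: \<tau>_def ln_powr)
  have L1: "1 \<le> ln \<tau>" using \<tau> exp_le by (subst ln_ge_iff) auto
  have q1: "q < 1"
  proof (rule ccontr)
    assume "\<not> q < 1"
    then have "0 \<le> \<nu> * ln q" using \<nu> by simp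
    then show False using ln\<tau> L1 by simp
  qed
  \<comment> \<open>As \<nu> < 1, q is at most 1 / \<tau>. Thus the errors of replacing B by q z and
    exp (- q z) by 1, both of order q |z|, are within g.\<close>
  have "q powr 1 \<le> q powr \<nu>" using q q1 \<nu> by (intro powr_mono') auto
  then have q\<tau>: "q \<le> 1 / \<tau>" using q by (simp add: \<tau>_def powr_minus_divide)
  have K13: "13 \<le> K" unfolding K_def using \<nu> by simp
  have g1: "g \<le> 1 / 26"
    by (rule order_trans[OF g]) (use K13 in \<open>simp add: field_simps\<close>)
  have xg: "norm z / \<tau> \<le> g"
  proof -
    have "0 \<le> ln \<tau> / \<tau>" using L1 \<tau>0 by (intro divide_nonneg_pos) linarith+
    then have "1 / \<tau> * norm z \<le> ln \<tau> / \<tau> * (norm z powr (\<nu> / 2) + norm z)"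
      using L1 \<tau>0 by (intro mult_mono divide_right_mono) auto
    then show ?thesis by (simp add: g_def)
  qed
  have y: "norm y \<le> g"
  proof -
    have "norm y = q * norm z" using q by (simp add: y_def norm_mult)
    also have "\<dots> \<le> 1 / \<tau> * norm z" by (rule mult_right_mono[OF q\<tau>]) simp
    finally show ?thesis using xg by simp
  qed
  have y0: "y \<noteq> 0" using z0 q by (simp add: y_def)
  have "norm (exp y) < 1" using z q by (simp add: y_def norm_exp_eq_Re)
  then have "Re (exp y) < 1" using complex_Re_le_cmod[of "exp y"] by linarith
  then have B: "0 < Re B" by (simp add: B_def y_def)
  define u where "u = B / (of_real q * z) - 1"
  have u: "norm u \<le> 2 * g"
  proof -
    have "u = (exp y - 1 - y) / y" using y0 q z0 by (simp add: u_def B_def y_def field_simps)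
    then have "norm u = norm (exp y - 1 - y) / norm y" by (simp add: norm_divide)
    also have "\<dots> \<le> 2 * (norm y)\<^sup>2 / norm y"
      using norm_exp_minus_one_le(2)[of y] y g1 by (intro divide_right_mono) auto
    also have "\<dots> = 2 * norm y" by (simp add: power2_eq_square)
    finally show ?thesis using y by simp
  qed
  have "lb - lw = - of_real \<nu> * Ln (1 + u)"
  proof -
    have "Ln (1 + u) = Ln B - Ln (of_real q * z)"
      using Ln_quotient_Re_pos[OF B, of "of_real q * z"] q z by (simp add: u_def)
    also have "Ln (of_real q * z) = of_real (ln q) + Ln z"
      using Ln_times_of_real[OF q z0] by (simp add: Ln_of_real q)
    finally have "Ln B = Ln (1 + u) + (of_real (ln q) + Ln z)" by simp
    then show ?thesis unfolding lb_def lw_def ln\<tau> by (simp add: algebra_simps)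
  qed
  then have "norm (lb - lw) = \<nu> * norm (Ln (1 + u))" using \<nu> by (simp add: norm_mult)
  also have "\<dots> \<le> 1 * (2 * norm u)"
    by (intro mult_mono norm_Ln_le) (use \<nu> u g1 in auto)
  also have "\<dots> \<le> 4 * g" using u by simp
  finally have lbw: "norm (lb - lw) \<le> 4 * g" .
  have Im: "\<bar>Im (- of_real \<nu> * Ln v - of_real c)\<bar> < pi / 2" if "0 < Re v" for v c
  proof -
    have "\<nu> * \<bar>Im (Ln v)\<bar> \<le> 1 * \<bar>Im (Ln v)\<bar>" using \<nu> by (intro mult_right_mono) auto
    then show ?thesis using Re_Ln_pos_lt_imp[OF that] \<nu> by (simp add: abs_mult)
  qed
  have Im_lw: "\<bar>Im lw\<bar> < pi / 2" using Im[OF z, of 0] by (simp add: lw_def)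
  have Re_lw: "Re lw = - \<nu> * ln (norm z)" using z0 by (simp add: lw_def)
  \<comment> \<open>From |A| \<le> 2 and \<nu> ln 2 \<le> 1.\<close>
  have Re_la: "- ln \<tau> - 1 \<le> Re la"
  proof -
    have A0: "A \<noteq> 0" using A by auto
    have "ln (norm A) \<le> ln 2" using A A0 by (subst ln_le_cancel_iff) auto
    also have "\<dots> \<le> 1" using ln_le_minus_one[of 2] by simp
    finally have "\<nu> * ln (norm A) \<le> \<nu> * 1" using \<nu> by (intro mult_left_mono) auto
    moreover have "Re la = - \<nu> * ln (norm A) - ln \<tau>" using A0 by (simp add: la_def)
    ultimately show ?thesis using \<nu> by linarith
  qed
  have ex: "of_real \<tau> * exp (- of_real \<nu> * Ln v - of_real (ln \<tau>)) = exp (- of_real \<nu> * Ln v)" for v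
    using \<tau>0 by (simp add: exp_diff exp_of_real)
  have \<tau>c: "complex_of_real \<tau> \<noteq> 0" using \<tau>0 by simp
  have eq': "exp la - exp lb - 1 = (of_real C * (la - lb - of_real (ln \<tau>)) - 1) / of_real \<tau>"
  proof -
    have "of_real \<tau> * (exp la - exp lb - 1) = of_real C * (la - lb - of_real (ln \<tau>)) - 1"
    proof -
      have 1: "of_real \<tau> * exp la = exp (- of_real \<nu> * Ln A)" "of_real \<tau> * exp lb = exp (- of_real \<nu> * Ln B)"
        unfolding la_def lb_def by (rule ex)+
      have 2: "la - lb - of_real (ln \<tau>) = of_real \<nu> * (Ln B - Ln A + of_real (ln q))"
        unfolding la_def lb_def ln\<tau> by (simp add: algebra_simps)
      have "of_real \<tau> * (exp la - exp lb - 1) = exp (- of_real \<nu> * Ln A) - exp (- of_real \<nu> * Ln B) - of_real \<tau>"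
        unfolding 1[symmetric] by (simp add: algebra_simps)
      also have "\<dots> = of_real C * (of_real \<nu> * (Ln B - Ln A + of_real (ln q))) - 1"
        using eq by (simp add: algebra_simps)
      finally show ?thesis unfolding 2 .
    qed
    then show ?thesis using \<tau>c by (simp add: field_simps)
  qed
  note pert = laplace_limit_perturbation[OF \<nu> C \<tau>, of "norm z" la lb lw y, folded K_def g_def,
    OF _ g _ _ Im_lw Re_lw Re_la lbw y eq']
  have k: "of_real C / (of_real \<tau> * exp (- of_real \<nu> * Ln v - of_real (ln \<tau>))) = of_real C * exp (of_real \<nu> * Ln v)" for v
    unfolding ex by (simp add: exp_minus divide_inverse)
  have nz: "1 - of_real C * exp (of_real \<nu> * Ln A) \<noteq> 0"
    using pert(1) Im[OF A(1)] Im[OF B] z0 unfolding la_def lb_def k by auto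
  \<comment> \<open>The exponents match because (1 + 1/\<nu>) \<nu> = 1 + \<nu>; the terms ln \<tau>
    cancel in la - lb.\<close>
  have e: "- of_real (1 + 1 / \<nu>) * (la - lb) = of_real (1 + \<nu>) * Ln A - of_real (1 + \<nu>) * Ln B"
    using \<nu> unfolding la_def lb_def by (simp add: field_simps)
  have "D = exp (- of_real (1 + 1 / \<nu>) * (la - lb))
      * ((1 - of_real C / (of_real \<tau> * exp lb)) / (1 - of_real C / (of_real \<tau> * exp la)))"
  proof -
    have inv: "exp (- of_real (1 + \<nu>) * Ln v) = 1 / exp (of_real (1 + \<nu>) * Ln v)" for v
      by (simp only: mult_minus_left exp_minus inverse_eq_divide)
    have "D = EA / EB * (kB / kA)" if "D * (1 / EA * kA) = 1 / EB * kB" "kA \<noteq> 0" "EA \<noteq> 0" "EB \<noteq> 0"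
      for EA EB kA kB :: complex
      using that by (simp add: field_simps)
    moreover have "of_real C / (of_real \<tau> * exp la) = of_real C * exp (of_real \<nu> * Ln A)"
      "of_real C / (of_real \<tau> * exp lb) = of_real C * exp (of_real \<nu> * Ln B)"
      unfolding la_def lb_def by (rule k)+
    ultimately show ?thesis
      unfolding e exp_diff using D[unfolded inv] nz by (metis exp_not_eq_zero)
  qed
  then have "exp (- of_real q * z) * D = exp y * exp (- of_real (1 + 1 / \<nu>) * (la - lb))
      * ((1 - of_real C / (of_real \<tau> * exp lb)) / (1 - of_real C / (of_real \<tau> * exp la)))"
    by (simp add: y_def)
  then show ?thesis
    using pert(2) Im[OF A(1)] Im[OF B] z0 unfolding la_def lb_def lw_def by simp
qed

section \<open>The rate of convergence\<close>

text \<open>Up to constants, |x|^(-1) times the growth factor of the error times the decay of the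
  limit transform. Both exponents lie on the integrable side of -1.\<close>

definition laplace_weight :: "real \<Rightarrow> real \<Rightarrow> real" where
  "laplace_weight \<nu> x = (if \<bar>x\<bar> \<le> 1 then \<bar>x\<bar> powr (\<nu> / 2 - 1) else \<bar>x\<bar> powr (- 1 - \<nu>))"

lemma laplace_weight_nonneg: "0 \<le> laplace_weight \<nu> x"
  by (simp add: laplace_weight_def)

lemma integrable_laplace_weight:
  assumes \<nu>: "0 < \<nu>"
  shows "integrable lborel (laplace_weight \<nu>)"
proof -
  let ?f = "\<lambda>x::real. indicator {0..1} x *\<^sub>R x powr (\<nu> / 2 - 1) + indicator {1<..} x *\<^sub>R x powr (- 1 - \<nu>)"
  have "(\<lambda>x. x powr (\<nu> / 2 - 1)) absolutely_integrable_on {0..1}"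
    using has_integral_powr_from_0[of "\<nu> / 2 - 1" 1] \<nu>
    by (intro nonnegative_absolutely_integrable_1) (auto simp: integrable_on_def)
  then have 1: "integrable lborel (\<lambda>x::real. indicator {0..1} x *\<^sub>R x powr (\<nu> / 2 - 1))"
    unfolding set_integrable_def by (subst (asm) integrable_completion) auto
  have "(\<lambda>x. x powr (- 1 - \<nu>)) absolutely_integrable_on {1..}"
    using has_integral_powr_to_inf[of "- 1 - \<nu>" 1] \<nu>
    by (intro nonnegative_absolutely_integrable_1) (auto simp: integrable_on_def)
  then have "integrable lborel (\<lambda>x::real. indicator {1..} x *\<^sub>R x powr (- 1 - \<nu>))"
    unfolding set_integrable_def by (subst (asm) integrable_completion) auto
  then have 2: "integrable lborel (\<lambda>x::real. indicator {1<..} x *\<^sub>R x powr (- 1 - \<nu>))"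
    by (rule Bochner_Integration.integrable_bound) (auto simp: indicator_def)
  have f: "integrable lborel ?f" using 1 2 by (rule Bochner_Integration.integrable_add)
  have "integrable lborel (\<lambda>x. ?f x + ?f (0 + -1 * x))"
    by (rule Bochner_Integration.integrable_add[OF f lborel_integrable_real_affine[OF f]]) simp
  also have "(\<lambda>x. ?f x + ?f (0 + -1 * x)) = laplace_weight \<nu>"
    by (rule ext) (auto simp: laplace_weight_def indicator_def)
  finally show ?thesis .
qed

lemma laplace_weight_bound:
  assumes \<nu>: "0 < \<nu>" "\<nu> < 1" and r: "0 < r" "r = \<bar>x\<bar>"
  shows "(r powr (\<nu> / 2) + r) * min 1 (r powr (- 1 - \<nu>)) \<le> r * (2 * laplace_weight \<nu> x)"
    and "min 1 (r powr (- 1 - \<nu>)) \<le> laplace_weight \<nu> x"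
proof -
  have "(r powr (\<nu> / 2) + r) * min 1 (r powr (- 1 - \<nu>)) \<le> r * (2 * laplace_weight \<nu> x)
    \<and> min 1 (r powr (- 1 - \<nu>)) \<le> laplace_weight \<nu> x"
  proof (cases "r \<le> 1")
    case True
    have "r powr 1 \<le> r powr (\<nu> / 2)" using True r \<nu> by (intro powr_mono') auto
    then have "(r powr (\<nu> / 2) + r) * min 1 (r powr (- 1 - \<nu>)) \<le> (2 * r powr (\<nu> / 2)) * 1"
      using r by (intro mult_mono) auto
    also have "\<dots> = r * (2 * laplace_weight \<nu> x)"
      using True r by (simp add: laplace_weight_def powr_diff)
    finally have A: "(r powr (\<nu> / 2) + r) * min 1 (r powr (- 1 - \<nu>)) \<le> r * (2 * laplace_weight \<nu> x)" .
    have "r powr 0 \<le> r powr (\<nu> / 2 - 1)" using True r \<nu> by (intro powr_mono') auto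
    then have "1 \<le> laplace_weight \<nu> x" using True r by (simp add: laplace_weight_def)
    then show ?thesis using A by linarith
  next
    case False
    have "r powr (\<nu> / 2) \<le> r powr 1" using False \<nu> by (intro powr_mono) auto
    then have "(r powr (\<nu> / 2) + r) * min 1 (r powr (- 1 - \<nu>)) \<le> (2 * r) * r powr (- 1 - \<nu>)"
      using r by (intro mult_mono) auto
    also have "\<dots> = r * (2 * laplace_weight \<nu> x)"
      using False r by (simp add: laplace_weight_def)
    finally have A: "(r powr (\<nu> / 2) + r) * min 1 (r powr (- 1 - \<nu>)) \<le> r * (2 * laplace_weight \<nu> x)" .
    have "min 1 (r powr (- 1 - \<nu>)) \<le> laplace_weight \<nu> x" using False r by (simp add: laplace_weight_def)
    then show ?thesis using A by blast
  qed
  then show "(r powr (\<nu> / 2) + r) * min 1 (r powr (- 1 - \<nu>)) \<le> r * (2 * laplace_weight \<nu> x)"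
    "min 1 (r powr (- 1 - \<nu>)) \<le> laplace_weight \<nu> x" by auto
qed

lemma norm_laplace_limit_Ln_le:
  assumes \<nu>: "0 < \<nu>" "\<nu> < 1" and z: "0 < Re z"
  shows "norm (laplace_limit \<nu> (- of_real \<nu> * Ln z)) \<le> min 1 (norm z powr (- 1 - \<nu>))"
proof -
  have z0: "z \<noteq> 0" using z by auto
  have "\<nu> * \<bar>Im (Ln z)\<bar> \<le> 1 * \<bar>Im (Ln z)\<bar>" using \<nu> by (intro mult_right_mono) auto
  then have Im: "\<bar>Im (- of_real \<nu> * Ln z)\<bar> < pi / 2"
    using Re_Ln_pos_lt_imp[OF z] \<nu> by (simp add: abs_mult)
  have "(1 + 1 / \<nu>) * Re (- of_real \<nu> * Ln z) = (- 1 - \<nu>) * ln (norm z)"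
    using \<nu> z0 by (simp add: field_simps)
  then have "exp ((1 + 1 / \<nu>) * Re (- of_real \<nu> * Ln z)) = norm z powr (- 1 - \<nu>)"
    using z0 by (simp only: powr_def) simp
  then show ?thesis using norm_laplace_limit_le[OF \<nu>(1) Im] by simp
qed

lemma laplace_transform_eq_limit:
  assumes \<mu>: "real_distribution \<mu>" "measure \<mu> {..<0} = 0" and \<nu>: "0 < \<nu>" "\<nu> < 1"
    and eq: "\<And>\<theta>. 0 \<le> \<theta> \<Longrightarrow> (LINT x|\<mu>. exp (- \<theta> * x)) = 1 / (1 + \<theta> powr \<nu>) powr (1 + 1 / \<nu>)"
    and z: "0 < Re z"
  shows "laplace_transform \<mu> z = laplace_limit \<nu> (- of_real \<nu> * Ln z)"
proof (rule real_distribution.laplace_transform_eqI[OF \<mu> _ _ z])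
  have Im: "\<bar>Im (- of_real \<nu> * Ln v)\<bar> < pi / 2" if "0 < Re v" for v
  proof -
    have "\<nu> * \<bar>Im (Ln v)\<bar> \<le> 1 * \<bar>Im (Ln v)\<bar>" using \<nu> by (intro mult_right_mono) auto
    then show ?thesis using Re_Ln_pos_lt_imp[OF that] \<nu> by (simp add: abs_mult)
  qed
  show "(\<lambda>z. laplace_limit \<nu> (- of_real \<nu> * Ln z)) holomorphic_on {z. 0 < Re z}"
  proof -
    have "v \<notin> \<real>\<^sub>\<le>\<^sub>0" "1 + exp (- of_real \<nu> * Ln v) \<notin> \<real>\<^sub>\<le>\<^sub>0" if "0 < Re v" for v
      using that Re_exp_pos[OF Im[OF that]] by (auto simp: complex_nonpos_Reals_iff)
    then show ?thesis
      unfolding laplace_limit_def by (intro holomorphic_intros) auto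
  qed
  fix \<theta> :: real assume \<theta>: "0 < \<theta>"
  define p where "p = 1 + 1 / \<nu>"
  define c where "c = \<theta> powr - \<nu>"
  have c: "0 < c" using \<theta> by (simp add: c_def)
  have "exp (- of_real \<nu> * Ln (of_real \<theta>)) = complex_of_real c"
    using \<theta> by (simp add: c_def powr_def Ln_of_real exp_of_real[symmetric])
  moreover have "Ln (1 + complex_of_real c) = of_real (ln (1 + c))"
    using Ln_of_real[of "1 + c"] c by simp
  ultimately have "laplace_limit \<nu> (- of_real \<nu> * Ln (of_real \<theta>)) = of_real (exp (- p * (ln (1 + c) + \<nu> * ln \<theta>)))"
    unfolding laplace_limit_def p_def[symmetric] using \<theta>
    by (simp add: p_def Ln_of_real exp_of_real[symmetric])
  also have "ln (1 + c) + \<nu> * ln \<theta> = ln (1 + \<theta> powr \<nu>)"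
  proof -
    have "ln (1 + c) + \<nu> * ln \<theta> = ln ((1 + c) * \<theta> powr \<nu>)"
      using c \<theta> by (simp add: ln_mult ln_powr)
    also have "(1 + c) * \<theta> powr \<nu> = 1 + \<theta> powr \<nu>"
      using \<theta> by (simp add: c_def distrib_right flip: powr_add)
    finally show ?thesis .
  qed
  also have "exp (- p * ln (1 + \<theta> powr \<nu>)) = 1 / (1 + \<theta> powr \<nu>) powr p"
  proof -
    have "1 + \<theta> powr \<nu> \<noteq> 0" using powr_ge_zero[of \<theta> \<nu>] by linarith
    then show ?thesis by (simp add: powr_def exp_minus divide_inverse)
  qed
  finally show "of_real (LINT x|\<mu>. exp (- \<theta> * x)) = laplace_limit \<nu> (- of_real \<nu> * Ln (of_real \<theta>))"
    using eq[of \<theta>] \<theta> by (simp add: p_def)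
qed

section \<open>Passage to the imaginary axis\<close>

lemma norm_vertical_tendsto: "(\<lambda>n. norm (Complex (1 / real (Suc n)) (- x))) \<longlonglongrightarrow> \<bar>x\<bar>"
proof -
  have "(\<lambda>n. norm (Complex (1 / real (Suc n)) (- x))) \<longlonglongrightarrow> norm (Complex 0 (- x))"
    by (intro tendsto_norm tendsto_Complex tendsto_const LIMSEQ_Suc[OF lim_1_over_n])
  then show ?thesis by (simp add: complex_norm)
qed

text \<open>A bound in the open half-plane that depends only on |z| passes to the boundary. The
  strict inequality |x| < T keeps the approximating points in the range of the bound.\<close>

lemma limit_norm_le_of_vertical:
  fixes \<phi> :: "complex \<Rightarrow> complex"
  assumes lim: "(\<lambda>n. \<phi> (Complex (1 / real (Suc n)) (- x))) \<longlonglongrightarrow> l"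
    and le: "\<And>z. 0 < Re z \<Longrightarrow> norm z < T \<Longrightarrow> norm (\<phi> z) \<le> b (norm z)"
    and b: "isCont b \<bar>x\<bar>" and x: "\<bar>x\<bar> < T"
  shows "norm l \<le> b \<bar>x\<bar>"
proof (rule tendsto_le[OF _ _ tendsto_norm[OF lim]])
  show "(\<lambda>n. b (norm (Complex (1 / real (Suc n)) (- x)))) \<longlonglongrightarrow> b \<bar>x\<bar>"
    by (rule isCont_tendsto_compose[OF b norm_vertical_tendsto])
  have "\<forall>\<^sub>F n in sequentially. norm (Complex (1 / real (Suc n)) (- x)) < T"
    using norm_vertical_tendsto x by (rule order_tendstoD)
  then show "\<forall>\<^sub>F n in sequentially. norm (\<phi> (Complex (1 / real (Suc n)) (- x))) \<le> b (norm (Complex (1 / real (Suc n)) (- x)))"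
    by eventually_elim (rule le, simp_all)
qed simp

text \<open>The decay |z|^(-1-\<nu>) of the transform makes the characteristic function integrable,
  so the limit law has a bounded density; this is the Lipschitz condition for smoothing.\<close>

lemma cdf_limit_lipschitz:
  assumes \<mu>: "real_distribution \<mu>" "measure \<mu> {..<0} = 0" and \<nu>: "0 < \<nu>" "\<nu> < 1"
    and eq: "\<And>z. 0 < Re z \<Longrightarrow> laplace_transform \<mu> z = laplace_limit \<nu> (- of_real \<nu> * Ln z)"
  obtains m where "\<And>x y. x \<le> y \<Longrightarrow> cdf \<mu> y - cdf \<mu> x \<le> m * (y - x)"
proof
  interpret real_distribution \<mu> by fact
  \<comment> \<open>The indicator repairs x = 0, where \<open>0 powr _\<close> is 0 whereas the
    characteristic function is 1; it does not change the integral.\<close>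
  let ?h = "\<lambda>x. laplace_weight \<nu> x + indicator {0} x"
  fix x y :: real assume "x \<le> y"
  then show "cdf \<mu> y - cdf \<mu> x \<le> (LBINT t. ?h t) * (y - x)"
  proof (rule cdf_lipschitz_of_char[rotated 2])
    show "integrable lborel ?h"
      by (intro Bochner_Integration.integrable_add integrable_laplace_weight \<nu> integrable_real_indicator) auto
    fix x
    show "norm (char \<mu> x) \<le> ?h x"
    proof (cases "x = 0")
      case True
      then show ?thesis using cmod_char_le_1[of x] laplace_weight_nonneg[of \<nu> x] by simp
    next
      case False
      have "norm (char \<mu> x) \<le> min 1 (\<bar>x\<bar> powr (- 1 - \<nu>))"
      proof (rule limit_norm_le_of_vertical[OF laplace_transform_tendsto_char[OF \<mu>(2)], where T = "\<bar>x\<bar> + 1"])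
        show "isCont (\<lambda>r. min 1 (r powr (- 1 - \<nu>))) \<bar>x\<bar>" using False by (intro continuous_intros) auto
        show "norm (laplace_transform \<mu> z) \<le> min 1 (norm z powr (- 1 - \<nu>))" if "0 < Re z" for z
          unfolding eq[OF that] by (rule norm_laplace_limit_Ln_le[OF \<nu> that])
      qed simp
      also have "\<dots> \<le> laplace_weight \<nu> x"
        by (rule laplace_weight_bound(2)[OF \<nu>]) (use False in auto)
      finally show ?thesis using False by simp
    qed
  qed
qed

context explicit_branching_process
begin

definition \<tau> :: "real \<Rightarrow> real" where "\<tau> t = survival_prob P Z t powr - \<nu>"

section \<open>Asymptotics of the survival probability\<close>

lemma survival_prob_bounds:
  assumes "0 \<le> t" shows "0 < survival_prob P Z t" "survival_prob P Z t \<le> 1"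
  using survival_prob_eq(2)[OF assms] pgf_bounds(1)[OF assms, of 0] pgf_less_one[OF assms, of 0] by auto

lemma survival_prob_eq_\<tau>: "0 \<le> t \<Longrightarrow> survival_prob P Z t = \<tau> t powr (- 1 / \<nu>)"
  using survival_prob_bounds[of t] \<nu> by (simp add: \<tau>_def powr_powr)

lemma \<tau>_ge_one: "0 \<le> t \<Longrightarrow> 1 \<le> \<tau> t"
  using survival_prob_bounds[of t] \<nu> powr_le1[of \<nu> "survival_prob P Z t"]
  by (simp add: \<tau>_def powr_minus one_le_inverse_iff)

text \<open>The implicit equation at s = 0, where B = 1 and the right-hand side reduces to 1 +
  \<nu>^2 C t.\<close>

lemma \<tau>_equation:
  assumes t: "0 \<le> t"
  shows "\<tau> t + C * \<nu> * ln (survival_prob P Z t) - 1 = \<nu>\<^sup>2 * C * t" and "\<tau> t - C * ln (\<tau> t) = 1 + \<nu>\<^sup>2 * C * t"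
proof -
  have "1 - transition_pgf P Z t 0 = survival_prob P Z t" using survival_prob_eq(2)[OF t] by simp
  then show 1: "\<tau> t + C * \<nu> * ln (survival_prob P Z t) - 1 = \<nu>\<^sup>2 * C * t"
    using pgf_implicit_equation[OF t, of 0] by (simp add: \<tau>_def)
  have "ln (\<tau> t) = - \<nu> * ln (survival_prob P Z t)"
    using survival_prob_bounds[OF t] by (simp add: \<tau>_def ln_powr)
  then show "\<tau> t - C * ln (\<tau> t) = 1 + \<nu>\<^sup>2 * C * t" using 1 by simp
qed

lemma \<tau>_lower: "0 \<le> t \<Longrightarrow> \<nu>\<^sup>2 * C * t \<le> \<tau> t"
proof -
  assume t: "0 \<le> t"
  have "0 \<le> C * ln (\<tau> t)" using C \<tau>_ge_one[OF t] by simp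
  then show ?thesis using \<tau>_equation(2)[OF t] by linarith
qed

lemma \<nu>C_pos: "0 < \<nu>\<^sup>2 * C"
  using \<nu> C by simp

lemma \<tau>_at_top: "filterlim \<tau> at_top at_top"
proof (rule filterlim_at_top_mono)
  show "filterlim (\<lambda>t. \<nu>\<^sup>2 * C * t) at_top at_top"
    by (rule filterlim_tendsto_pos_mult_at_top[OF tendsto_const \<nu>C_pos filterlim_ident])
  show "\<forall>\<^sub>F t in at_top. \<nu>\<^sup>2 * C * t \<le> \<tau> t"
    using eventually_ge_at_top[of 0] by eventually_elim (rule \<tau>_lower)
qed

lemma survival_prob_tendsto: "(survival_prob P Z \<longlongrightarrow> 0) at_top"
proof -
  have "((\<lambda>t. \<tau> t powr (- 1 / \<nu>)) \<longlongrightarrow> 0) at_top"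
    by (rule tendsto_neg_powr[OF _ \<tau>_at_top]) (use \<nu> in simp)
  moreover have "\<forall>\<^sub>F t in at_top. \<tau> t powr (- 1 / \<nu>) = survival_prob P Z t"
    using eventually_ge_at_top[of 0] by eventually_elim (simp add: survival_prob_eq_\<tau>)
  ultimately show ?thesis by (rule Lim_transform_eventually)
qed

text \<open>In the time variable t, \<tau> - C ln \<tau> has constant increments. As C < 1 \<le>
  \<tau>, this forces \<tau> to be nondecreasing, and ln v \<le> v - 1 bounds the relative increment
  by \<nu>^2 C t / (\<tau> u - C), which vanishes as u grows.\<close>

lemma survival_prob_ratio:
  assumes t: "0 \<le> t"
  shows "((\<lambda>u. survival_prob P Z (t + u) / survival_prob P Z u) \<longlongrightarrow> 1) at_top"
proof -
  let ?R = "\<lambda>u. \<tau> (t + u) / \<tau> u"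
  have R: "1 \<le> ?R u \<and> ?R u \<le> 1 + \<nu>\<^sup>2 * C * t / (\<tau> u - C)" if u: "0 \<le> u" for u
  proof -
    define x y where "x = \<tau> u" and "y = \<tau> (t + u)"
    have x: "1 \<le> x" and y: "1 \<le> y" using \<tau>_ge_one t u by (auto simp: x_def y_def)
    have eq: "y - x = \<nu>\<^sup>2 * C * t + C * (ln y - ln x)"
      using \<tau>_equation(2)[OF u] \<tau>_equation(2)[of "t + u"] t u by (simp add: x_def y_def algebra_simps)
    have c0: "0 \<le> \<nu>\<^sup>2 * C * t" using \<nu>C_pos t by simp
    have xy: "x \<le> y"
    proof (rule ccontr)
      assume "\<not> x \<le> y"
      then have lt: "y < x" by simp
      have "ln x - ln y = ln (x / y)" using x y by (simp add: ln_div)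
      also have "\<dots> \<le> x / y - 1" using x y by (intro ln_le_minus_one) auto
      also have "\<dots> = (x - y) / y" using y by (simp add: field_simps)
      also have "\<dots> \<le> (x - y) / 1" using lt y by (intro divide_left_mono) auto
      finally have "C * (ln x - ln y) \<le> C * (x - y)" using C by (intro mult_left_mono) auto
      moreover have "C * (x - y) < 1 * (x - y)" using C lt by (intro mult_strict_right_mono) auto
      ultimately show False using eq c0 by (simp add: algebra_simps)
    qed
    have "ln y - ln x = ln (y / x)" using x y by (simp add: ln_div)
    also have "\<dots> \<le> y / x - 1" using x y by (intro ln_le_minus_one) auto
    finally have "ln y - ln x \<le> y / x - 1" .
    moreover define v where "v = y / x - 1"
    ultimately have l: "C * (ln y - ln x) \<le> C * v" using C by (intro mult_left_mono) auto
    have "v * x = y - x" using x by (simp add: v_def field_simps)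
    then have "v * (x - C) \<le> \<nu>\<^sup>2 * C * t" using eq l by (simp add: right_diff_distrib mult.commute)
    then have "v \<le> \<nu>\<^sup>2 * C * t / (x - C)" using x C by (subst pos_le_divide_eq) auto
    then have "y / x - 1 \<le> \<nu>\<^sup>2 * C * t / (x - C)" by (simp add: v_def)
    then show ?thesis using x xy by (simp add: x_def[symmetric] y_def[symmetric])
  qed
  have "((\<lambda>u. 1 + \<nu>\<^sup>2 * C * t / (\<tau> u - C)) \<longlongrightarrow> 1 + 0) at_top"
  proof (rule tendsto_add[OF tendsto_const real_tendsto_divide_at_top[OF tendsto_const]])
    show "filterlim (\<lambda>u. \<tau> u - C) at_top at_top"
      using filterlim_tendsto_add_at_top[OF tendsto_const[of "- C"] \<tau>_at_top] by simp
  qed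
  then have up: "((\<lambda>u. 1 + \<nu>\<^sup>2 * C * t / (\<tau> u - C)) \<longlongrightarrow> 1) at_top" by simp
  have "(?R \<longlongrightarrow> 1) at_top"
  proof (rule tendsto_sandwich[OF _ _ tendsto_const up])
    show "\<forall>\<^sub>F u in at_top. 1 \<le> ?R u"
      using eventually_ge_at_top[of 0] by eventually_elim (use R in blast)
    show "\<forall>\<^sub>F u in at_top. ?R u \<le> 1 + \<nu>\<^sup>2 * C * t / (\<tau> u - C)"
      using eventually_ge_at_top[of 0] by eventually_elim (use R in blast)
  qed
  then have "((\<lambda>u. ?R u powr (- 1 / \<nu>)) \<longlongrightarrow> 1 powr (- 1 / \<nu>)) at_top"
    by (intro tendsto_intros) auto
  moreover have "\<forall>\<^sub>F u in at_top. ?R u powr (- 1 / \<nu>) = survival_prob P Z (t + u) / survival_prob P Z u"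
    using eventually_ge_at_top[of 0]
  proof eventually_elim
    case (elim u)
    then show ?case
      using t \<tau>_ge_one[of u] \<tau>_ge_one[of "t + u"] by (simp add: survival_prob_eq_\<tau> powr_divide)
  qed
  ultimately have "((\<lambda>u. survival_prob P Z (t + u) / survival_prob P Z u) \<longlongrightarrow> 1 powr (- 1 / \<nu>)) at_top"
    by (rule Lim_transform_eventually)
  then show ?thesis by simp
qed

lemma laplace_transform_W:
  assumes Q: "markov_Q_process P Z N W E" and W0: "AE \<omega> in N. W 0 \<omega> = 1"
    and t: "0 \<le> t" and z: "0 < Re z"
    and D: "(transition_pgf P Z t has_field_derivative D) (at (exp (- of_real (survival_prob P Z t) * z)))"
  shows "laplace_transform (distr N borel (\<lambda>\<omega>. survival_prob P Z t * real (W t \<omega>))) z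
    = exp (- of_real (survival_prob P Z t) * z) * D"
proof -
  interpret Q: markov_Q_process P Z N W E by fact
  let ?q = "survival_prob P Z t"
  let ?s = "exp (- of_real ?q * z)"
  note [measurable] = Q.measurable_X[OF t]
  have q: "0 < ?q" by (rule survival_prob_bounds[OF t])
  have s: "norm ?s < 1" using q z by (simp add: norm_exp_eq_Re)
  have "laplace_transform (distr N borel (\<lambda>\<omega>. ?q * real (W t \<omega>))) z = (CLINT \<omega>|N. ?s ^ W t \<omega>)"
    unfolding laplace_transform_def
    by (subst integral_distr) (auto simp: exp_of_nat_mult[symmetric] mult_ac intro!: Bochner_Integration.integral_cong)
  moreover have "(\<lambda>j. of_real \<P>(\<omega> in N. W t \<omega> = j) * ?s ^ j) sums (CLINT \<omega>|N. ?s ^ W t \<omega>)"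
    by (rule Q.sums_expectation_nat[where B = 1]) (use s in \<open>auto simp: norm_power power_le_one\<close>)
  moreover have "\<P>(\<omega> in N. W t \<omega> = j) = real j * trans_prob P Z t 1 j" for j
    unfolding Q.prob_W_eq[OF t W0]
    by (rule Q_trans_prob_one[OF t survival_prob_tendsto survival_prob_bounds(1) survival_prob_ratio[OF t]])
  ultimately have 1: "(\<lambda>j. of_real (real j * trans_prob P Z t 1 j) * ?s ^ j)
      sums laplace_transform (distr N borel (\<lambda>\<omega>. ?q * real (W t \<omega>))) z"
    by simp
  obtain D' where D': "(transition_pgf P Z t has_field_derivative D') (at ?s)"
    "(\<lambda>j. of_real (real j * trans_prob P Z t 1 j) * ?s ^ j) sums (?s * D')"
    by (rule pgf_has_field_derivative[OF t s])
  have "D' = D" by (rule DERIV_unique[OF D'(1) D])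
  then show ?thesis using sums_unique2[OF 1 D'(2)] by simp
qed

lemma laplace_transform_W_estimate:
  fixes z :: complex and t :: real
  defines "g \<equiv> ln (\<tau> t) / \<tau> t * (norm z powr (\<nu> / 2) + norm z)"
    and "K \<equiv> 13 + (1 + 1 / \<nu>) * (24 * (2 + 4 / \<nu>) + 20)"
  assumes Q: "markov_Q_process P Z N W E" and W0: "AE \<omega> in N. W 0 \<omega> = 1"
    and t: "0 \<le> t" and z: "0 < Re z" and \<tau>: "8 \<le> \<tau> t" and g: "g \<le> 1 / (2 * K)"
  shows "norm (laplace_transform (distr N borel (\<lambda>\<omega>. survival_prob P Z t * real (W t \<omega>))) z
      - laplace_limit \<nu> (- of_real \<nu> * Ln z)) \<le> 2 * K * g * min 1 (norm z powr (- 1 - \<nu>))"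
proof -
  let ?q = "survival_prob P Z t"
  let ?s = "exp (- of_real ?q * z)"
  have q: "0 < ?q" by (rule survival_prob_bounds[OF t])
  have s: "norm ?s < 1" using q z by (simp add: norm_exp_eq_Re)
  obtain D where D: "(transition_pgf P Z t has_field_derivative D) (at ?s)"
    by (rule pgf_has_field_derivative[OF t s])
  have F: "norm (transition_pgf P Z t ?s) < 1" by (rule norm_pgf_less_one[OF t s])
  have A: "0 < Re (1 - transition_pgf P Z t ?s)" using complex_Re_le_cmod[of "transition_pgf P Z t ?s"] F by simp
  have A2: "norm (1 - transition_pgf P Z t ?s) \<le> 2" using norm_triangle_ineq4[of 1 "transition_pgf P Z t ?s"] F by simp
  have g0: "0 \<le> 2 * K * g"
  proof -
    have "0 \<le> ln (\<tau> t) / \<tau> t" using \<tau>_ge_one[OF t] by simp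
    then have "0 \<le> g" unfolding g_def by (intro mult_nonneg_nonneg add_nonneg_nonneg) auto
    moreover have "0 \<le> K" unfolding K_def using \<nu> by simp
    ultimately show ?thesis by simp
  qed
  have "norm (?s * D - laplace_limit \<nu> (- of_real \<nu> * Ln z))
      \<le> 2 * K * g * norm (laplace_limit \<nu> (- of_real \<nu> * Ln z))"
    unfolding g_def K_def \<tau>_def
  proof (rule laplace_estimate[OF \<nu> C q _ z _ A A2])
    show "8 \<le> ?q powr - \<nu>" using \<tau> by (simp add: \<tau>_def)
    show "ln (?q powr - \<nu>) / ?q powr - \<nu> * (cmod z powr (\<nu> / 2) + cmod z)
        \<le> 1 / (2 * (13 + (1 + 1 / \<nu>) * (24 * (2 + 4 / \<nu>) + 20)))"
      using g by (simp only: g_def K_def \<tau>_def)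
    show "exp (- of_real \<nu> * Ln (1 - transition_pgf P Z t ?s)) + of_real (C * \<nu>) * Ln (1 - transition_pgf P Z t ?s)
        = exp (- of_real \<nu> * Ln (1 - ?s)) + of_real (C * \<nu>) * Ln (1 - ?s) + of_real (?q powr - \<nu> + C * \<nu> * ln ?q - 1)"
      using pgf_implicit_equation_complex[OF t s] \<tau>_equation(1)[OF t] by (simp only: \<tau>_def)
    show "D * (exp (- of_real (1 + \<nu>) * Ln (1 - transition_pgf P Z t ?s)) * (1 - of_real C * exp (of_real \<nu> * Ln (1 - transition_pgf P Z t ?s))))
        = exp (- of_real (1 + \<nu>) * Ln (1 - ?s)) * (1 - of_real C * exp (of_real \<nu> * Ln (1 - ?s)))"
      by (rule pgf_derivative_equation[OF t s D])
  qed
  also have "\<dots> \<le> 2 * K * g * min 1 (norm z powr (- 1 - \<nu>))"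
    by (rule mult_left_mono[OF norm_laplace_limit_Ln_le[OF \<nu> z] g0])
  finally show ?thesis unfolding laplace_transform_W[OF Q W0 t z D] .
qed

theorem cdf_W_rate:
  assumes Q: "markov_Q_process P Z N W E" and W0: "AE \<omega> in N. W 0 \<omega> = 1"
    and \<mu>: "real_distribution \<mu>" "measure \<mu> {..<0} = 0"
    and lap: "\<And>\<theta>. 0 \<le> \<theta> \<Longrightarrow> (LINT x|\<mu>. exp (- \<theta> * x)) = 1 / (1 + \<theta> powr \<nu>) powr (1 + 1 / \<nu>)"
  obtains K where "\<forall>\<^sub>F t in at_top. \<forall>x.
    \<bar>\<P>(\<omega> in N. survival_prob P Z t * real (W t \<omega>) \<le> x) - cdf \<mu> x\<bar> \<le> K * (ln (\<tau> t) / \<tau> t)"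
proof -
  interpret Q: markov_Q_process P Z N W E by fact
  interpret \<mu>: real_distribution \<mu> by fact
  have \<mu>_eq: "laplace_transform \<mu> z = laplace_limit \<nu> (- of_real \<nu> * Ln z)" if "0 < Re z" for z
    by (rule laplace_transform_eq_limit[OF \<mu> \<nu> _ that]) (rule lap)
  obtain m where m: "\<And>x y. x \<le> y \<Longrightarrow> cdf \<mu> y - cdf \<mu> x \<le> m * (y - x)"
  proof (rule cdf_limit_lipschitz[OF \<mu> \<nu> \<mu>_eq])
    fix m assume "\<And>x y. x \<le> y \<Longrightarrow> cdf \<mu> y - cdf \<mu> x \<le> m * (y - x)"
    then show thesis by (rule that)
  qed
  obtain u0 where u0: "0 < u0" "measure fejer_distribution {u. u0 < \<bar>u\<bar>} \<le> 1 / 4"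
    using real_distribution_small_tail[OF real_distribution_fejer, of "1/4"] by auto
  define K0 where "K0 = 2 + 4 * u0"
  define K1 where "K1 = 13 + (1 + 1 / \<nu>) * (24 * (2 + 4 / \<nu>) + 20)"
  have K1: "0 < K1" unfolding K1_def using \<nu> by (intro add_pos_nonneg) auto
  \<comment> \<open>The threshold for g under which the transform estimate is available.\<close>
  define e where "e = 1 / (2 * K1)"
  have e: "0 < e" using K1 by (simp add: e_def)
  define J where "J = (LBINT x. laplace_weight \<nu> x)"
  have lim: "((\<lambda>t. ln (\<tau> t) / \<tau> t) \<longlongrightarrow> 0) at_top"
  proof (rule filterlim_compose[OF _ \<tau>_at_top])
    show "((\<lambda>x::real. ln x / x) \<longlongrightarrow> 0) at_top" by real_asymp
  qed
  show thesis
  proof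
    have "\<forall>\<^sub>F t in at_top. ln (\<tau> t) / \<tau> t < e / 2" using lim e by (intro order_tendstoD) auto
    moreover have "\<forall>\<^sub>F t in at_top. 8 \<le> \<tau> t" using \<tau>_at_top by (simp add: filterlim_at_top)
    ultimately show "\<forall>\<^sub>F t in at_top. \<forall>x.
        \<bar>\<P>(\<omega> in N. survival_prob P Z t * real (W t \<omega>) \<le> x) - cdf \<mu> x\<bar>
          \<le> K0 * (4 * K1 * J + 4 * m / e) * (ln (\<tau> t) / \<tau> t)"
      using eventually_ge_at_top[of 0]
    proof eventually_elim
      case (elim t)
      define \<rho> where "\<rho> = distr N borel (\<lambda>\<omega>. survival_prob P Z t * real (W t \<omega>))"
      define l where "l = ln (\<tau> t) / \<tau> t"
      note [measurable] = Q.measurable_X[OF elim(3)]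
      have l: "0 < l" "l < e / 2" using elim by (auto simp: l_def)
      have \<rho>: "real_distribution \<rho>" unfolding \<rho>_def by (rule Q.real_distribution_distr) simp
      interpret \<rho>: real_distribution \<rho> by fact
      have \<rho>0: "measure \<rho> {..<0} = 0"
      proof -
        have "(\<lambda>\<omega>. survival_prob P Z t * real (W t \<omega>)) -` {..<0} \<inter> space N = {}"
          using survival_prob_bounds[OF elim(3)] by (auto simp: mult_less_0_iff)
        then show ?thesis unfolding \<rho>_def by (subst measure_distr) auto
      qed
      \<comment> \<open>The estimate needs g r \<le> e. Since r^(\<nu>/2) \<le> 1 + r, g r \<le> l
        (1 + 2 T) = l + e / 2, which is below e because l < e / 2. With this T, the term m / T is a
        multiple of l, matching the rate.\<close>
      define T where "T = e / (4 * l)"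
      have T: "0 < T" using e l by (simp add: T_def)
      define g where "g r = l * (r powr (\<nu> / 2) + r)" for r
      have g: "g r \<le> e" if "0 \<le> r" "r < T" for r
      proof -
        have "r powr (\<nu> / 2) \<le> 1 + r"
        proof (cases "r \<le> 1")
          case True
          then have "r powr (\<nu> / 2) \<le> 1" using that \<nu> by (intro powr_le1) auto
          then show ?thesis using that by simp
        next
          case False
          then have "r powr (\<nu> / 2) \<le> r powr 1" using \<nu> by (intro powr_mono) auto
          then show ?thesis using False by simp
        qed
        then have "g r \<le> l * (1 + 2 * T)"
          unfolding g_def using l that by (intro mult_left_mono) auto
        also have "\<dots> = l + e / 2" using l by (simp add: T_def field_simps)
        finally show ?thesis using l by simp
      qed
      have char_le: "norm (char \<rho> x - char \<mu> x) \<le> \<bar>x\<bar> * (4 * K1 * l * laplace_weight \<nu> x)" if x: "\<bar>x\<bar> < T" for x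
      \<comment> \<open>At 0 both characteristic functions are 1; elsewhere the bound is continuous
        in r, as the boundary passage requires.\<close>
      proof (cases "x = 0")
        case True
        then show ?thesis by (simp add: \<rho>.char_zero \<mu>.char_zero)
      next
        case False
        have "norm (char \<rho> x - char \<mu> x) \<le> 2 * K1 * g \<bar>x\<bar> * min 1 (\<bar>x\<bar> powr (- 1 - \<nu>))"
        proof (rule limit_norm_le_of_vertical[where T = T
              and \<phi> = "\<lambda>z. laplace_transform \<rho> z - laplace_transform \<mu> z"])
          show "(\<lambda>n. laplace_transform \<rho> (Complex (1 / real (Suc n)) (- x)) - laplace_transform \<mu> (Complex (1 / real (Suc n)) (- x)))
              \<longlonglongrightarrow> char \<rho> x - char \<mu> x"
            by (intro tendsto_diff \<rho>.laplace_transform_tendsto_char \<mu>.laplace_transform_tendsto_char \<rho>0 \<mu>)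
          show "isCont (\<lambda>r. 2 * K1 * g r * min 1 (r powr (- 1 - \<nu>))) \<bar>x\<bar>"
            unfolding g_def using False by (intro continuous_intros) auto
          show "norm (laplace_transform \<rho> z - laplace_transform \<mu> z) \<le> 2 * K1 * g (norm z) * min 1 (norm z powr (- 1 - \<nu>))"
            if z: "0 < Re z" "norm z < T" for z
            unfolding \<mu>_eq[OF z(1)] \<rho>_def g_def l_def K1_def
            by (rule laplace_transform_W_estimate[OF Q W0 elim(3) z(1) elim(2)])
              (use g[of "norm z"] z in \<open>simp add: g_def l_def K1_def e_def\<close>)
        qed fact
        also have "\<dots> = 2 * K1 * l * ((\<bar>x\<bar> powr (\<nu> / 2) + \<bar>x\<bar>) * min 1 (\<bar>x\<bar> powr (- 1 - \<nu>)))"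
          by (simp add: g_def)
        also have "\<dots> \<le> 2 * K1 * l * (\<bar>x\<bar> * (2 * laplace_weight \<nu> x))"
          using K1 l False by (intro mult_left_mono laplace_weight_bound(1)[OF \<nu>]) auto
        finally show ?thesis by (simp add: mult_ac)
      qed
      show ?case
      proof
        fix x
        have "\<bar>cdf \<rho> x - cdf \<mu> x\<bar> \<le> K0 * ((LBINT x. 4 * K1 * l * laplace_weight \<nu> x) + m / T)"
          unfolding K0_def by (rule esseen_smoothing[OF u0 \<rho> \<mu>(1) m T _ _ char_le])
            (use K1 l \<nu> in \<open>auto intro!: integrable_mult_right integrable_laplace_weight mult_nonneg_nonneg laplace_weight_nonneg\<close>)
        also have "(LBINT x. 4 * K1 * l * laplace_weight \<nu> x) = 4 * K1 * l * J" by (simp add: J_def)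
        also have "m / T = 4 * m * l / e" by (simp add: T_def)
        also have "K0 * (4 * K1 * l * J + 4 * m * l / e) = K0 * (4 * K1 * J + 4 * m / e) * l"
          by (simp add: algebra_simps)
        also have "cdf \<rho> x = \<P>(\<omega> in N. survival_prob P Z t * real (W t \<omega>) \<le> x)"
          unfolding cdf_def \<rho>_def by (subst measure_distr) (auto intro!: arg_cong[where f = Q.prob])
        finally show "\<bar>\<P>(\<omega> in N. survival_prob P Z t * real (W t \<omega>) \<le> x) - cdf \<mu> x\<bar>
          \<le> K0 * (4 * K1 * J + 4 * m / e) * (ln (\<tau> t) / \<tau> t)" by (simp add: l_def)
      qed
    qed
  qed
qed

text \<open>ln x / x decreases from exp 1 on, so the linear lower bound c t \<le> \<tau> t suffices,
  and c \<le> 1 gives ln (c t) \<le> ln t. No upper bound for \<tau> is involved.\<close>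

lemma ln_\<tau>_over_\<tau>:
  "\<forall>\<^sub>F t in at_top. ln (\<tau> t) / \<tau> t \<le> 1 / (\<nu>\<^sup>2 * C) * (ln t / t)"
proof -
  define c where "c = \<nu>\<^sup>2 * C"
  have c: "0 < c" "c \<le> 1" using \<nu> C by (auto simp: c_def intro!: mult_le_one power_le_one)
  show ?thesis
    using eventually_ge_at_top[of "exp 1 / c"] eventually_ge_at_top[of 1]
  proof eventually_elim
    case (elim t)
    have "exp 1 \<le> c * t" using elim c by (simp add: field_simps)
    moreover have "c * t \<le> \<tau> t" using \<tau>_lower[of t] elim by (simp add: c_def)
    ultimately have "ln (\<tau> t) / \<tau> t \<le> ln (c * t) / (c * t)" by (rule ln_x_over_x_mono)
    also have "\<dots> \<le> ln t / (c * t)"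
      using c elim by (intro divide_right_mono) (auto intro!: ln_mono mult_left_le_one_le)
    also have "\<dots> = 1 / c * (ln t / t)" by simp
    finally show ?case by (simp add: c_def)
  qed
qed

end

theorem corollary1:
  fixes P :: "nat \<Rightarrow> 'a measure" and Z :: "real \<Rightarrow> 'a \<Rightarrow> nat"
    and S :: "nat set" and a :: "nat \<Rightarrow> real"
    and N :: "'b measure" and W :: "real \<Rightarrow> 'b \<Rightarrow> nat" and E :: "nat set"
    and \<nu> :: real and \<Lambda> \<Lambda>' L \<delta> :: "real \<Rightarrow> real"
    and \<mu> :: "real measure"
  assumes "markov_branching_process P Z S a"
    and "critical S a"
    and "0 < \<nu>" and "\<nu> < 1"
    and "\<And>y. y \<in> {0<..1} \<Longrightarrow> infinitesimal_gf S a (1 - y) = y * \<Lambda> y"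
    and "\<And>y. y \<in> {0<..1} \<Longrightarrow> \<Lambda> y = y powr \<nu> * L (1 / y)"
    and "slowly_varying L"
    and "\<And>y. y \<in> {0<..1} \<Longrightarrow> (\<Lambda> has_real_derivative \<Lambda>' y) (at y within {0<..1})"
    and "\<And>y. y \<in> {0<..1} \<Longrightarrow> y * \<Lambda>' y / \<Lambda> y = \<nu> + \<delta> y"
    and "continuous_on {0<..1} \<delta>"
    and "(\<delta> \<longlongrightarrow> 0) (at_right 0)"
    and "\<And>y. y \<in> {0<..1} \<Longrightarrow> \<delta> y = \<Lambda> y"
    and "markov_Q_process P Z N W E"
    and "AE \<omega> in N. W 0 \<omega> = 1"
    and "real_distribution \<mu>" and "measure \<mu> {..<0} = 0"
    and "\<And>\<theta>. 0 \<le> \<theta> \<Longrightarrow>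
           (LINT x|\<mu>. exp (- \<theta> * x)) = 1 / (1 + \<theta> powr \<nu>) powr (1 + 1 / \<nu>)"
  shows "(\<lambda>t. SUP x\<in>{0<..}. \<bar>\<P>(\<omega> in N. survival_prob P Z t * real (W t \<omega>) \<le> x) - cdf \<mu> x\<bar>)
           \<in> O[at_top](\<lambda>t. ln t / t)"
proof -
  note \<nu> = assms(3,4)
  have pos: "0 < \<Lambda> y" if "y \<in> {0<..1}" for y
    using assms(6)[OF that] assms(7) that by (simp add: slowly_varying_def)
  have ode: "y * \<Lambda>' y / \<Lambda> y = \<nu> + \<Lambda> y" if "y \<in> {0<..1}" for y
    using assms(9)[OF that] assms(12)[OF that] by simp
  obtain C where C: "0 < C" "C < 1"
    "\<And>y. y \<in> {0<..1} \<Longrightarrow> \<Lambda> y = \<nu> * C * y powr \<nu> / (1 - C * y powr \<nu>)"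
  proof (rule regular_variation_ode_explicit[OF \<nu>(1) pos assms(8) ode])
    fix C assume "0 < C" "C < 1" "\<And>y. y \<in> {0<..1} \<Longrightarrow> \<Lambda> y = \<nu> * C * y powr \<nu> / (1 - C * y powr \<nu>)"
    then show thesis by (rule that)
  qed
  interpret explicit_branching_process P Z S a \<nu> C
  proof (intro explicit_branching_process.intro explicit_branching_process_axioms.intro assms(1) \<nu> C)
    fix x :: real assume "0 \<le> x" "x < 1"
    then show "infinitesimal_gf S a x = \<nu> * C * (1 - x) powr (1 + \<nu>) / (1 - C * (1 - x) powr \<nu>)"
      using assms(5)[of "1 - x"] C(3)[of "1 - x"] by (simp add: powr_add)
  qed
  let ?d = "\<lambda>t x. \<bar>\<P>(\<omega> in N. survival_prob P Z t * real (W t \<omega>) \<le> x) - cdf \<mu> x\<bar>"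
  obtain K where K: "\<forall>\<^sub>F t in at_top. \<forall>x. ?d t x \<le> K * (ln (\<tau> t) / \<tau> t)"
    by (rule cdf_W_rate[OF assms(13-17)])
  show ?thesis
  proof (rule bigoI)
    show "\<forall>\<^sub>F t in at_top. norm (SUP x\<in>{0<..}. ?d t x) \<le> \<bar>K\<bar> * (1 / (\<nu>\<^sup>2 * C)) * norm (ln t / t)"
      using K ln_\<tau>_over_\<tau> eventually_ge_at_top[of 1]
    proof eventually_elim
      case (elim t)
      let ?b = "\<bar>K\<bar> * (1 / (\<nu>\<^sup>2 * C)) * norm (ln t / t)"
      have b: "?d t x \<le> ?b" for x
      proof -
        have "?d t x \<le> K * (ln (\<tau> t) / \<tau> t)" using elim(1) by blast
        also have "\<dots> \<le> \<bar>K\<bar> * (ln (\<tau> t) / \<tau> t)"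
          using \<tau>_ge_one[of t] elim(3) by (intro mult_right_mono) auto
        also have "\<dots> \<le> \<bar>K\<bar> * (1 / (\<nu>\<^sup>2 * C) * (ln t / t))"
          by (rule mult_left_mono[OF elim(2)]) simp
        finally show ?thesis using elim(3) by simp
      qed
      have "(SUP x\<in>{0<..}. ?d t x) \<le> ?b" by (rule cSUP_least) (use b in auto)
      \<comment> \<open>The Landau symbol concerns the absolute value; comparison with the value at
        one point shows that the supremum is nonnegative.\<close>
      moreover have "?d t 1 \<le> (SUP x\<in>{0<..}. ?d t x)"
        by (rule cSUP_upper) (use b in \<open>auto intro!: bdd_aboveI\<close>)
      ultimately show ?case by simp
    qed
  qed
qed

end
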